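(* Let $k, d \in \mathbb{N}$ with $k \geq 1$, and let $\ell = \left\lfloor \frac{d-1}{k+1} \right\rfloor$. Then every finite graph $G$ with maximum average degree $\mathrm{mad}(G) \leq 2\left(k + \frac{d}{d+k+1}\right)$ has a decomposition (partition of its edge set) into $k+1$ pseudoforests such that one of these pseudoforests, $F$, satisfies all of the following: (i) $F$ is acyclic; (ii) every connected component $K$ of $F$ has $e(K) \leq d$; (iii) every connected component $K$ of $F$ has $\mathrm{diam}(K) \leq 2\ell + 2$, and if $d \equiv 1 \pmod{k+1}$ then $\mathrm{diam}(K) \leq 2\ell + 1$; (iv) for every $z \in \mathbb{N}$ and every connected component $K$ of $F$ with $e(K) \geq d - z(k-1) + 1$, we have $\mathrm{diam}(K) \leq 2z$.
   Context: A pseudoforest is a graph in which every connected component contains at most one cycle. For a graph $H$, $e(H)$ and $v(H)$ denote its numbers of edges and vertices. The maximum average degree is $\mathrm{mad}(G) = \max\{ 2e(H)/v(H) : H \subseteq G,\ V(H) \neq \varnothing\}$. The diameter $\mathrm{diam}(K)$ of a connected graph $K$ is the maximum over pairs of vertices of the minimum number of edges of a path joining them. The paper remarks the result holds also when $G$ may have loops and parallel edges. *)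

theory Defs
  imports Complex_Main "HOL-Number_Theory.Cong"
begin

text \<open>
  Undirected graphs in which loops and parallel edges are allowed: an edge \<open>e\<close> is a loop if
  \<open>ends G e\<close> is a singleton, and two edges with the same set of ends are parallel.  The simple
  graphs are the case where \<open>ends G\<close> is injective on \<open>edges G\<close> and all its values there have
  two elements.
\<close>

record ('v, 'e) multigraph =
  verts :: "'v set"
  edges :: "'e set"
  ends :: "'e \<Rightarrow> 'v set"

definition wf_multigraph :: "('v, 'e) multigraph \<Rightarrow> bool" where
  "wf_multigraph G \<longleftrightarrow>
     (\<forall>e\<in>edges G. ends G e \<subseteq> verts G \<and> (card (ends G e) = 1 \<or> card (ends G e) = 2))"

definition finite_multigraph :: "('v, 'e) multigraph \<Rightarrow> bool" where
  "finite_multigraph G \<longleftrightarrow> wf_multigraph G \<and> finite (verts G) \<and> finite (edges G)"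

text \<open>
  A subgraph keeps the whole function \<open>ends\<close>, so that a subgraph of \<open>G\<close> is determined by its
  vertices and edges, and equality of subgraphs is equality of records.
\<close>

definition subgraph :: "('v, 'e) multigraph \<Rightarrow> ('v, 'e) multigraph \<Rightarrow> bool" where
  "subgraph H G \<longleftrightarrow>
     wf_multigraph H \<and> verts H \<subseteq> verts G \<and> edges H \<subseteq> edges G \<and> ends H = ends G"

text \<open>The maximum ranges over the empty set only if \<open>G\<close> has no vertices.\<close>

definition mad :: "('v, 'e) multigraph \<Rightarrow> real" where
  "mad G = Max {2 * real (card (edges H)) / real (card (verts H)) | H.
                  subgraph H G \<and> verts H \<noteq> {}}"

definition walk :: "('v, 'e) multigraph \<Rightarrow> 'v list \<Rightarrow> 'e list \<Rightarrow> bool" where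
  "walk G vs es \<longleftrightarrow>
     length vs = length es + 1 \<and> set vs \<subseteq> verts G \<and> set es \<subseteq> edges G \<and>
     (\<forall>i<length es. ends G (es ! i) = {vs ! i, vs ! (i + 1)})"

definition path :: "('v, 'e) multigraph \<Rightarrow> 'v list \<Rightarrow> 'e list \<Rightarrow> bool" where
  "path G vs es \<longleftrightarrow> walk G vs es \<and> distinct vs"

definition path_between ::
    "('v, 'e) multigraph \<Rightarrow> 'v \<Rightarrow> 'v \<Rightarrow> 'v list \<Rightarrow> 'e list \<Rightarrow> bool" where
  "path_between G u v vs es \<longleftrightarrow> path G vs es \<and> hd vs = u \<and> last vs = v"

text \<open>
  Cycles are subgraphs, so that the different closed walks around a cycle (different starting
  points or directions) are not counted as different cycles.  A loop is a cycle of length 1 and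
  a pair of parallel edges a cycle of length 2; \<open>distinct es\<close> is needed to prevent a single edge
  traversed back and forth from being a cycle.
\<close>

definition cycles :: "('v, 'e) multigraph \<Rightarrow> ('v, 'e) multigraph set" where
  "cycles G = {\<lparr>verts = set vs, edges = set es, ends = ends G\<rparr> | vs es.
      walk G vs es \<and> es \<noteq> [] \<and> hd vs = last vs \<and> distinct (tl vs) \<and> distinct es}"

definition acyclic_graph :: "('v, 'e) multigraph \<Rightarrow> bool" where
  "acyclic_graph G \<longleftrightarrow> cycles G = {}"

definition connected_graph :: "('v, 'e) multigraph \<Rightarrow> bool" where
  "connected_graph G \<longleftrightarrow>
     verts G \<noteq> {} \<and> (\<forall>u\<in>verts G. \<forall>v\<in>verts G. \<exists>vs es. path_between G u v vs es)"

definition component :: "('v, 'e) multigraph \<Rightarrow> ('v, 'e) multigraph \<Rightarrow> bool" where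
  "component K G \<longleftrightarrow>
     subgraph K G \<and> connected_graph K \<and>
     (\<forall>K'. subgraph K' G \<and> connected_graph K' \<and> subgraph K K' \<longrightarrow> K' = K)"

definition graph_dist :: "('v, 'e) multigraph \<Rightarrow> 'v \<Rightarrow> 'v \<Rightarrow> nat" where
  "graph_dist G u v = (LEAST n. \<exists>vs es. path_between G u v vs es \<and> length es = n)"

definition diam :: "('v, 'e) multigraph \<Rightarrow> nat" where
  "diam G = Max {graph_dist G u v | u v. u \<in> verts G \<and> v \<in> verts G}"

definition pseudoforest :: "('v, 'e) multigraph \<Rightarrow> bool" where
  "pseudoforest G \<longleftrightarrow>
     (\<forall>K. component K G \<longrightarrow> (\<forall>C\<in>cycles K. \<forall>C'\<in>cycles K. C = C'))"

text \<open>
  The parts of a decomposition are taken as spanning subgraphs.  A part may have no edges, and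
  edgeless parts may occur repeatedly in the list.
\<close>

definition decomposition :: "('v, 'e) multigraph \<Rightarrow> ('v, 'e) multigraph list \<Rightarrow> bool" where
  "decomposition G Hs \<longleftrightarrow>
     (\<forall>H\<in>set Hs. subgraph H G \<and> verts H = verts G) \<and>
     (\<Union>H\<in>set Hs. edges H) = edges G \<and>
     (\<forall>i<length Hs. \<forall>j<length Hs. i \<noteq> j \<longrightarrow> edges (Hs ! i) \<inter> edges (Hs ! j) = {})"

end

theory Submission
  imports Defs "HOL-Library.Multiset"
begin

text \<open>
  Condition (iv), read for trees of radius \<open>r\<close>, says \<open>e(K) + (r - 1) (k - 1) \<le> d\<close>; together with
  acyclicity it implies (ii) and (iii).  Call a tree good if it satisfies this inequality and bad
  otherwise.  The decompositions considered consist of a red forest and of blue oriented edges with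
  out-degree at most \<open>k\<close>; the blue edges then split into \<open>k\<close> functional graphs, which are
  pseudoforests.  Sparsity lets an augmenting argument cover all edges in this way.

  Among all such decompositions minimise the total size of the bad trees.  If a bad tree \<open>R\<close> is
  left, explore from \<open>R\<close> along blue edges, visiting whole red trees, and choose the decomposition
  and the order of exploration so that the list of tree sizes is lexicographically minimal.
  By minimality every reached vertex has exactly \<open>k\<close> outgoing blue edges: a vertex with a spare one
  could cut the red edge towards the root of its tree, or reverse the blue edge into that root and pass
  the spare one on to an earlier tree.  Call a tree small if it has less than \<open>d / (k + 1)\<close> edges.
  Exchanging red edges of a tree \<open>K\<close> for the blue edges to its small children never leads to an
  improvement, and this forces \<open>K\<close> with its \<open>j\<close> small children to have at least
  \<open>(1 + j) d / (k + 1)\<close> edges, strictly more for \<open>R\<close>.  Summing over all reached trees contradicts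
  the bound on the average degree.
\<close>

section \<open>Rooted trees\<close>

text \<open>The constant \<open>d / (k + 1)\<close> is the sparsity bound in disguise. If
  \<open>n\<close> red trees with \<open>m\<close> edges in all are closed under blue edges and each
  of their vertices has \<open>k\<close> outgoing ones, sparsity for the \<open>m + n\<close>
  vertices reduces to \<open>(k + 1) * m \<le> d * n\<close>. The obstacle is the trees below this
  average: they must be paid for by the tree from which they are entered.

  The term \<open>(r - 1) * (k - 1)\<close> is what an exchange at one vertex can pay. Let the
  smallest candidates be attached and let \<open>t\<close> bound their sizes. The result has depth
  at most \<open>t + 1\<close>, so if it still violates the inequality, it has more than
  \<open>d - t * (k - 1)\<close> edges. Every candidate left out has at least \<open>t\<close>
  edges, and if fewer than \<open>k - 1\<close> are left out, the missing ones are made up for by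
  \<open>t \<le> d / (k + 1)\<close>. A branch that cannot pay in this way shrinks to a core, which
  counts as one more small child at the next vertex up; so the argument runs from the leaves to the
  root.\<close>

text \<open>
  The edge stored with a branch joins the root to the root of the branch.  Vertices and edges are
  collected in multisets so that cutting and joining trees become equations between sums;
  distinctness is imposed once, on a whole decomposition.
\<close>

datatype ('v, 'e) rtree = Node (root: 'v) (branches: "('e \<times> ('v, 'e) rtree) list")

fun vm :: "('v, 'e) rtree \<Rightarrow> 'v multiset" where
  "vm (Node x bs) = add_mset x (\<Sum>(e, b)\<leftarrow>bs. vm b)"

fun em :: "('v, 'e) rtree \<Rightarrow> 'e multiset" where
  "em (Node x bs) = (\<Sum>(e, b)\<leftarrow>bs. add_mset e (em b))"

fun depth :: "('v, 'e) rtree \<Rightarrow> nat" where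
  "depth (Node x bs) = Max (insert 0 ((\<lambda>(e, b). Suc (depth b)) ` set bs))"

fun subtrees :: "('v, 'e) rtree \<Rightarrow> ('v, 'e) rtree set" where
  "subtrees (Node x bs) = insert (Node x bs) (\<Union>(e, b)\<in>set bs. subtrees b)"

abbreviation esz :: "('v, 'e) rtree \<Rightarrow> nat" where
  "esz s \<equiv> size (em s)"

lemma sum_list_perm:
  fixes f :: "'a \<Rightarrow> 'b::comm_monoid_add"
  assumes "mset xs = mset ys"
  shows "(\<Sum>x\<leftarrow>xs. f x) = (\<Sum>x\<leftarrow>ys. f x)"
  using assms by (metis mset_map sum_mset_sum_list)

lemma size_sum_list: "size (\<Sum>x\<leftarrow>xs. f x :: 'b multiset) = (\<Sum>x\<leftarrow>xs. size (f x))"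
  by (induction xs) auto

lemma root_in_vm [simp]: "root s \<in># vm s"
  by (cases s) auto

lemma size_vm: "size (vm s) = Suc (esz s)"
proof (induction s)
  case (Node x bs)
  have "(\<Sum>(e, b)\<leftarrow>bs. size (vm b)) = (\<Sum>(e, b)\<leftarrow>bs. Suc (esz b))"
    using Node by (intro arg_cong[where f = sum_list] map_cong) auto
  then show ?case
    by (simp add: size_sum_list split_def)
qed

lemma in_sum_list_mset: "(a :: 'b) \<in># (\<Sum>x\<leftarrow>xs. f x) \<longleftrightarrow> (\<exists>x\<in>set xs. a \<in># f x)"
  by (induction xs) auto

lemma self_subtree [simp]: "s \<in> subtrees s"
  by (cases s) auto

lemma subtrees_trans: "t \<in> subtrees s \<Longrightarrow> s \<in> subtrees K \<Longrightarrow> t \<in> subtrees K"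
proof (induction K)
  case (Node x bs)
  then show ?case by (auto, blast+)
qed

lemma branch_subtree:
  assumes "Node x bs \<in> subtrees K" and "(e, b) \<in> set bs"
  shows "b \<in> subtrees K"
proof -
  have "b \<in> subtrees (Node x bs)"
    using assms(2) self_subtree[of b] by (auto simp del: self_subtree)
  then show ?thesis
    using assms(1) subtrees_trans by metis
qed

lemma vm_subtree: "x \<in># vm s \<Longrightarrow> \<exists>t\<in>subtrees s. root t = x"
proof (induction s)
  case (Node y bs)
  show ?case
  proof (cases "x = y")
    case False
    then obtain e b where b: "(e, b) \<in> set bs" "x \<in># vm b"
      using Node.prems by (auto simp: in_sum_list_mset)
    then obtain t where "t \<in> subtrees b" "root t = x"
      using Node.IH by fastforce
    then show ?thesis
      using b by auto
  qed auto
qed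

lemma sum_list_remove1:
  fixes f :: "'a \<Rightarrow> 'b::comm_monoid_add"
  shows "x \<in> set xs \<Longrightarrow> (\<Sum>y\<leftarrow>xs. f y) = f x + (\<Sum>y\<leftarrow>remove1 x xs. f y)"
  by (induction xs) (auto simp: ac_simps)

locale incidence =
  fixes N :: "'e \<Rightarrow> 'v set"
begin

fun wft :: "('v, 'e) rtree \<Rightarrow> bool" where
  "wft (Node x bs) \<longleftrightarrow> (\<forall>(e, b)\<in>set bs. N e = {x, root b} \<and> wft b)"

lemma ends_in_vm: "wft s \<Longrightarrow> e \<in># em s \<Longrightarrow> N e \<subseteq> set_mset (vm s)"
proof (induction s)
  case (Node x bs)
  then show ?case
    by (fastforce simp: in_sum_list_mset)
qed

lemma wft_subtree: "wft K \<Longrightarrow> s \<in> subtrees K \<Longrightarrow> wft s"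
  by (induction K) fastforce

text \<open>Cutting the edge \<open>f\<close> above \<open>s\<close> leaves \<open>T\<close>, which
  keeps the root of \<open>K\<close>. Only sums of vertices and edges are recorded; of the position
  of \<open>s\<close> the upper end \<open>a\<close> survives, which suffices to put the edge
  back.\<close>

lemma subtree_context:
  assumes "wft K" and "s \<in> subtrees K"
  shows "s = K \<or> (\<exists>T f a. wft T \<and> root T = root K \<and> a \<in># vm T \<and> N f = {a, root s} \<and>
    vm K = vm T + vm s \<and> em K = add_mset f (em T + em s))"
  using assms
proof (induction K)
  case (Node x bs)
  show ?case
  proof (cases "s = Node x bs")
    case False
    then obtain e b where b: "(e, b) \<in> set bs" "s \<in> subtrees b"
      using Node.prems by auto
    have e: "N e = {x, root b}" "wft b" and rest: "\<forall>(e, b)\<in>set (remove1 (e, b) bs). N e = {x, root b} \<and> wft b"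
      using Node.prems(1) b(1) by (auto dest: notin_set_remove1 set_remove1_subset[THEN subsetD])
    have vmK: "vm (Node x bs) = add_mset x (vm b + (\<Sum>(e, b)\<leftarrow>remove1 (e, b) bs. vm b))"
      using sum_list_remove1[OF b(1), of "\<lambda>(e, b). vm b"] by simp
    have emK: "em (Node x bs) = add_mset e (em b + (\<Sum>(e, b)\<leftarrow>remove1 (e, b) bs. add_mset e (em b)))"
      using sum_list_remove1[OF b(1), of "\<lambda>(e, b). add_mset e (em b)"] by simp
    show ?thesis
    proof (cases "s = b")
      case True
      show ?thesis
        apply (rule disjI2)
        apply (rule exI[of _ "Node x (remove1 (e, b) bs)"], rule exI[of _ e], rule exI[of _ x])
        using True e rest unfolding vmK emK by (auto simp: ac_simps)
    next
      case False
      then obtain T f a where T: "wft T" "root T = root b" "a \<in># vm T" "N f = {a, root s}"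
        "vm b = vm T + vm s" "em b = add_mset f (em T + em s)"
        using Node.IH[OF b(1), of b] b e by fastforce
      show ?thesis
        apply (rule disjI2)
        apply (rule exI[of _ "Node x ((e, T) # remove1 (e, b) bs)"], rule exI[of _ f], rule exI[of _ a])
        using T e rest unfolding vmK emK by (auto simp: ac_simps)
    qed
  qed auto
qed

lemma cut_above:
  assumes "wft K" and "x \<in># vm K" and "x \<noteq> root K"
  shows "\<exists>T s f a. wft T \<and> wft s \<and> root T = root K \<and> root s = x \<and> a \<in># vm T \<and> N f = {a, x} \<and>
    vm K = vm T + vm s \<and> em K = add_mset f (em T + em s)"
proof -
  obtain s where s: "s \<in> subtrees K" "root s = x"
    using assms(2) vm_subtree by metis
  then have "s \<noteq> K"
    using assms by auto
  then show ?thesis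
    using subtree_context[OF assms(1) s(1)] s wft_subtree[OF assms(1) s(1)] by metis
qed

text \<open>The part \<open>T\<close> above \<open>x\<close> is rerooted at the upper end
  \<open>a\<close> of the cut edge and hung below \<open>x\<close> as a further branch.
  \<open>T\<close> has fewer vertices than \<open>K\<close> but need not be a subtree of it, hence
  the induction on size.\<close>

lemma reroot:
  assumes "wft K" and "x \<in># vm K"
  shows "\<exists>K'. wft K' \<and> root K' = x \<and> vm K' = vm K \<and> em K' = em K"
  using assms
proof (induction "size (vm K)" arbitrary: K x rule: less_induct)
  case less
  show ?case
  proof (cases "x = root K")
    case False
    then obtain T s f a where T: "wft T" "wft s" "root T = root K" "root s = x" "a \<in># vm T" "N f = {a, x}"
      "vm K = vm T + vm s" "em K = add_mset f (em T + em s)"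
      using cut_above less by blast
    have "size (vm T) < size (vm K)"
      using T(7) by (simp add: size_vm)
    then obtain T' where T': "wft T'" "root T' = a" "vm T' = vm T" "em T' = em T"
      using less.hyps T by metis
    obtain bs where s: "s = Node x bs"
      using T(4) by (cases s) auto
    show ?thesis
      apply (rule exI[of _ "Node x ((f, T') # bs)"])
      using T T' s by (auto simp: ac_simps insert_commute)
  qed (use less in auto)
qed

lemma join_trees:
  assumes "wft K" and "wft K'" and "a \<in># vm K" and "b \<in># vm K'" and "N e = {a, b}"
  shows "\<exists>J. wft J \<and> root J = a \<and> vm J = vm K + vm K' \<and> em J = add_mset e (em K + em K')"
proof -
  obtain L where L: "wft L" "root L = a" "vm L = vm K" "em L = em K"
    using reroot assms by metis
  obtain L' where L': "wft L'" "root L' = b" "vm L' = vm K'" "em L' = em K'"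
    using reroot assms by metis
  obtain bs where bs: "L = Node a bs"
    using L by (cases L) auto
  show ?thesis
    by (rule exI[of _ "Node a ((e, L') # bs)"])
       (use L L' bs assms in \<open>auto simp: ac_simps\<close>)
qed

end

section \<open>Exchanging branches for small children\<close>

lemma depth_le_esz: "depth s \<le> esz s"
proof (induction s)
  case (Node x bs)
  have "Suc (depth b) \<le> esz (Node x bs)" if b: "(e, b) \<in> set bs" for e b
  proof -
    have "size (add_mset e (em b)) \<le> (\<Sum>(e, b)\<leftarrow>bs. size (add_mset e (em b)))"
      using member_le_sum_list[of "size (add_mset e (em b))" "map (\<lambda>(e, b). size (add_mset e (em b))) bs"] b
      by force
    then show ?thesis
      using Node[OF b, of b] by (simp add: size_sum_list split_def)
  qed
  then show ?case
    by (auto simp: Max_le_iff simp del: em.simps)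
qed

lemma depth_Node_le: "(\<And>e b. (e, b) \<in> set bs \<Longrightarrow> esz b \<le> t) \<Longrightarrow> depth (Node x bs) \<le> Suc t"
  by (auto simp: Max_le_iff intro: le_trans[OF depth_le_esz])

text \<open>Here \<open>t\<close> is the largest key selected, or 0 if nothing is selected. The last
  clause lets a bound valid for all keys pass on to \<open>t\<close>.\<close>

lemma split_smallest:
  fixes key :: "'a \<Rightarrow> nat"
  assumes "L \<le> length xs"
  shows "\<exists>ys zs t. mset xs = mset ys + mset zs \<and> length ys = L \<and> (\<forall>y\<in>set ys. key y \<le> t) \<and>
    (\<forall>z\<in>set zs. t \<le> key z) \<and> (t = 0 \<or> (\<exists>x\<in>set xs. key x = t))"
proof -
  let ?s = "sort_key key xs"
  have "sorted (map key (take L ?s @ drop L ?s))"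
    by simp
  then have le: "\<forall>y\<in>set (take L ?s). \<forall>z\<in>set (drop L ?s). key y \<le> key z"
    by (simp only: map_append sorted_append set_map) blast
  let ?t = "Max (insert 0 (key ` set (take L ?s)))"
  have "?t = 0 \<or> (\<exists>x\<in>set (take L ?s). key x = ?t)"
    using Max_in[of "insert 0 (key ` set (take L ?s))"] by fastforce
  moreover have "\<forall>z\<in>set (drop L ?s). ?t \<le> key z"
    using le by (auto simp: Max_le_iff)
  moreover have "mset xs = mset (take L ?s) + mset (drop L ?s)"
    by (metis append_take_drop_id mset_append mset_sort)
  ultimately show ?thesis
    using assms by (intro exI[of _ "take L ?s"] exI[of _ "drop L ?s"] exI[of _ ?t])
      (auto dest: in_set_takeD)
qed

text \<open>Branches compete by the size of their cores and children by their own size. The sum type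
  merges the two lists, so that they can be ranked together.\<close>

lemma split_smallest2:
  fixes f :: "'a \<Rightarrow> nat" and g :: "'b \<Rightarrow> nat"
  assumes "L \<le> length xs + length ys"
  shows "\<exists>xs1 xs2 ys1 ys2 t. mset xs = mset xs1 + mset xs2 \<and> mset ys = mset ys1 + mset ys2 \<and>
    length xs1 + length ys1 = L \<and> (\<forall>x\<in>set xs1. f x \<le> t) \<and> (\<forall>y\<in>set ys1. g y \<le> t) \<and>
    (\<forall>x\<in>set xs2. t \<le> f x) \<and> (\<forall>y\<in>set ys2. t \<le> g y) \<and>
    (t = 0 \<or> (\<exists>x\<in>set xs. f x = t) \<or> (\<exists>y\<in>set ys. g y = t))"
proof -
  define os where "os = map Inl xs @ map Inr ys"
  define l :: "('a + 'b) list \<Rightarrow> 'a list" where "l zs = map projl (filter isl zs)" for zs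
  define r :: "('a + 'b) list \<Rightarrow> 'b list" where "r zs = map projr (filter (\<lambda>z. \<not> isl z) zs)" for zs
  have "L \<le> length os"
    using assms by (simp add: os_def)
  then obtain zs1 zs2 t where z: "mset os = mset zs1 + mset zs2" "length zs1 = L"
    "\<forall>z\<in>set zs1. case_sum f g z \<le> t" "\<forall>z\<in>set zs2. t \<le> case_sum f g z"
    "t = 0 \<or> (\<exists>z\<in>set os. case_sum f g z = t)"
    using split_smallest[of L os "case_sum f g"] by blast
  have lo: "l os = xs" and ro: "r os = ys"
    unfolding l_def r_def os_def by (simp_all add: filter_map o_def)
  have ml: "mset (l os) = mset (l zs1) + mset (l zs2)" and mr: "mset (r os) = mset (r zs1) + mset (r zs2)"
    unfolding l_def r_def by (simp_all add: z(1))
  have len: "length (l zs) + length (r zs) = length zs" for zs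
    unfolding l_def r_def by (simp add: sum_length_filter_compl)
  have bounds: "Inl x \<in> set zs1 \<Longrightarrow> f x \<le> t" "Inr y \<in> set zs1 \<Longrightarrow> g y \<le> t"
      "Inl x \<in> set zs2 \<Longrightarrow> t \<le> f x" "Inr y \<in> set zs2 \<Longrightarrow> t \<le> g y" for x y
    using z(3,4) by (metis sum.case)+
  have t: "t = 0 \<or> (\<exists>x\<in>set xs. f x = t) \<or> (\<exists>y\<in>set ys. g y = t)"
    using z(5) by (auto simp: os_def)
  have memb: "x \<in> set (l zs) \<longleftrightarrow> Inl x \<in> set zs" "y \<in> set (r zs) \<longleftrightarrow> Inr y \<in> set zs" for x y zs
    unfolding l_def r_def by (force simp: isl_def image_iff split: sum.splits)+
  show ?thesis
    by (rule exI[of _ "l zs1"], rule exI[of _ "l zs2"], rule exI[of _ "r zs1"], rule exI[of _ "r zs2"],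
        rule exI[of _ t])
       (use z(2) t bounds ml mr lo ro len memb in auto)
qed

lemma sum_list_ge: "(\<And>x. x \<in> set xs \<Longrightarrow> t \<le> f x) \<Longrightarrow> length xs * t \<le> (\<Sum>x\<leftarrow>xs. f x :: nat)"
  by (induction xs) (auto simp: add_mono)

text \<open>Isolates the exchange argument from the list of trees: \<open>Ch x\<close> stands for
  the small trees entered by blue edges out of \<open>x\<close>. Minimality will enter only through
  assumptions that certain rearrangements are not admissible.\<close>

locale small_children = incidence N for N :: "'e \<Rightarrow> 'v set" +
  fixes Ch :: "'v \<Rightarrow> ('e \<times> ('v, 'e) rtree) list" and k d :: nat
  assumes Ch: "(c, b) \<in> set (Ch x) \<Longrightarrow> N c = {x, root b} \<and> wft b \<and> (k + 1) * esz b < d"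
    and length_Ch: "length (Ch x) \<le> k"
    and k_pos: "k \<ge> 1"
begin

abbreviation own :: "'v \<Rightarrow> ('e \<times> ('v, 'e) rtree) list \<Rightarrow> ('v \<times> 'e \<times> ('v, 'e) rtree) multiset" where
  "own x cs \<equiv> mset (map (Pair x) cs)"

fun children :: "('v, 'e) rtree \<Rightarrow> ('v \<times> 'e \<times> ('v, 'e) rtree) multiset" where
  "children (Node x bs) = own x (Ch x) + (\<Sum>(e, b)\<leftarrow>bs. children b)"

text \<open>
  A rearrangement turns \<open>s\<close> into the tree \<open>M\<close> with the same root and the cut off, otherwise
  untouched subtrees \<open>Q\<close>.  It colours the edges to the children in \<open>U\<close> red and the edges in \<open>D\<close>
  blue, with the given tails; \<open>n\<close> counts the outgoing blue edges that the root loses in total.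
\<close>

definition rearr ::
    "nat \<Rightarrow> ('v, 'e) rtree \<Rightarrow> ('v, 'e) rtree \<Rightarrow> ('v, 'e) rtree multiset \<Rightarrow>
     ('v \<times> 'e \<times> ('v, 'e) rtree) multiset \<Rightarrow> ('v \<times> 'e) multiset \<Rightarrow> bool" where
  "rearr n s M Q U D \<longleftrightarrow> root M = root s \<and> wft M \<and> (\<forall>q\<in>#Q. wft q) \<and> U \<subseteq># children s \<and>
     vm M + (\<Sum>q\<in>#Q. vm q) = vm s + (\<Sum>(x, c, b)\<in>#U. vm b) \<and>
     em M + (\<Sum>q\<in>#Q. em q) + image_mset snd D =
       em s + (\<Sum>(x, c, b)\<in>#U. em b) + image_mset (\<lambda>(x, c, b). c) U \<and>
     image_mset fst U = replicate_mset n (root s) + image_mset fst D \<and>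
     (\<forall>(x, f)\<in>#D. x \<in> N f) \<and> (\<Sum>q\<in>#Q. em q) + image_mset snd D \<subseteq># em s \<and> size Q = size D"

text \<open>The source of all spare out-edges: each child taken in turns one blue edge out of
  \<open>x\<close> red.\<close>

lemma rearr_base:
  assumes "mset cs \<subseteq># mset (Ch x)"
  shows "rearr (length cs) (Node x []) (Node x cs) {#} (own x cs) {#}"
proof -
  have "own x cs \<subseteq># own x (Ch x)"
    using assms by (simp add: image_mset_subseteq_mono)
  moreover have "(c, b) \<in> set (Ch x)" if "(c, b) \<in> set cs" for c b
    using assms that by (metis mset_subset_eqD set_mset_mset)
  moreover have "(\<Sum>(e, b)\<leftarrow>cs. add_mset e (em b)) =
      (\<Sum>(x, c, b)\<in>#own x cs. em b) + image_mset (\<lambda>(x, c, b). c) (own x cs)"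
    by (induction cs) auto
  moreover have "(\<Sum>(e, b)\<leftarrow>cs. vm b) = (\<Sum>(x, c, b)\<in>#own x cs. vm b)"
    by (induction cs) auto
  moreover have "image_mset fst (own x cs) = replicate_mset (length cs) x"
    by (induction cs) auto
  moreover from calculation(2) have "wft (Node x cs)"
    using Ch by fastforce
  ultimately show ?thesis
    unfolding rearr_def by (auto simp del: wft.simps)
qed

lemma rearr_keep:
  assumes "rearr n (Node x bs) (Node x os) Q U D" and "rearr 0 b M Q' U' D'" and "N e = {x, root b}"
  shows "rearr n (Node x ((e, b) # bs)) (Node x ((e, M) # os)) (Q + Q') (U + U') (D + D')"
proof -
  have "U + U' \<subseteq># children (Node x ((e, b) # bs))"
    using assms(1,2) subset_mset.add_mono[of U "children (Node x bs)" U' "children b"]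
    unfolding rearr_def by (simp add: ac_simps)
  moreover have "((\<Sum>q\<in>#Q. em q) + image_mset snd D) + ((\<Sum>q\<in>#Q'. em q) + image_mset snd D') \<subseteq>#
      em (Node x bs) + em b"
    using assms(1,2) unfolding rearr_def by (intro subset_mset.add_mono) auto
  then have "((\<Sum>q\<in>#Q. em q) + image_mset snd D) + ((\<Sum>q\<in>#Q'. em q) + image_mset snd D') \<subseteq>#
      em (Node x bs) + em b + {#e#}"
    by (rule subset_mset.order_trans) simp
  then have "(\<Sum>q\<in>#Q + Q'. em q) + image_mset snd (D + D') \<subseteq># em (Node x ((e, b) # bs))"
    by (simp add: ac_simps)
  moreover have "vm (Node x ((e, M) # os)) + (\<Sum>q\<in>#Q + Q'. vm q) =
      (vm (Node x os) + (\<Sum>q\<in>#Q. vm q)) + (vm M + (\<Sum>q\<in>#Q'. vm q))"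
    "em (Node x ((e, M) # os)) + (\<Sum>q\<in>#Q + Q'. em q) + image_mset snd (D + D') =
      add_mset e ((em (Node x os) + (\<Sum>q\<in>#Q. em q) + image_mset snd D) +
        (em M + (\<Sum>q\<in>#Q'. em q) + image_mset snd D'))"
    by (simp_all add: ac_simps)
  ultimately show ?thesis
    using assms unfolding rearr_def
    by (simp only:) (auto simp: ac_simps)
qed

text \<open>The edge \<open>e\<close> becomes blue with tail \<open>x\<close> and uses up one of the
  out-edges that \<open>x\<close> has lost, hence the step from \<open>Suc n\<close> to
  \<open>n\<close>.\<close>

lemma rearr_detach:
  assumes "rearr (Suc n) (Node x bs) (Node x os) Q U D" and "wft b" and "N e = {x, root b}"
  shows "rearr n (Node x ((e, b) # bs)) (Node x os) (add_mset b Q) U (add_mset (x, e) D)"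
proof -
  have "U \<subseteq># children (Node x ((e, b) # bs))"
    using assms(1) subset_mset.add_increasing[of "children b" U "children (Node x bs)"]
    unfolding rearr_def by (simp add: ac_simps)
  then show ?thesis
    using assms unfolding rearr_def by (auto simp: ac_simps)
qed

lemma rearr_perm:
  assumes "rearr n (Node x bs) M Q U D" and "mset bs = mset bs'"
  shows "rearr n (Node x bs') M Q U D"
  using assms(1) sum_list_perm[OF assms(2), of "\<lambda>(e, b). vm b"] sum_list_perm[OF assms(2), of "\<lambda>(e, b). add_mset e (em b)"]
    sum_list_perm[OF assms(2), of "\<lambda>(e, b). children b"]
  unfolding rearr_def by simp

text \<open>Balance at \<open>x\<close>: each child in \<open>cs\<close> frees an out-edge, each
  branch in \<open>B\<close> occupies one, and the branches in \<open>A\<close> are balanced within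
  themselves.\<close>

lemma rearr_Node:
  assumes "mset cs \<subseteq># mset (Ch x)" and "length cs = length B + n" and "wft (Node x (A @ B))"
    and "\<And>e b. (e, b) \<in> set A \<Longrightarrow> \<exists>Q U D. rearr 0 b (M b) Q U D"
  shows "\<exists>Q U D. rearr n (Node x (A @ B)) (Node x (map (\<lambda>(e, b). (e, M b)) A @ cs)) Q U D"
  using assms(3,4)
proof (induction A)
  case Nil
  have "\<exists>Q U D. rearr n (Node x B) (Node x cs) Q U D"
    using assms(2) Nil.prems(1)
  proof (induction B arbitrary: n)
    case Nil
    then show ?case
      using rearr_base[OF assms(1)] by auto
  next
    case (Cons eb B)
    obtain e b where eb: "eb = (e, b)"
      by fastforce
    have "\<exists>Q U D. rearr (Suc n) (Node x B) (Node x cs) Q U D"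
      using Cons by auto
    then show ?case
      using rearr_detach[of n x B cs _ _ _ b e] Cons.prems eb by fastforce
  qed
  then show ?case
    by simp
next
  case (Cons eb A)
  obtain e b where eb: "eb = (e, b)"
    by fastforce
  obtain Q U D where 1: "rearr n (Node x (A @ B)) (Node x (map (\<lambda>(e, b). (e, M b)) A @ cs)) Q U D"
    using Cons by fastforce
  obtain Q' U' D' where 2: "rearr 0 b (M b) Q' U' D'"
    using Cons.prems(2)[of e b] eb by auto
  have "N e = {x, root b}"
    using Cons.prems(1) eb by auto
  then show ?case
    using rearr_keep[OF 1 2, of e] eb by (auto simp del: wft.simps)
qed

definition weight :: "('v, 'e) rtree \<Rightarrow> nat" where
  "weight s = esz s + (\<Sum>(x, c, b)\<in>#children s. esz b)"

abbreviation num_children :: "('v, 'e) rtree \<Rightarrow> nat" where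
  "num_children s \<equiv> size (children s)"

text \<open>
  A tree that is not strong has a rearrangement into a core of fewer than \<open>d / (k + 1)\<close> edges.
  Attached to a parent, such a core behaves exactly like one more small child.
\<close>

definition strong :: "('v, 'e) rtree \<Rightarrow> bool" where
  "strong s \<longleftrightarrow> d * (1 + num_children s) \<le> (k + 1) * weight s"

text \<open>The last inequality says that after \<open>d / (k + 1)\<close> is set aside for each
  child, the weight of \<open>s\<close> still covers the edges of \<open>M\<close>. This allows the
  core to stand in for the whole branch in weight bounds.\<close>

definition weak_core :: "('v, 'e) rtree \<Rightarrow> ('v, 'e) rtree \<Rightarrow> bool" where
  "weak_core s M \<longleftrightarrow> (\<exists>Q U D. rearr 0 s M Q U D) \<and> (k + 1) * esz M < d \<and>
     (k + 1) * esz M + d * num_children s \<le> (k + 1) * weight s"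

text \<open>The inequality for good trees with the depth as radius. It depends only on the shape of
  the rooted tree, so no distinctness of vertices is involved during an exchange.\<close>

definition admissible :: "('v, 'e) rtree \<Rightarrow> bool" where
  "admissible s \<longleftrightarrow> esz s + (depth s - 1) * (k - 1) \<le> d"

lemma num_children_Node: "num_children (Node x bs) = length (Ch x) + (\<Sum>(e, b)\<leftarrow>bs. num_children b)"
  by (simp add: size_sum_list split_def)

lemma weight_Node: "weight (Node x bs) = (\<Sum>(c, b)\<leftarrow>Ch x. esz b) + (\<Sum>(e, b)\<leftarrow>bs. Suc (weight b))"
proof -
  have "(\<Sum>(x, c, b)\<in>#(\<Sum>(e, b)\<leftarrow>bs. children b). esz b) + (\<Sum>(e, b)\<leftarrow>bs. size (add_mset e (em b))) =
      (\<Sum>(e, b)\<leftarrow>bs. Suc (weight b))"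
    by (induction bs) (auto simp: weight_def)
  moreover have "(\<Sum>(x, c, b)\<in>#own x cs. esz b) = (\<Sum>(c, b)\<leftarrow>cs. esz b)" for cs
    by (induction cs) auto
  moreover have "size (em (Node x bs)) = (\<Sum>(e, b)\<leftarrow>bs. size (add_mset e (em b)))"
    by (simp add: size_sum_list split_def)
  ultimately show ?thesis
    by (simp add: weight_def del: em.simps)
qed

text \<open>Each branch contributes the edge joining it to \<open>x\<close>, then
  \<open>d / (k + 1)\<close> per child inside it, and on top of this \<open>d / (k + 1)\<close> if
  it is strong or \<open>f b\<close> otherwise. For \<open>f\<close> the size of a core is taken, or
  0 where a crude bound is enough.\<close>

lemma weight_lower_bound:
  assumes "mset bs = mset (S @ A)"
    and "\<And>e b. (e, b) \<in> set S \<Longrightarrow> strong b"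
    and "\<And>e b. (e, b) \<in> set A \<Longrightarrow> (k + 1) * f b + d * num_children b \<le> (k + 1) * weight b"
    and "J = (\<Sum>(e, b)\<leftarrow>bs. num_children b)"
  shows "(k + 1) * (length bs + (\<Sum>(e, b)\<leftarrow>A. f b) + (\<Sum>(c, b)\<leftarrow>Ch x. esz b)) + d * (length S + J)
    \<le> (k + 1) * weight (Node x bs)"
proof -
  have S: "(\<Sum>(e, b)\<leftarrow>S. (k + 1) + d + d * num_children b) \<le> (\<Sum>(e, b)\<leftarrow>S. (k + 1) * Suc (weight b))"
    using assms(2) unfolding strong_def by (intro sum_list_mono) fastforce
  have A: "(\<Sum>(e, b)\<leftarrow>A. (k + 1) + (k + 1) * f b + d * num_children b) \<le> (\<Sum>(e, b)\<leftarrow>A. (k + 1) * Suc (weight b))"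
    using assms(3) by (intro sum_list_mono) fastforce
  have "(\<Sum>(e, b)\<leftarrow>S. (k + 1) + d + d * num_children b) =
      (k + 1) * length S + d * (length S + (\<Sum>(e, b)\<leftarrow>S. num_children b))"
    by (induction S) (auto simp: algebra_simps)
  moreover have "(\<Sum>(e, b)\<leftarrow>A. (k + 1) + (k + 1) * f b + d * num_children b) =
      (k + 1) * (length A + (\<Sum>(e, b)\<leftarrow>A. f b)) + d * (\<Sum>(e, b)\<leftarrow>A. num_children b)"
    by (induction A) (auto simp: algebra_simps)
  moreover have "(\<Sum>(e, b)\<leftarrow>bs. (k + 1) * Suc (weight b)) =
      (\<Sum>(e, b)\<leftarrow>S. (k + 1) * Suc (weight b)) + (\<Sum>(e, b)\<leftarrow>A. (k + 1) * Suc (weight b))"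
    using sum_list_perm[OF assms(1)] by simp
  moreover have "J = (\<Sum>(e, b)\<leftarrow>S. num_children b) + (\<Sum>(e, b)\<leftarrow>A. num_children b)"
    using sum_list_perm[OF assms(1)] assms(4) by simp
  moreover have "length bs = length S + length A"
    using mset_eq_length[OF assms(1)] by simp
  moreover have "(k + 1) * weight (Node x bs) =
      (k + 1) * (\<Sum>(c, b)\<leftarrow>Ch x. esz b) + (\<Sum>(e, b)\<leftarrow>bs. (k + 1) * Suc (weight b))"
  proof -
    have "(\<Sum>(e, b)\<leftarrow>bs. (k + 1) * Suc (weight b)) = (k + 1) * (\<Sum>(e, b)\<leftarrow>bs. Suc (weight b))" for bs :: "('e \<times> ('v, 'e) rtree) list"
      by (induction bs) (auto simp: algebra_simps)
    then show ?thesis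
      by (simp add: weight_Node distrib_left)
  qed
  ultimately show ?thesis
    using S A by (simp add: algebra_simps)
qed

text \<open>
  Strong branches are always cut off.  The cores of the remaining branches and the small children
  compete for being attached to \<open>x\<close>, and the smallest of them win.  Every loser has at least
  \<open>t\<close> edges and every winner at most \<open>t\<close>, so that \<open>M\<close> has depth at most \<open>t + 1\<close>.
\<close>

lemma exchange_exists:
  assumes "wft (Node x bs)"
    and dich: "\<forall>(e, b)\<in>set bs. strong b \<or> (\<exists>M. weak_core b M)"
    and q: "q = length (filter (\<lambda>(e, b). strong b) bs)"
    and le: "q + n \<le> length (Ch x)"
    and J: "J = (\<Sum>(e, b)\<leftarrow>bs. num_children b)"
  shows "\<exists>M Q U D t. rearr n (Node x bs) M Q U D \<and> depth M \<le> Suc t \<and> (k + 1) * t \<le> d \<and>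
    (k + 1) * (esz M + (length (Ch x) - q - n) * t) + d * (q + J) \<le> (k + 1) * (weight (Node x bs) + n)"
proof -
  define S where "S = filter (\<lambda>(e, b). strong b) bs"
  define W where "W = filter (\<lambda>(e, b). \<not> strong b) bs"
  define core where "core b = (SOME M. weak_core b M)" for b
  have core: "weak_core b (core b)" if "(e, b) \<in> set W" for e b
    using dich that unfolding core_def W_def by (auto intro: someI)
  have SW: "mset bs = mset (S @ W)"
    unfolding S_def W_def by (induction bs) auto
  have lenb: "length bs = q + length W"
    using mset_eq_length[OF SW] by (simp add: q S_def)
  \<comment> \<open>The number of winners is \<open>length W + q + n\<close>. With it the attached
    children outnumber the detached branches, strong ones and losing ones together, by exactly
    \<open>n\<close>.\<close>
  have "length W + q + n \<le> length W + length (Ch x)"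
    using le by simp
  from split_smallest2[OF this, where f = "\<lambda>(e, b). esz (core b)" and g = "\<lambda>(c, b). esz b"]
  obtain A A' C C' t where sp: "mset W = mset A + mset A'" "mset (Ch x) = mset C + mset C'"
    "length A + length C = length W + q + n"
    and At: "\<forall>(e, b)\<in>set A. esz (core b) \<le> t" and Ct: "\<forall>(c, b)\<in>set C. esz b \<le> t"
    and A't: "\<forall>(e, b)\<in>set A'. t \<le> esz (core b)" and C't: "\<forall>(c, b)\<in>set C'. t \<le> esz b"
    and t: "t = 0 \<or> (\<exists>(e, b)\<in>set W. esz (core b) = t) \<or> (\<exists>(c, b)\<in>set (Ch x). esz b = t)"
    by (simp only: split_def) blast
  have lenW: "length W = length A + length A'" and lenC: "length (Ch x) = length C + length C'"
    using mset_eq_length[of W "A @ A'"] mset_eq_length[of "Ch x" "C @ C'"] sp by auto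
  have ab: "mset bs = mset (A @ (S @ A'))"
    using SW sp(1) by simp
  have setA: "set A \<subseteq> set W"
    using sp(1) by (metis mset_subset_eq_add_left set_mset_mono set_mset_mset)
  have "length C = length (S @ A') + n"
    using sp(3) lenW q S_def by simp
  moreover have "mset C \<subseteq># mset (Ch x)"
    using sp(2) by simp
  moreover have "wft (Node x (A @ (S @ A')))"
    using assms(1) mset_eq_setD[OF ab] by simp
  moreover have "\<exists>Q U D. rearr 0 b (core b) Q U D" if "(e, b) \<in> set A" for e b
    using core[of e b] that setA unfolding weak_core_def by blast
  ultimately obtain Q U D where r: "rearr n (Node x (A @ (S @ A'))) (Node x (map (\<lambda>(e, b). (e, core b)) A @ C)) Q U D"
    using rearr_Node[of C x "S @ A'" n A core] by blast
  define M where "M = Node x (map (\<lambda>(e, b). (e, core b)) A @ C)"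
  have rM: "rearr n (Node x bs) M Q U D"
    unfolding M_def using rearr_perm[OF r] ab by simp
  have dep: "depth M \<le> Suc t"
    unfolding M_def using At Ct by (intro depth_Node_le) auto
  \<comment> \<open>\<open>t\<close> is 0, the size of a core or the size of a child, and all of
    these are small.\<close>
  have kt: "(k + 1) * t \<le> d"
    using t core Ch unfolding weak_core_def by fastforce
  have "esz (Node x (map (\<lambda>(e, b). (e, core b)) A)) = (\<Sum>(e, b)\<leftarrow>A. Suc (esz (core b)))"
    "esz (Node x C) = (\<Sum>(e, b)\<leftarrow>C. Suc (esz b))"
    by ((induction A, auto), (induction C, auto))
  then have "esz M = (\<Sum>(e, b)\<leftarrow>A. Suc (esz (core b))) + (\<Sum>(e, b)\<leftarrow>C. Suc (esz b))"
    unfolding M_def by simp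
  then have eM: "esz M = length A + (\<Sum>(e, b)\<leftarrow>A. esz (core b)) + (length C + (\<Sum>(e, b)\<leftarrow>C. esz b))"
    by (simp add: split_def sum_list_Suc)
  have SumW: "(\<Sum>(e, b)\<leftarrow>W. esz (core b)) = (\<Sum>(e, b)\<leftarrow>A. esz (core b)) + (\<Sum>(e, b)\<leftarrow>A'. esz (core b))"
    using sum_list_perm[of W "A @ A'"] sp(1) by simp
  have SumC: "(\<Sum>(c, b)\<leftarrow>Ch x. esz b) = (\<Sum>(c, b)\<leftarrow>C. esz b) + (\<Sum>(c, b)\<leftarrow>C'. esz b)"
    using sum_list_perm[of "Ch x" "C @ C'"] sp(2) by simp
  have "length A' * t \<le> (\<Sum>(e, b)\<leftarrow>A'. esz (core b))" "length C' * t \<le> (\<Sum>(c, b)\<leftarrow>C'. esz b)"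
    using A't C't by (auto intro!: sum_list_ge)
  moreover have "length (Ch x) - q - n = length A' + length C'"
    using sp(3) lenW lenC by simp
  \<comment> \<open>\<open>M\<close> has one joining edge per winner, and there are \<open>n\<close>
    more winners than branches; this is the summand \<open>n\<close> on the right. The losers
    account for the multiple of \<open>t\<close>.\<close>
  ultimately have "esz M + (length (Ch x) - q - n) * t \<le>
      length bs + n + (\<Sum>(e, b)\<leftarrow>W. esz (core b)) + (\<Sum>(c, b)\<leftarrow>Ch x. esz b)"
    using eM SumW SumC sp(3) lenb by (simp add: distrib_right)
  then have "(k + 1) * (esz M + (length (Ch x) - q - n) * t) \<le>
      (k + 1) * (length bs + n + (\<Sum>(e, b)\<leftarrow>W. esz (core b)) + (\<Sum>(c, b)\<leftarrow>Ch x. esz b))"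
    by (rule mult_le_mono2)
  moreover have "(k + 1) * (length bs + (\<Sum>(e, b)\<leftarrow>W. esz (core b)) + (\<Sum>(c, b)\<leftarrow>Ch x. esz b)) + d * (length S + J)
    \<le> (k + 1) * weight (Node x bs)"
    using core unfolding weak_core_def
    by (intro weight_lower_bound[OF SW _ _ J]) (auto simp: S_def)
  moreover have "length S = q"
    by (simp add: q S_def)
  ultimately have "(k + 1) * (esz M + (length (Ch x) - q - n) * t) + d * (q + J) \<le> (k + 1) * (weight (Node x bs) + n)"
    by (simp add: algebra_simps)
  then show ?thesis
    using rM dep kt by blast
qed

text \<open>The strong branches pay for all children of \<open>x\<close> and, being more numerous,
  also for the tree itself. The edges that join the branches to \<open>x\<close> are left over and
  make the inequality strict.\<close>

lemma many_strong:
  assumes "\<forall>(e, b)\<in>set bs. strong b \<or> (\<exists>M. weak_core b M)"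
    and q: "q = length (filter (\<lambda>(e, b). strong b) bs)"
    and "length (Ch x) < q"
  shows "d * (1 + num_children (Node x bs)) < (k + 1) * weight (Node x bs)"
proof -
  define S where "S = filter (\<lambda>(e, b). strong b) bs"
  define W where "W = filter (\<lambda>(e, b). \<not> strong b) bs"
  have SW: "mset bs = mset (S @ W)"
    unfolding S_def W_def by (induction bs) auto
  have "(k + 1) * (length bs + (\<Sum>(e, b)\<leftarrow>W. 0) + (\<Sum>(c, b)\<leftarrow>Ch x. esz b)) +
      d * (length S + (\<Sum>(e, b)\<leftarrow>bs. num_children b)) \<le> (k + 1) * weight (Node x bs)"
    using assms(1) unfolding weak_core_def
    by (intro weight_lower_bound[OF SW _ _ refl]) (fastforce simp: S_def W_def)+
  moreover have "d * (1 + num_children (Node x bs)) \<le> d * (length S + (\<Sum>(e, b)\<leftarrow>bs. num_children b))"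
    using assms(3) unfolding q S_def num_children_Node by (intro mult_le_mono2) simp
  moreover have "length bs > 0"
    using assms(3) unfolding q by (cases bs) auto
  then have "(k + 1) * (length bs + (\<Sum>(e, b)\<leftarrow>W. 0) + (\<Sum>(c, b)\<leftarrow>Ch x. esz b)) > 0"
    by simp
  ultimately show ?thesis
    by linarith
qed

lemma not_admissible:
  assumes "\<not> admissible M" and "depth M \<le> Suc t"
  shows "d < esz M + t * (k - 1)"
proof -
  have "(depth M - 1) * (k - 1) \<le> t * (k - 1)"
    using assms(2) by (intro mult_le_mono1) simp
  then show ?thesis
    using assms(1) unfolding admissible_def by linarith
qed

text \<open>Strong branches are balanced against the children of the root. If they outnumber the
  children, counting suffices. If they are fewer, an exchange with one spare out-edge exists, and
  its failure to be admissible forces the weight up. If the numbers agree, the balanced exchange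
  yields a core unless the tree is strong.\<close>

lemma strong_or_weak:
  assumes "wft K"
    and "\<And>s M Q U D. s \<in> subtrees K \<Longrightarrow> rearr 1 s M Q U D \<Longrightarrow> \<not> admissible M"
  shows "strong K \<or> (\<exists>M. weak_core K M)"
  using assms
proof (induction K)
  case (Node x bs)
  have "strong b \<or> (\<exists>M. weak_core b M)" if b: "(e, b) \<in> set bs" for e b
  proof -
    have "wft b" "subtrees b \<subseteq> subtrees (Node x bs)"
      using Node.prems(1) b by auto
    moreover have "\<not> admissible M" if "s \<in> subtrees b" "rearr 1 s M Q U D" for s M Q U D
      using Node.prems(2)[OF _ that(2)] that(1) calculation(2) by blast
    ultimately show ?thesis
      by (intro Node.IH[OF b]) simp_all
  qed
  then have dich: "\<forall>(e, b)\<in>set bs. strong b \<or> (\<exists>M. weak_core b M)"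
    by blast
  define q where "q = length (filter (\<lambda>(e, b). strong b) bs)"
  define j where "j = length (Ch x)"
  define J where "J = (\<Sum>(e, b)\<leftarrow>bs. num_children b)"
  define w where "w = weight (Node x bs)"
  have nc: "num_children (Node x bs) = j + J"
    by (simp only: num_children_Node j_def J_def)
  consider "j < q" | "q < j" | "q = j"
    by linarith
  then show ?case
  proof cases
    case 1
    then show ?thesis
      using many_strong[OF dich q_def, of x] unfolding strong_def j_def by (metis less_imp_le)
  next
    case 2
    then have "q + 1 \<le> length (Ch x)"
      by (simp add: j_def)
    from exchange_exists[OF Node.prems(1) dich q_def this J_def]
    obtain M Q U D t where M: "rearr 1 (Node x bs) M Q U D" "depth M \<le> Suc t" "(k + 1) * t \<le> d"
      "(k + 1) * (esz M + (j - q - 1) * t) + d * (q + J) \<le> (k + 1) * (w + 1)"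
      unfolding j_def w_def by blast
    have "\<not> admissible M"
      using Node.prems(2)[OF self_subtree M(1)] .
    then have "d + 1 \<le> esz M + t * (k - 1)"
      using not_admissible[OF _ M(2)] by fastforce
    \<comment> \<open>The number of losers. They cover \<open>n\<close> of the \<open>k - 1\<close>
      copies of \<open>t\<close>; each of the other \<open>k - 1 - n\<close> copies is bounded by
      \<open>d / (k + 1)\<close>.\<close>
    moreover define n where "n = j - q - 1"
    have n: "n \<le> k - 1" "j = q + n + 1"
      using 2 length_Ch[of x] by (auto simp: n_def j_def)
    have "t * (k - 1) = t * (k - 1 - n) + t * n"
      using n(1) by (metis distrib_left le_add_diff_inverse2)
    ultimately have "d + 1 \<le> (esz M + n * t) + t * (k - 1 - n)"
      by (simp add: mult.commute)
    then have "(k + 1) * (d + 1) \<le> (k + 1) * (esz M + n * t) + ((k + 1) * t) * (k - 1 - n)"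
      by (metis mult_le_mono2 distrib_left mult.assoc)
    also have "((k + 1) * t) * (k - 1 - n) \<le> d * (k - 1 - n)"
      using M(3) by (rule mult_le_mono1)
    \<comment> \<open>The \<open>+ 1\<close> on the right comes from attaching one tree more than
      there are branches. It is paid for by the \<open>+ 1\<close> on the left, which failed
      admissibility provides.\<close>
    finally have "(k + 1) * (d + 1) + d * (q + J) \<le> (k + 1) * (w + 1) + d * (k - 1 - n)"
      using M(4) unfolding n_def by linarith
    moreover have "(k - 1 - n) + (n + 2) = k + 1"
      using n(1) k_pos by simp
    then have "d * (k - 1 - n) + d * (n + 2) = d * (k + 1)"
      by (metis distrib_left)
    ultimately have "d * (n + 2) + d * (q + J) \<le> (k + 1) * w"
      by (simp add: algebra_simps)
    then have "d * (1 + (j + J)) \<le> (k + 1) * w"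
      unfolding n(2) by (simp add: algebra_simps)
    then show ?thesis
      unfolding strong_def nc w_def by simp
  next
    case 3
    then have "q + 0 \<le> length (Ch x)"
      by (simp add: j_def)
    from exchange_exists[OF Node.prems(1) dich q_def this J_def]
    obtain M Q U D t where M: "rearr 0 (Node x bs) M Q U D"
      "(k + 1) * (esz M + (j - q - 0) * t) + d * (q + J) \<le> (k + 1) * (w + 0)"
      unfolding j_def w_def by blast
    then have *: "(k + 1) * esz M + d * (j + J) \<le> (k + 1) * w"
      using 3 by simp
    show ?thesis
    proof (cases "strong (Node x bs)")
      case False
      then have "(k + 1) * w < d + d * (j + J)"
        unfolding strong_def nc w_def by simp
      then have "(k + 1) * esz M < d"
        using * by linarith
      then have "weak_core (Node x bs) M"
        using M(1) * unfolding weak_core_def nc w_def by blast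
      then show ?thesis
        by blast
    qed blast
  qed
qed

text \<open>Version for the first tree of the list. No earlier tree could take over a spare out-edge
  of its root, so the exchange at the root must be balanced. No extra tree is attached then, and the
  \<open>+ 1\<close> from failed admissibility survives as strictness.\<close>

lemma strictly_strong:
  assumes "wft (Node x bs)"
    and ne: "\<And>e b s M Q U D. (e, b) \<in> set bs \<Longrightarrow> s \<in> subtrees b \<Longrightarrow> rearr 1 s M Q U D \<Longrightarrow> \<not> admissible M"
    and ne0: "\<And>M Q U D. rearr 0 (Node x bs) M Q U D \<Longrightarrow> \<not> admissible M"
  shows "d * (1 + num_children (Node x bs)) < (k + 1) * weight (Node x bs)"
proof -
  have "strong b \<or> (\<exists>M. weak_core b M)" if b: "(e, b) \<in> set bs" for e b
    using strong_or_weak[of b] ne[OF b] assms(1) b by auto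
  then have dich: "\<forall>(e, b)\<in>set bs. strong b \<or> (\<exists>M. weak_core b M)"
    by blast
  define q where "q = length (filter (\<lambda>(e, b). strong b) bs)"
  define j where "j = length (Ch x)"
  define J where "J = (\<Sum>(e, b)\<leftarrow>bs. num_children b)"
  define w where "w = weight (Node x bs)"
  have nc: "num_children (Node x bs) = j + J"
    by (simp only: num_children_Node j_def J_def)
  show ?thesis
  proof (cases "j < q")
    case True
    then show ?thesis
      using many_strong[OF dich q_def] by (simp only: j_def)
  next
    case False
    then have "q + 0 \<le> length (Ch x)"
      by (simp add: j_def)
    from exchange_exists[OF assms(1) dich q_def this J_def]
    obtain M Q U D t where M: "rearr 0 (Node x bs) M Q U D" "depth M \<le> Suc t" "(k + 1) * t \<le> d"
      "(k + 1) * (esz M + (j - q - 0) * t) + d * (q + J) \<le> (k + 1) * (w + 0)"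
      unfolding j_def w_def by blast
    have inv: "d + 1 \<le> esz M + t * (k - 1)"
      using not_admissible[OF ne0[OF M(1)] M(2)] by simp
    define n where "n = j - q"
    have n: "n \<le> k" "j = q + n"
      using False length_Ch[of x] by (auto simp: n_def j_def)
    have M4: "(k + 1) * (esz M + n * t) + d * (q + J) \<le> (k + 1) * w"
      using M(4) by (simp add: n_def)
    have "d * (1 + (j + J)) < (k + 1) * w"
    \<comment> \<open>With \<open>k\<close> losers there is one more than the \<open>k - 1\<close>
      required, and \<open>k - 1 - n\<close> would be a truncated difference.\<close>
    proof (cases "n = k")
      case True
      have "t * (k - 1) \<le> n * t"
        using True by (simp add: mult.commute)
      then have "(k + 1) * (d + 1) \<le> (k + 1) * (esz M + n * t)"
        using inv by (intro mult_le_mono2) linarith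
      moreover have "d * (1 + (j + J)) = d * (k + 1) + d * (q + J)"
        unfolding n(2) True by (simp add: algebra_simps)
      ultimately show ?thesis
        using M4 by (simp add: algebra_simps)
    next
      case False
      then have n': "n \<le> k - 1"
        using n(1) by simp
      have "t * (k - 1) = t * (k - 1 - n) + t * n"
        using n' by (metis distrib_left le_add_diff_inverse2)
      then have "d + 1 \<le> (esz M + n * t) + t * (k - 1 - n)"
        using inv by (simp add: mult.commute)
      then have "(k + 1) * (d + 1) \<le> (k + 1) * (esz M + n * t) + ((k + 1) * t) * (k - 1 - n)"
        by (metis mult_le_mono2 distrib_left mult.assoc)
      also have "((k + 1) * t) * (k - 1 - n) \<le> d * (k - 1 - n)"
        using M(3) by (rule mult_le_mono1)
      finally have "(k + 1) * (d + 1) + d * (q + J) \<le> (k + 1) * w + d * (k - 1 - n)"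
        using M4 by linarith
      moreover have "(k - 1 - n) + (n + 2) = k + 1"
        using n' k_pos by simp
      then have "d * (k - 1 - n) + d * (n + 2) = d * (k + 1)"
        by (metis distrib_left)
      ultimately have "d * (n + 2) + (k + 1) + d * (q + J) \<le> (k + 1) * w"
        by (simp add: algebra_simps)
      then show ?thesis
        unfolding n(2) by (simp add: algebra_simps)
    qed
    then show ?thesis
      unfolding nc w_def .
  qed
qed

end

section \<open>Multiset counts, and layerings as certificates of bounded depth\<close>

lemma size_sum_mset: "size (\<Sum>x\<in>#M. f x :: 'b multiset) = (\<Sum>x\<in>#M. size (f x))"
  by (induction M) auto

lemma card_set_mset_le_size: "card (set_mset M) \<le> size M"
  by (metis mset_set_set_mset_msubset size_mset_mono size_mset_set)

lemma count_le_one_subset: "A \<subseteq># mset_set B \<Longrightarrow> count A x \<le> 1"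
  using mset_subset_eq_count[of A "mset_set B" x] by (cases "finite B"; cases "x \<in> B") auto

lemma card_set_mset_subset:
  assumes "A \<subseteq># mset_set B"
  shows "card (set_mset A) = size A"
proof -
  have "mset_set (set_mset A) = A"
  proof (rule multiset_eqI)
    fix x
    show "count (mset_set (set_mset A)) x = count A x"
    proof (cases "x \<in># A")
      case True
      then have "count A x = 1"
        using count_le_one_subset[OF assms] count_greater_eq_one_iff[of A x] by (simp only: le_antisym)
      then show ?thesis
        using True by simp
    next
      case False
      then show ?thesis
        by (simp add: not_in_iff)
    qed
  qed
  then show ?thesis
    by (metis size_mset_set)
qed

context incidence
begin

text \<open>
  A certificate that \<open>A\<close> is a forest all of whose trees have depth at most \<open>r\<close>.  In contrast to
  the depth of a rooted tree it is inherited by subsets.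
\<close>

definition layering :: "('v \<Rightarrow> nat) \<Rightarrow> ('e \<Rightarrow> 'v) \<Rightarrow> nat \<Rightarrow> 'e set \<Rightarrow> bool" where
  "layering lev low r A \<longleftrightarrow> inj_on low A \<and>
     (\<forall>e\<in>A. \<exists>u. N e = {u, low e} \<and> lev (low e) = Suc (lev u) \<and> lev (low e) \<le> r)"

lemma layering_mono: "layering lev low r A \<Longrightarrow> B \<subseteq> A \<Longrightarrow> layering lev low r B"
  unfolding layering_def by (meson inj_on_subset subset_iff)

text \<open>The levels of the second forest are raised by one, and \<open>f\<close> receives
  \<open>y\<close> as its lower end. No edge of \<open>A2\<close> has \<open>y\<close> as its lower
  end, so \<open>low\<close> remains injective.\<close>

lemma layering_graft:
  assumes 1: "layering lev1 low1 r1 A1" "\<And>e. e \<in> A1 \<Longrightarrow> N e \<subseteq> S1 \<and> low1 e \<noteq> x" "lev1 x = 0" "x \<in> S1"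
    and 2: "layering lev2 low2 r2 A2" "\<And>e. e \<in> A2 \<Longrightarrow> N e \<subseteq> S2 \<and> low2 e \<noteq> y" "lev2 y = 0" "y \<in> S2"
    and "S1 \<inter> S2 = {}" and f: "N f = {x, y}"
  defines "lev \<equiv> \<lambda>v. if v \<in> S2 then Suc (lev2 v) else lev1 v"
    and "low \<equiv> \<lambda>e. if e = f then y else if e \<in> A2 then low2 e else low1 e"
  shows "layering lev low (max r1 (Suc r2)) (insert f (A1 \<union> A2))" and "lev x = 0"
    and "e \<in> insert f (A1 \<union> A2) \<Longrightarrow> low e \<noteq> x"
proof -
  have x: "x \<notin> S2" "y \<notin> S1" "x \<noteq> y"
    using assms by auto
  have low1: "\<exists>u. N e = {u, low1 e} \<and> lev1 (low1 e) = Suc (lev1 u) \<and> lev1 (low1 e) \<le> r1" if "e \<in> A1" for e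
    using 1(1) that unfolding layering_def by auto
  have low2: "\<exists>u. N e = {u, low2 e} \<and> lev2 (low2 e) = Suc (lev2 u) \<and> lev2 (low2 e) \<le> r2" if "e \<in> A2" for e
    using 2(1) that unfolding layering_def by auto
  have mem1: "low1 e \<in> S1" if "e \<in> A1" for e
    using low1[OF that] 1(2)[OF that] by auto
  have mem2: "low2 e \<in> S2" if "e \<in> A2" for e
    using low2[OF that] 2(2)[OF that] by auto
  have f1: "f \<notin> A1" "f \<notin> A2"
    using 1(2)[of f] 2(2)[of f] x f by auto
  have A12: "A1 \<inter> A2 = {}"
  proof (rule equals0I)
    fix e assume "e \<in> A1 \<inter> A2"
    then have "N e \<subseteq> S1 \<inter> S2" "N e \<noteq> {}"
      using 1(2) 2(2) low1 by blast+
    then show False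
      using assms(9) by simp
  qed
  have e1: "low e = low1 e" if "e \<in> A1" for e
    using that f1 A12 unfolding low_def by auto
  have e2: "low e = low2 e" if "e \<in> A2" for e
    using that f1 unfolding low_def by auto
  have ef: "low f = y"
    unfolding low_def by simp
  show "lev x = 0"
    using x 1(3) unfolding lev_def by simp
  show "low e \<noteq> x" if "e \<in> insert f (A1 \<union> A2)"
    using that e1[of e] e2[of e] ef mem2[of e] x 1(2)[of e] by (elim insertE UnE) auto
  have "inj_on low A1" "inj_on low A2"
    using 1(1) 2(1) e1 e2 unfolding layering_def by (auto cong: inj_on_cong)
  moreover have "low ` A1 \<subseteq> S1"
    using e1 mem1 by auto
  moreover have "low ` A2 \<subseteq> S2 - {y}"
    using e2 mem2 2(2) by (intro image_subsetI) (metis DiffI singletonD)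
  ultimately have "inj_on low (insert f (A1 \<union> A2))"
    unfolding inj_on_insert inj_on_Un ef using x(2) assms(9) by blast
  moreover have "\<exists>u. N e = {u, low e} \<and> lev (low e) = Suc (lev u) \<and> lev (low e) \<le> max r1 (Suc r2)"
    if "e \<in> insert f (A1 \<union> A2)" for e
    using that
  proof (elim insertE UnE)
    assume "e = f"
    then show ?thesis
      using f ef x 1(3) 2(3,4) by (intro exI[of _ x]) (auto simp: lev_def)
  next
    assume e: "e \<in> A1"
    then obtain u where u: "N e = {u, low1 e}" "lev1 (low1 e) = Suc (lev1 u)" "lev1 (low1 e) \<le> r1"
      using low1 by blast
    then have "u \<notin> S2" "low1 e \<notin> S2"
      using 1(2)[OF e] assms(9) by auto
    then show ?thesis
      using u e1[OF e] by (intro exI[of _ u]) (auto simp: lev_def)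
  next
    assume e: "e \<in> A2"
    then obtain u where u: "N e = {u, low2 e}" "lev2 (low2 e) = Suc (lev2 u)" "lev2 (low2 e) \<le> r2"
      using low2 by blast
    then have "u \<in> S2" "low2 e \<in> S2"
      using 2(2)[OF e] by auto
    then show ?thesis
      using u e2[OF e] by (intro exI[of _ u]) (auto simp: lev_def)
  qed
  ultimately show "layering lev low (max r1 (Suc r2)) (insert f (A1 \<union> A2))"
    unfolding layering_def by blast
qed

text \<open>Levels are distances from the root, and \<open>low e\<close> is the end of
  \<open>e\<close> farther from it; a vertex other than the root has only one edge towards the root.
  The last two clauses keep the root free, so that the tree can be grafted below another
  vertex.\<close>

lemma tree_layering:
  assumes "wft s" and "\<And>v. count (vm s) v \<le> 1"
  shows "\<exists>lev low. layering lev low (depth s) (set_mset (em s)) \<and> lev (root s) = 0 \<and>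
    (\<forall>e\<in>#em s. low e \<noteq> root s)"
  using assms
proof (induction s)
  case (Node x bs)
  show ?case
    using Node
  proof (induction bs)
    case Nil
    show ?case
      by (rule exI[of _ "\<lambda>_. 0"], rule exI[of _ undefined]) (auto simp: layering_def)
  next
    case (Cons eb bs)
    obtain e b where eb: "eb = (e, b)"
      by fastforce
    have cnt: "count (vm (Node x bs)) v + count (vm b) v \<le> 1" for v
    proof -
      have "count (vm (Node x (eb # bs))) v = count (vm (Node x bs)) v + count (vm b) v"
        using eb by simp
      then show ?thesis
        using Cons.prems(3)[of v] by simp
    qed
    have cnt1: "count (vm b) v \<le> 1" for v
      using cnt[of v] by linarith
    have wb: "wft b" "wft (Node x bs)" and e: "N e = {x, root b}"
      using Cons.prems(2) eb by auto
    have "\<exists>lev low. layering lev low (depth b) (set_mset (em b)) \<and> lev (root b) = 0 \<and>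
        (\<forall>e\<in>#em b. low e \<noteq> root b)"
      by (rule Cons.prems(1)[of eb b]) (use eb wb(1) cnt1 in simp_all)
    then obtain lev2 low2 where 2: "layering lev2 low2 (depth b) (set_mset (em b))" "lev2 (root b) = 0"
        "\<forall>e\<in>#em b. low2 e \<noteq> root b"
      by blast
    have "\<exists>lev low. layering lev low (depth (Node x bs)) (set_mset (em (Node x bs))) \<and> lev (root (Node x bs)) = 0 \<and>
        (\<forall>e\<in>#em (Node x bs). low e \<noteq> root (Node x bs))"
    proof (rule Cons.IH[OF Cons.prems(1)[OF list.set_intros(2)] wb(2)])
      show "count (vm (Node x bs)) v \<le> 1" for v
        using cnt[of v] by linarith
    qed
    then obtain lev1 low1 where 1: "layering lev1 low1 (depth (Node x bs)) (set_mset (em (Node x bs)))" "lev1 x = 0"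
        "\<forall>e\<in>#em (Node x bs). low1 e \<noteq> x"
      by auto
    have disj: "set_mset (vm (Node x bs)) \<inter> set_mset (vm b) = {}"
    proof (rule ccontr)
      assume "\<not> ?thesis"
      then obtain v where "v \<in># vm (Node x bs)" "v \<in># vm b"
        by blast
      then have "1 \<le> count (vm (Node x bs)) v" "1 \<le> count (vm b) v"
        by (simp_all only: count_greater_eq_one_iff)
      then show False
        using cnt[of v] by linarith
    qed
    have dep: "depth (Node x (eb # bs)) = max (depth (Node x bs)) (Suc (depth b))"
    proof -
      have "depth (Node x (eb # bs)) = Max (insert (Suc (depth b)) (insert 0 ((\<lambda>(e, b). Suc (depth b)) ` set bs)))"
        by (simp only: depth.simps list.set image_insert eb prod.case insert_commute)
      also have "\<dots> = max (Suc (depth b)) (depth (Node x bs))"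
        by (subst Max_insert) simp_all
      finally show ?thesis
        by (simp only: max.commute)
    qed
    have emE: "set_mset (em (Node x (eb # bs))) = insert e (set_mset (em (Node x bs)) \<union> set_mset (em b))"
      using eb by auto
    note g = layering_graft[of lev1 low1 "depth (Node x bs)" "set_mset (em (Node x bs))" "set_mset (vm (Node x bs))" x
        lev2 low2 "depth b" "set_mset (em b)" "set_mset (vm b)" "root b" e]
    have p1: "N f \<subseteq> set_mset (vm (Node x bs)) \<and> low1 f \<noteq> x" if "f \<in># em (Node x bs)" for f
      using ends_in_vm[OF wb(2) that] 1(3) that by blast
    have p2: "N f \<subseteq> set_mset (vm b) \<and> low2 f \<noteq> root b" if "f \<in># em b" for f
      using ends_in_vm[OF wb(1) that] 2(3) that by blast
    have px: "x \<in># vm (Node x bs)"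
      by simp
    show ?case
      unfolding emE dep rtree.sel
      using g(1)[OF 1(1) p1 1(2) px 2(1) p2 2(2) root_in_vm disj e]
        g(2)[OF 1(1) p1 1(2) px 2(1) p2 2(2) root_in_vm disj e]
        g(3)[OF 1(1) p1 1(2) px 2(1) p2 2(2) root_in_vm disj e]
      by blast
  qed
qed

end

section \<open>Partial decompositions\<close>

text \<open>\<open>sparse\<close> is the bound on the average degree with denominators cleared, so
  that the combinatorial part takes place in the natural numbers.\<close>

locale sparse_graph = incidence N for N :: "'e \<Rightarrow> 'v set" +
  fixes V :: "'v set" and E :: "'e set" and k d :: nat
  assumes finite_V: "finite V" and finite_E: "finite E"
    and ends: "e \<in> E \<Longrightarrow> N e \<subseteq> V \<and> (card (N e) = 1 \<or> card (N e) = 2)"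
    and k_pos: "k \<ge> 1"
    and sparse: "\<lbrakk>S \<subseteq> V; S \<noteq> {}; X \<subseteq> E; \<And>e. e \<in> X \<Longrightarrow> N e \<subseteq> S\<rbrakk> \<Longrightarrow>
      card X * (d + k + 1) \<le> (k * (d + k + 1) + d) * card S"
begin

text \<open>The two equations with \<open>mset_set\<close> say at once that the trees are disjoint
  and span \<open>V\<close> and that every edge of \<open>F\<close> is used once, as red or as blue.
  A pair in \<open>B\<close> is a blue edge with its tail. The set \<open>F\<close> is a parameter
  because edges are first inserted one by one.\<close>

definition state :: "'e set \<Rightarrow> ('v, 'e) rtree multiset \<Rightarrow> ('v \<times> 'e) multiset \<Rightarrow> bool" where
  "state F T B \<longleftrightarrow> (\<forall>s\<in>#T. wft s) \<and> (\<Sum>s\<in>#T. vm s) = mset_set V \<and>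
     (\<Sum>s\<in>#T. em s) + image_mset snd B = mset_set F \<and> (\<forall>(v, e)\<in>#B. v \<in> N e) \<and>
     (\<forall>v. count (image_mset fst B) v \<le> k)"

lemma stateD:
  assumes "state F T B"
  shows "s \<in># T \<Longrightarrow> wft s" and "(\<Sum>s\<in>#T. vm s) = mset_set V"
    and "(\<Sum>s\<in>#T. em s) + image_mset snd B = mset_set F"
    and "(v, e) \<in># B \<Longrightarrow> v \<in> N e" and "count (image_mset fst B) v \<le> k"
proof -
  note 1 = assms[unfolded state_def, THEN conjunct1]
  note 2 = assms[unfolded state_def, THEN conjunct2]
  note 3 = 2[THEN conjunct2]
  note 4 = 3[THEN conjunct2]
  show "s \<in># T \<Longrightarrow> wft s"
    using 1 by (rule bspec)
  show "(\<Sum>s\<in>#T. vm s) = mset_set V"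
    using 2 by (rule conjunct1)
  show "(\<Sum>s\<in>#T. em s) + image_mset snd B = mset_set F"
    using 3 by (rule conjunct1)
  show "(v, e) \<in># B \<Longrightarrow> v \<in> N e"
    using bspec[OF 4[THEN conjunct1]] by fastforce
  show "count (image_mset fst B) v \<le> k"
    using 4[THEN conjunct2] by (rule spec)
qed

lemma state_replace:
  assumes "state F (T1 + T) (B1 + B)" and "\<And>s. s \<in># T2 \<Longrightarrow> wft s"
    and "(\<Sum>s\<in>#T2. vm s) = (\<Sum>s\<in>#T1. vm s)"
    and "(\<Sum>s\<in>#T2. em s) + image_mset snd B2 = (\<Sum>s\<in>#T1. em s) + image_mset snd B1"
    and "\<And>v e. (v, e) \<in># B2 \<Longrightarrow> v \<in> N e" and "\<And>v. count (image_mset fst (B2 + B)) v \<le> k"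
  shows "state F (T2 + T) (B2 + B)"
proof -
  have "(\<Sum>s\<in>#T2 + T. em s) + image_mset snd (B2 + B) =
      ((\<Sum>s\<in>#T2. em s) + image_mset snd B2) + ((\<Sum>s\<in>#T. em s) + image_mset snd B)"
    "(\<Sum>s\<in>#T1 + T. em s) + image_mset snd (B1 + B) =
      ((\<Sum>s\<in>#T1. em s) + image_mset snd B1) + ((\<Sum>s\<in>#T. em s) + image_mset snd B)"
    by (simp_all add: ac_simps)
  then have em: "(\<Sum>s\<in>#T2 + T. em s) + image_mset snd (B2 + B) = mset_set F"
    unfolding assms(4) stateD(3)[OF assms(1), symmetric] by (rule trans[OF _ sym])
  have vm: "(\<Sum>s\<in>#T2 + T. vm s) = mset_set V"
    unfolding stateD(2)[OF assms(1), symmetric] by (simp add: assms(3))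
  have wf: "\<forall>s\<in>#T2 + T. wft s"
    using assms(2) stateD(1)[OF assms(1)] by auto
  have tl: "\<forall>(v, e)\<in>#B2 + B. v \<in> N e"
    using assms(5) stateD(4)[OF assms(1)] by auto
  show ?thesis
    unfolding state_def by (intro conjI wf vm em tl allI assms(6))
qed

lemma state_vm_subset:
  assumes "state F (T1 + T2) B"
  shows "(\<Sum>s\<in>#T1. vm s) \<subseteq># mset_set V"
proof -
  have "(\<Sum>s\<in>#T1. vm s) + (\<Sum>s\<in>#T2. vm s) = mset_set V"
    using stateD(2)[OF assms] by simp
  then show ?thesis
    using mset_subset_eq_add_left[of "\<Sum>s\<in>#T1. vm s" "\<Sum>s\<in>#T2. vm s"] by simp
qed

lemma state_vm_disjoint:
  assumes "state F (add_mset s (add_mset t T)) B" and "x \<in># vm s" and "x \<in># vm t"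
  shows False
proof -
  have "state F ({#s, t#} + T) B"
    using assms(1) by (simp only: union_mset_add_mset_left add_0)
  then have "count (vm s + vm t) x \<le> 1"
    using count_le_one_subset[OF state_vm_subset, of F "{#s, t#}" T B x] by simp
  moreover have "1 \<le> count (vm s) x"
    using assms(2) by (simp only: count_greater_eq_one_iff)
  moreover have "1 \<le> count (vm t) x"
    using assms(3) by (simp only: count_greater_eq_one_iff)
  ultimately show False
    by simp
qed

lemma state_vertex:
  assumes "state F T B"
  shows "x \<in> V \<longleftrightarrow> (\<exists>s\<in>#T. x \<in># vm s)"
proof -
  have "x \<in> V \<longleftrightarrow> x \<in># (\<Sum>s\<in>#T. vm s)"
    unfolding stateD(2)[OF assms] using finite_V by simp
  then show ?thesis
    by simp
qed

lemma state_count_vm: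
  assumes "state F T B" and "s \<in># T"
  shows "count (vm s) v \<le> 1"
proof -
  obtain T' where "T = {#s#} + T'"
    using multi_member_split[OF assms(2)] by auto
  then have "vm s \<subseteq># mset_set V"
    using state_vm_subset[of F "{#s#}" T' B] assms(1) by simp
  then show ?thesis
    by (rule count_le_one_subset)
qed

text \<open>The red edges of \<open>T1\<close>, the \<open>k\<close> blue edges out of each vertex
  of \<open>S\<close> and the edges of \<open>X\<close> are all different and lie inside
  \<open>S\<close>, so sparsity applies to their union. \<open>X\<close> will be a single uncovered
  edge in one use and empty in the other.\<close>

lemma density_bound:
  assumes st: "state F (T1 + T2) B" and F: "F \<subseteq> E" and S: "S = set_mset (\<Sum>s\<in>#T1. vm s)" "S \<noteq> {}"
    and full: "\<And>v. v \<in> S \<Longrightarrow> count (image_mset fst B) v = k"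
    and closed: "\<And>v e. (v, e) \<in># B \<Longrightarrow> v \<in> S \<Longrightarrow> N e \<subseteq> S"
    and X: "X \<subseteq> E - F" "\<And>e. e \<in> X \<Longrightarrow> N e \<subseteq> S"
  shows "((\<Sum>s\<in>#T1. esz s) + k * card S + card X) * (d + k + 1) \<le> (k * (d + k + 1) + d) * card S"
proof -
  define B1 where "B1 = filter_mset (\<lambda>p. fst p \<in> S) B"
  define Y where "Y = (\<Sum>s\<in>#T1. em s) + image_mset snd B1"
  have finF: "finite F"
    using F finite_E finite_subset by blast
  have "Y \<subseteq># (\<Sum>s\<in>#T1 + T2. em s) + image_mset snd B"
    unfolding Y_def B1_def by (intro subset_mset.add_mono image_mset_subseteq_mono multiset_filter_subset) simp
  then have YF: "Y \<subseteq># mset_set F"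
    using st unfolding state_def by simp
  then have setY: "set_mset Y \<subseteq> F"
    using finF by (metis finite_set_mset_mset_set set_mset_mono)
  have "size B1 = (\<Sum>v\<in>S. count (image_mset fst B1) v)"
  proof -
    have "size B1 = size (image_mset fst B1)"
      by simp
    also have "\<dots> = (\<Sum>v\<in>set_mset (image_mset fst B1). count (image_mset fst B1) v)"
      by (simp only: size_multiset_overloaded_eq)
    also have "\<dots> = (\<Sum>v\<in>S. count (image_mset fst B1) v)"
    proof (rule sum.mono_neutral_left)
      show "finite S"
        unfolding S(1) by simp
      show "set_mset (image_mset fst B1) \<subseteq> S"
        unfolding B1_def by auto
      show "\<forall>v\<in>S - set_mset (image_mset fst B1). count (image_mset fst B1) v = 0"
        by (meson DiffD2 not_in_iff)
    qed
    finally show ?thesis .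
  qed
  also have "\<dots> = (\<Sum>v\<in>S. k)"
  proof (rule sum.cong[OF refl])
    fix v assume v: "v \<in> S"
    have "image_mset fst B1 = filter_mset (\<lambda>v. v \<in> S) (image_mset fst B)"
      unfolding B1_def by (simp add: filter_mset_image_mset)
    then show "count (image_mset fst B1) v = k"
      using full[OF v] v by simp
  qed
  finally have "size B1 = k * card S"
    by simp
  then have sizeY: "size Y = (\<Sum>s\<in>#T1. esz s) + k * card S"
    unfolding Y_def by (simp add: size_sum_mset image_mset.compositionality o_def)
  have cardYX: "card (set_mset Y \<union> X) = (\<Sum>s\<in>#T1. esz s) + k * card S + card X"
    using card_set_mset_subset[OF YF] setY X(1) sizeY finite_E
    by (subst card_Un_disjoint) (auto intro: finite_subset)
  have "S \<subseteq> V"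
    using set_mset_mono[OF state_vm_subset[OF st]] finite_V unfolding S by simp
  moreover have "N e \<subseteq> S" if e: "e \<in> set_mset Y \<union> X" for e
  proof -
    consider s where "s \<in># T1" "e \<in># em s" | v where "(v, e) \<in># B" "v \<in> S" | "e \<in> X"
      using e unfolding Y_def B1_def by auto
    then show ?thesis
    proof cases
      case 1
      then have "N e \<subseteq> set_mset (vm s)"
        using st ends_in_vm unfolding state_def by auto
      then show ?thesis
        using 1 S by auto
    qed (use closed X in auto)
  qed
  ultimately show ?thesis
    using sparse[of S "set_mset Y \<union> X"] S(2) setY F X(1) unfolding cardYX by blast
qed

lemma state_reroot:
  assumes "state F (add_mset K T) B" and "wft K'" and "vm K' = vm K" and "em K' = em K"
  shows "state F (add_mset K' T) B"
  using state_replace[of F "{#K#}" T "{#}" B "{#K'#}" "{#}"] assms stateD(5)[OF assms(1)] by simp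

lemma state_cut:
  assumes st: "state F (add_mset K T) B" and x: "x \<in># vm K" "x \<noteq> root K"
    and spare: "count (image_mset fst B) x < k"
  shows "\<exists>K0 s f. wft K0 \<and> wft s \<and> root K0 = root K \<and> root s = x \<and> vm K = vm K0 + vm s \<and>
    em K = add_mset f (em K0 + em s) \<and> state F (add_mset K0 (add_mset s T)) (add_mset (x, f) B)"
proof -
  have "wft K"
    using stateD(1)[OF st] by simp
  from cut_above[OF this x] obtain K0 s f a where c: "wft K0" "wft s" "root K0 = root K" "root s = x"
    "a \<in># vm K0" "N f = {a, x}" "vm K = vm K0 + vm s" "em K = add_mset f (em K0 + em s)"
    by blast
  have "state F ({#K0, s#} + T) ({#(x, f)#} + B)"
  proof (rule state_replace[of F "{#K#}" T "{#}" B])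
    show "count (image_mset fst ({#(x, f)#} + B)) v \<le> k" for v
      using spare stateD(5)[OF st, of v] by (cases "v = x") auto
  qed (use st c in \<open>auto simp: ac_simps\<close>)
  then show ?thesis
    using c by (intro exI[of _ K0] exI[of _ s] exI[of _ f]) simp
qed

lemma state_join:
  assumes st: "state F (add_mset K (add_mset K' T)) B" and "a \<in># vm K" "b \<in># vm K'" "N e = {a, b}"
    and B: "B = add_mset (c, e) B'"
  shows "\<exists>J. wft J \<and> vm J = vm K + vm K' \<and> em J = add_mset e (em K + em K') \<and> state F (add_mset J T) B'"
proof -
  have w: "wft K" "wft K'"
    using stateD(1)[OF st] by simp_all
  obtain J where J: "wft J" "vm J = vm K + vm K'" "em J = add_mset e (em K + em K')"
    using join_trees[OF w assms(2-4)] by blast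
  have "state F ({#J#} + T) ({#} + B')"
  proof (rule state_replace[of F "{#K, K'#}" T "{#(c, e)#}" B'])
    show "count (image_mset fst ({#} + B')) v \<le> k" for v
      using stateD(5)[OF st, of v] unfolding B by (auto split: if_splits)
  qed (use st J B in \<open>auto simp: ac_simps\<close>)
  then show ?thesis
    using J by auto
qed

lemma state_insert:
  assumes "state F T B" and "finite F" and "e \<notin> F" and "v \<in> N e" and "count (image_mset fst B) v < k"
  shows "state (insert e F) T (add_mset (v, e) B)"
proof -
  have "mset_set (insert e F) = add_mset e (mset_set F)"
    using assms(2,3) by simp
  moreover have "count (image_mset fst (add_mset (v, e) B)) u \<le> k" for u
    using assms(5) stateD(5)[OF assms(1), of u] by (cases "u = v") auto
  ultimately show ?thesis
    using stateD[OF assms(1)] assms(4) unfolding state_def by auto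
qed

lemma state_insert_join:
  assumes st: "state F (add_mset K (add_mset K' T)) B" and "finite F" "e \<notin> F"
    and "a \<in># vm K" "b \<in># vm K'" "N e = {a, b}"
  shows "\<exists>T' B. state (insert e F) T' B"
proof -
  have w: "wft K" "wft K'"
    using stateD(1)[OF st] by simp_all
  obtain J where J: "wft J" "vm J = vm K + vm K'" "em J = add_mset e (em K + em K')"
    using join_trees[OF w assms(4-6)] by blast
  have "mset_set (insert e F) = add_mset e (mset_set F)"
    using assms(2,3) by simp
  then have "state (insert e F) (add_mset J T) B"
    using stateD[OF st] J unfolding state_def by (auto simp: ac_simps)
  then show ?thesis
    by blast
qed

section \<open>Augmentation: covering one more edge\<close>

lemma ends_obtain:
  assumes "e \<in> E"
  obtains a b where "N e = {a, b}" "a \<in> V" "b \<in> V"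
  using ends[OF assms] by (metis card_1_singletonE card_2_iff insert_absorb2 insert_subset)

lemma state_tree_of:
  assumes "state F T B" and "x \<in> V"
  obtains K T' where "T = add_mset K T'" "x \<in># vm K"
  using state_vertex[OF assms(1), of x] assms(2) by (metis insert_DiffM)

lemma blue_edge:
  assumes st: "state F T B" and "F \<subseteq> E" and "(v, e) \<in># B"
  obtains u where "N e = {v, u}" "u \<in> V" "e \<in> F"
proof -
  have "e \<in># (\<Sum>s\<in>#T. em s) + image_mset snd B"
    using assms(3) by force
  then have "e \<in> F"
    unfolding stateD(3)[OF st] by (metis elem_mset_set empty_iff mset_set.infinite set_mset_empty)
  moreover have "v \<in> N e"
    using stateD(4)[OF st assms(3)] .
  ultimately show ?thesis
    using that assms(2) ends_obtain[of e] by (metis doubleton_eq_iff empty_iff insertE subsetD)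
qed

text \<open>For an uncovered edge with ends \<open>a\<close> and \<open>b\<close>, take a state on
  \<open>F\<close> whose tree at \<open>a\<close> is smallest. If that tree missed \<open>b\<close>,
  had a vertex with a spare out-edge or had an outgoing blue edge, then \<open>e\<close> could be
  inserted, \<open>a\<close> would gain a spare out-edge, or the tree could shrink. Otherwise its
  vertex set \<open>S\<close> spans at least \<open>(k + 1) * card S\<close> edges, \<open>e\<close>
  included, which is too dense.\<close>

lemma extend_state:
  assumes F: "F \<subset> E" and "state F T B"
  shows "\<exists>e T B. e \<in> E - F \<and> state (insert e F) T B"
proof (rule ccontr)
  assume contra: "\<not> ?thesis"
  have finF: "finite F"
    using F finite_E finite_subset by blast
  obtain e where e: "e \<in> E" "e \<notin> F"
    using F by blast
  have no: "\<not> state (insert e F) T B" for T B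
    using contra e by blast
  obtain a b where ab: "N e = {a, b}" "a \<in> V" "b \<in> V"
    using ends_obtain[OF e(1)] .
  define P where "P n \<longleftrightarrow> (\<exists>K T B. state F (add_mset K T) B \<and> a \<in># vm K \<and> esz K = n)" for n
  obtain K0 T0 where "T = add_mset K0 T0" "a \<in># vm K0"
    using state_tree_of[OF assms(2) ab(2)] .
  then have "P (esz K0)"
    using assms(2) unfolding P_def by blast
  then have "P (LEAST n. P n)"
    by (rule LeastI)
  then obtain K T B where st0: "state F (add_mset K T) B" and aK0: "a \<in># vm K" and "esz K = (LEAST n. P n)"
    unfolding P_def by blast
  then have min0: "esz K \<le> esz K'" if "state F (add_mset K' T') B'" "a \<in># vm K'" for K' T' B'
    using that Least_le[of P "esz K'"] unfolding P_def by auto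
  obtain K1 where K1: "wft K1" "root K1 = a" "vm K1 = vm K" "em K1 = em K"
    using reroot[OF stateD(1)[OF st0, of K] aK0] by auto
  have st: "state F (add_mset K1 T) B"
    using state_reroot[OF st0 K1(1,3,4)] .
  have aK: "a \<in># vm K1"
    using aK0 K1(3) by simp
  have min: "esz K1 \<le> esz K'" if "state F (add_mset K' T') B'" "a \<in># vm K'" for K' T' B'
    using min0[OF that] K1(4) by simp
  have bK: "b \<in># vm K1"
  proof (rule ccontr)
    assume "b \<notin># vm K1"
    then obtain K' T' where "add_mset K1 T = add_mset K' T'" "b \<in># vm K'" "K' \<noteq> K1"
      using state_tree_of[OF st ab(3)] by metis
    then obtain T'' where "state F (add_mset K1 (add_mset K' T'')) B"
      using st by (metis add_eq_conv_ex)
    then show False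
      using state_insert_join[OF _ finF e(2) aK \<open>b \<in># vm K'\<close> ab(1)] no by blast
  qed
  have a_full: "\<not> count (image_mset fst B') a < k" if "state F T' B'" for T' B'
    using state_insert[OF that finF e(2), of a] no ab(1) by blast
  have full: "count (image_mset fst B) x = k" if x: "x \<in># vm K1" for x
  proof (rule ccontr)
    assume "count (image_mset fst B) x \<noteq> k"
    then have less: "count (image_mset fst B) x < k"
      using stateD(5)[OF st, of x] by simp
    then have "x \<noteq> root K1"
      using a_full[OF st] K1(2) by auto
    then obtain K2 s f where "root K2 = a" "em K1 = add_mset f (em K2 + em s)"
      "state F (add_mset K2 (add_mset s T)) (add_mset (x, f) B)"
      using state_cut[OF st x _ less] K1(2) by metis
    then show False
      using min[of K2 "add_mset s T"] root_in_vm[of K2] by fastforce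
  qed
  have closed: "N g \<subseteq> set_mset (vm K1)" if g: "(x, g) \<in># B" and x: "x \<in># vm K1" for x g
  proof (rule ccontr)
    assume out: "\<not> ?thesis"
    obtain y where y: "N g = {x, y}" "y \<in> V"
      using blue_edge[OF st _ g] F by blast
    then have "y \<notin># vm K1"
      using out x by auto
    then obtain K' T' where K': "add_mset K1 T = add_mset K' T'" "y \<in># vm K'" "K' \<noteq> K1"
      using state_tree_of[OF st y(2)] by metis
    then obtain T'' where T'': "T = add_mset K' T''"
      by (metis add_eq_conv_ex)
    obtain B' where B': "B = add_mset (x, g) B'"
      using g by (metis multi_member_split)
    have less: "count (image_mset fst B') x < k"
      using stateD(5)[OF st, of x] unfolding B' by simp
    show False
    proof (cases "x = a")
      case True
      obtain J where "state F (add_mset J T'') B'"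
        using state_join[OF st[unfolded T''] x K'(2) y(1) B'] by blast
      then show False
        using a_full less True by blast
    next
      case False
      have "wft K1"
        using K1(1) .
      have "x \<noteq> root K1"
        using False K1(2) by simp
      \<comment> \<open>The edge \<open>f\<close> above \<open>x\<close> and the blue edge
        \<open>g\<close> trade colours. Out-degrees are unchanged, and the part below
        \<open>f\<close> moves over to the tree of \<open>y\<close>, so the tree of \<open>a\<close>
        shrinks.\<close>
      from cut_above[OF K1(1) x this] obtain K2 s f c where c: "wft K2" "wft s" "root K2 = root K1" "root s = x"
        "c \<in># vm K2" "N f = {c, x}" "vm K1 = vm K2 + vm s" "em K1 = add_mset f (em K2 + em s)"
        by blast
      have "x \<in># vm s"
        using c(4) by auto
      from join_trees[OF c(2) _ this K'(2) y(1)] stateD(1)[OF st, of K'] T''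
      obtain J where J: "wft J" "vm J = vm s + vm K'" "em J = add_mset g (em s + em K')"
        by auto
      have "state F ({#K2, J#} + T'') ({#(x, f)#} + B')"
      proof (rule state_replace[of F "{#K1, K'#}" T'' "{#(x, g)#}" B'])
        show "count (image_mset fst ({#(x, f)#} + B')) v \<le> k" for v
          using stateD(5)[OF st, of v] unfolding B' by simp
      qed (use st T'' B' J c in \<open>auto simp: ac_simps\<close>)
      then show False
        using min[of K2 "add_mset J T''" "add_mset (x, f) B'"] c(3,8) K1(2) root_in_vm[of K2] by auto
    qed
  qed
  define S where "S = set_mset (\<Sum>s\<in>#{#K1#}. vm s)"
  have S: "S = set_mset (vm K1)"
    unfolding S_def by simp
  have "((\<Sum>s\<in>#{#K1#}. esz s) + k * card S + card {e}) * (d + k + 1) \<le> (k * (d + k + 1) + d) * card S"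
  proof (rule density_bound[OF _ _ S_def])
    show "state F ({#K1#} + T) B"
      using st by simp
    show "S \<noteq> {}"
      using aK S by auto
    show "N g \<subseteq> S" if "g \<in> {e}" for g
      using that ab aK bK S by simp
  qed (use S full closed e F in auto)
  moreover have "card S = Suc (esz K1)"
  proof -
    have "card (set_mset (vm K1)) = size (vm K1)"
      using card_set_mset_subset[OF state_vm_subset, of F "{#K1#}" T B] st by simp
    then show ?thesis
      unfolding S by (simp add: size_vm)
  qed
  ultimately have "(k + 1) * card S * (d + k + 1) \<le> (k * (d + k + 1) + d) * card S"
    by (simp add: algebra_simps)
  then have "((k + 1) * (d + k + 1)) * card S \<le> (k * (d + k + 1) + d) * card S"
    by (simp only: mult.assoc mult.commute[of "card S"])
  then have "(k + 1) * (d + k + 1) \<le> k * (d + k + 1) + d"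
    using \<open>card S = _\<close> by (simp only: mult_le_cancel2)
  then show False
    by simp
qed

lemma state_empty: "state {} (image_mset (\<lambda>v. Node v []) (mset_set V)) {#}"
  unfolding state_def by (simp add: image_mset.compositionality o_def)

lemma exists_state: "\<exists>T B. state E T B"
proof -
  define P where "P F \<longleftrightarrow> F \<subseteq> E \<and> (\<exists>T B. state F T B)" for F
  have "P {}"
    unfolding P_def by (intro conjI exI, rule empty_subsetI, rule state_empty)
  moreover have "finite {F. P F}"
  proof (rule finite_subset)
    show "{F. P F} \<subseteq> Pow E"
      unfolding P_def by blast
  qed (use finite_E in simp)
  ultimately have "\<exists>F\<in>{F. P F}. \<forall>F'\<in>{F. P F}. F \<subseteq> F' \<longrightarrow> F = F'"
    by (intro finite_has_maximal) blast+
  then obtain F where F: "P F" "\<And>F'. P F' \<Longrightarrow> F \<subseteq> F' \<Longrightarrow> F = F'"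
    by blast
  show ?thesis
  proof (cases "F = E")
    case False
    obtain T B where FE: "F \<subseteq> E" and "state F T B"
      using F(1) unfolding P_def by (elim conjE exE)
    with False obtain e T' B' where e: "e \<in> E - F" "state (insert e F) T' B'"
      using extend_state[of F T B] by (metis psubsetI)
    then have "P (insert e F)"
      using FE unfolding P_def by (intro conjI exI) auto
    then have "F = insert e F"
      by (rule F(2)) auto
    then show ?thesis
      using e(1) by auto
  next
    case True
    then show ?thesis
      using F(1) unfolding P_def by (elim conjE) simp
  qed
qed

end

section \<open>Minimal configurations\<close>

lemma subseteq_image_mset:
  "A \<subseteq># image_mset f M \<Longrightarrow> \<exists>M'. M' \<subseteq># M \<and> A = image_mset f M'"
proof (induction M arbitrary: A)
  case (add x M)
  have "A - {#f x#} \<subseteq># image_mset f M"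
    using add.prems by (simp add: subset_eq_diff_conv)
  then obtain M' where M': "M' \<subseteq># M" "A - {#f x#} = image_mset f M'"
    using add.IH by blast
  show ?case
  proof (cases "f x \<in># A")
    case True
    then have "A = image_mset f (add_mset x M')"
      using M'(2) by (metis image_mset_add_mset insert_DiffM)
    then show ?thesis
      using M'(1) by (metis mset_subset_eq_add_mset_cancel)
  next
    case False
    then show ?thesis
      using M' by (metis diff_single_trivial mset_subset_eq_add_left add_mset_add_single subset_mset.order_trans)
  qed
qed simp

lemma subseteq_image_mset_set:
  assumes "A \<subseteq># image_mset f (mset_set C)" and "finite C"
  shows "\<exists>C'\<subseteq>C. A = image_mset f (mset_set C')"
proof -
  obtain M where M: "M \<subseteq># mset_set C" "A = image_mset f M"
    using subseteq_image_mset[OF assms(1)] by blast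
  have "M = mset_set (set_mset M)"
  proof (rule multiset_eqI)
    fix x
    show "count M x = count (mset_set (set_mset M)) x"
    proof (cases "x \<in># M")
      case True
      then have "count M x = 1"
        using count_le_one_subset[OF M(1)] count_greater_eq_one_iff[of M x] by (simp only: le_antisym)
      then show ?thesis
        using True by simp
    next
      case False
      then show ?thesis
        by (simp add: not_in_iff)
    qed
  qed
  moreover have "set_mset M \<subseteq> C"
    using set_mset_mono[OF M(1)] assms(2) by simp
  ultimately show ?thesis
    using M(2) by metis
qed

lemma mset_nth_split: "i < length xs \<Longrightarrow> mset xs = mset (take i xs) + add_mset (xs ! i) (mset (drop (Suc i) xs))"
  by (metis id_take_nth_drop mset.simps(2) mset_append)

lemma mset_two_nth:
  assumes "i < j" "j < length xs"
  shows "\<exists>M. mset xs = add_mset (xs ! i) (add_mset (xs ! j) M)"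
proof -
  have "xs ! j \<in> set (drop (Suc i) xs)"
    using assms by (auto simp: in_set_conv_nth intro!: exI[of _ "j - Suc i"])
  then show ?thesis
    using mset_nth_split[of i xs] assms by (metis Suc_lessD less_trans_Suc multi_member_split set_mset_mset union_mset_add_mset_right)
qed

context sparse_graph
begin

text \<open>Stated for a bare edge set with the radius and the layering existentially quantified, so
  that it passes to subsets and hence to all pieces of a cut tree.\<close>

definition good :: "'e set \<Rightarrow> bool" where
  "good A \<longleftrightarrow> (\<exists>r lev low. layering lev low r A \<and> card A + (r - 1) * (k - 1) \<le> d)"

text \<open>Counting edges rather than bad trees makes it progress to cut an edge of a bad tree even
  if the pieces are still bad.\<close>

definition badness :: "('v, 'e) rtree \<Rightarrow> nat" where
  "badness s = (if good (set_mset (em s)) then 0 else esz s)"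

definition total_badness :: "('v, 'e) rtree multiset \<Rightarrow> nat" where
  "total_badness T = (\<Sum>s\<in>#T. badness s)"

lemma total_badness_simps [simp]:
  "total_badness {#} = 0" "total_badness (add_mset s T) = badness s + total_badness T"
  "total_badness (S + T) = total_badness S + total_badness T"
  by (simp_all add: total_badness_def)

lemma good_mono: "good A \<Longrightarrow> B \<subseteq> A \<Longrightarrow> finite A \<Longrightarrow> good B"
  unfolding good_def by (meson add_le_mono1 card_mono layering_mono le_trans)

lemma good_empty: "good {}"
  unfolding good_def layering_def by (rule exI[of _ 0]) simp

lemma badness_le: "badness s \<le> esz s"
  by (simp add: badness_def)

lemma badness_cong: "em s = em t \<Longrightarrow> badness s = badness t"
  by (simp add: badness_def)

lemma total_badness_le: "total_badness T \<le> size (\<Sum>s\<in>#T. em s)"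
  by (induction T) (auto intro: add_mono badness_le)

text \<open>Pieces of a good tree are good and contribute 0; pieces of a bad tree have at most as
  many edges together as the tree.\<close>

lemma total_badness_pieces:
  assumes "(\<Sum>s\<in>#T. em s) \<subseteq># em K"
  shows "total_badness T \<le> badness K"
proof (cases "good (set_mset (em K))")
  case True
  have "badness s = 0" if "s \<in># T" for s
  proof -
    have "em s \<subseteq># (\<Sum>s\<in>#T. em s)"
      using that by (metis image_mset_add_mset insert_DiffM mset_subset_eq_add_left sum_mset.insert)
    then have "set_mset (em s) \<subseteq> set_mset (em K)"
      using assms set_mset_mono subset_mset.order_trans by blast
    then show ?thesis
      using good_mono[OF True] by (simp add: badness_def)
  qed
  then have "image_mset badness T = image_mset (\<lambda>_. 0) T"
    by (intro image_mset_cong)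
  then show ?thesis
    by (simp add: total_badness_def)
next
  case False
  then show ?thesis
    using total_badness_le[of T] size_mset_mono[OF assms] by (simp add: badness_def)
qed

lemma admissible_good:
  assumes "wft s" "\<And>v. count (vm s) v \<le> 1" "esz s + (depth s - 1) * (k - 1) \<le> d"
  shows "good (set_mset (em s))"
  using tree_layering[OF assms(1,2)] assms(3) card_set_mset_le_size[of "em s"] unfolding good_def
  by (meson add_le_mono1 le_trans)

lemma small_admissible:
  assumes "(k + 1) * esz s < d"
  shows "esz s + (depth s - 1) * (k - 1) \<le> d"
proof -
  have "(depth s - 1) * (k - 1) \<le> esz s * k"
    using depth_le_esz[of s] by (intro mult_le_mono) auto
  then show ?thesis
    using assms by (simp add: algebra_simps)
qed

text \<open>
  The list is an order of exploration: the root of each tree but the first is entered by a blue edge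
  from an earlier tree.
\<close>

definition legal :: "('v \<times> 'e) multiset \<Rightarrow> ('v, 'e) rtree list \<Rightarrow> bool" where
  "legal B L \<longleftrightarrow> (\<forall>i<length L. 0 < i \<longrightarrow>
     (\<exists>j<i. \<exists>v p. v \<in># vm (L ! j) \<and> (v, p) \<in># B \<and> N p = {v, root (L ! i)}))"

text \<open>The list may stop before all reachable trees are listed; the others are in
  \<open>R\<close>. Hence a list cut off right after a modified tree is again eligible.\<close>

definition config ::
    "('v, 'e) rtree list \<Rightarrow> ('v, 'e) rtree multiset \<Rightarrow> ('v \<times> 'e) multiset \<Rightarrow> bool" where
  "config L R B \<longleftrightarrow> L \<noteq> [] \<and> state E (mset L + R) B \<and> legal B L \<and> \<not> good (set_mset (em (L ! 0)))"

lemma state_esz_le: "state F T B \<Longrightarrow> F \<subseteq> E \<Longrightarrow> s \<in># T \<Longrightarrow> esz s \<le> card E"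
proof -
  assume st: "state F T B" and F: "F \<subseteq> E" and s: "s \<in># T"
  obtain T' where "T = add_mset s T'"
    using s by (metis multi_member_split)
  then have "em s \<subseteq># mset_set F"
    unfolding stateD(3)[OF st, symmetric] by simp
  then have "esz s \<le> card F"
    using size_mset_mono by fastforce
  then show ?thesis
    using card_mono[OF finite_E F] by simp
qed

lemma state_size_le: "state F T B \<Longrightarrow> size T \<le> card V"
proof -
  assume st: "state F T B"
  have "size T \<le> size (\<Sum>s\<in>#T. vm s)" for T :: "('v, 'e) rtree multiset"
    by (induction T) (auto simp: size_vm)
  then show ?thesis
    using stateD(2)[OF st] by (metis size_mset_set)
qed

text \<open>Total badness is compared first, then the padded list of sizes. A lexicographic
  comparison is decided at the first difference, so a competitor may stop right after its new tree
  \<open>P\<close>, and nothing has to be known about the trees thrown back into \<open>R'\<close>.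
  The case \<open>i = length L\<close> is an extension of the list.\<close>

lemma minimal_config_exists:
  assumes no: "\<And>T B. state E T B \<Longrightarrow> total_badness T \<noteq> 0"
  shows "\<exists>L R B. config L R B \<and>
    (\<forall>T' B'. state E T' B' \<longrightarrow> total_badness (mset L + R) \<le> total_badness T') \<and>
    (\<forall>i P R' B'. config (take i L @ [P]) R' B' \<longrightarrow>
       total_badness (mset (take i L @ [P]) + R') \<le> total_badness (mset L + R) \<longrightarrow>
       i \<le> length L \<longrightarrow> \<not> (i = length L \<or> esz P < esz (L ! i)))"
proof -
  \<comment> \<open>padding with a value larger than every tree makes a list smaller when it is extended\<close>
  define pad where "pad L = map esz L @ replicate (card V - length L) (card E + 1)" for L :: "('v, 'e) rtree list"
  define f where "f = (\<lambda>(L, R, B :: ('v \<times> 'e) multiset). (total_badness (mset L + R), pad L))"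
  define r where "r = inv_image (less_than <*lex*> lexn less_than (card V)) f"
  define C where "C = {(L, R, B). config L R B}"
  have wf: "wf r"
    unfolding r_def by (intro wf_inv_image wf_lex_prod wf_less_than wf_lexn)
  have single: "\<exists>L R. (L, R, B) \<in> C \<and> mset L + R = T" if st: "state E T B" for T B
  proof -
    have "\<not> (\<forall>s\<in>#T. badness s = 0)"
      using no[OF st] unfolding total_badness_def by auto
    then obtain s where s: "s \<in># T" "\<not> good (set_mset (em s))"
      unfolding badness_def by meson
    then have "config [s] (T - {#s#}) B"
      using st unfolding config_def legal_def by simp
    then show ?thesis
      using s(1) unfolding C_def by (intro exI[of _ "[s]"] exI[of _ "T - {#s#}"]) simp
  qed
  obtain T0 B0 where "state E T0 B0"
    using exists_state by blast
  then obtain c0 where "c0 \<in> C"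
    using single by blast
  from wfE_min[OF wf this] obtain c where c: "c \<in> C" "\<And>y. (y, c) \<in> r \<Longrightarrow> y \<notin> C"
    by blast
  obtain L R B where LRB: "c = (L, R, B)"
    by (cases c)
  have conf: "config L R B"
    using c(1) unfolding C_def LRB by simp
  then have st: "state E (mset L + R) B"
    unfolding config_def by simp
  have len: "length L' \<le> card V" if "config L' R' B'" for L' R' B'
  proof -
    have "size (mset L' + R') \<le> card V"
      using that state_size_le unfolding config_def by blast
    then show ?thesis
      by simp
  qed
  have "total_badness (mset L + R) \<le> total_badness T'" if st': "state E T' B'" for T' B'
  proof (rule ccontr)
    assume less: "\<not> ?thesis"
    obtain L' R' where L': "(L', R', B') \<in> C" "mset L' + R' = T'"
      using single[OF st'] by blast
    then have "((L', R', B'), c) \<in> r"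
      using less unfolding r_def f_def LRB L'(2)[symmetric] by auto
    then show False
      using c(2) L'(1) by blast
  qed
  moreover have False if conf': "config (take i L @ [P]) R' B'"
    and le: "total_badness (mset (take i L @ [P]) + R') \<le> total_badness (mset L + R)"
    and i: "i \<le> length L" and less: "i = length L \<or> esz P < esz (L ! i)" for i P R' B'
  proof -
    define x where "x = (if i = length L then card E + 1 else esz (L ! i))"
    have "esz P \<le> card E"
      using conf' state_esz_le[of E "mset (take i L @ [P]) + R'" B' P] unfolding config_def by simp
    then have Px: "esz P < x"
      using less unfolding x_def by auto
    have lenP: "Suc i \<le> card V"
      using len[OF conf'] i by simp
    have "\<exists>ys. pad L = map esz (take i L) @ x # ys"
    proof (cases "i = length L")
      case True
      then show ?thesis
        using lenP unfolding pad_def x_def by (cases "card V - length L") auto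
    next
      case False
      then have "L = take i L @ L ! i # drop (Suc i) L"
        using i by (simp add: id_take_nth_drop)
      then have "map esz L = map esz (take i L) @ esz (L ! i) # map esz (drop (Suc i) L)"
        by (metis list.simps(9) map_append)
      then show ?thesis
        using False unfolding pad_def x_def by simp
    qed
    then obtain ys where ys: "pad L = map esz (take i L) @ x # ys"
      by blast
    define ys' where "ys' = replicate (card V - Suc i) (card E + 1)"
    have pad': "pad (take i L @ [P]) = map esz (take i L) @ esz P # ys'"
      using i unfolding pad_def ys'_def by (simp add: min_def)
    have "length (pad L) = card V"
      using len[OF conf] unfolding pad_def by simp
    moreover have "length (pad (take i L @ [P])) = card V"
      using lenP i unfolding pad_def by (simp add: min_def)
    ultimately have "(pad (take i L @ [P]), pad L) \<in> lexn less_than (card V)"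
      unfolding lexn_conv using ys pad' Px by fastforce
    then have "((take i L @ [P], R', B'), c) \<in> r"
      using le unfolding r_def f_def LRB by auto
    then show False
      using c(2) conf' unfolding C_def by blast
  qed
  ultimately show ?thesis
    using conf by blast
qed

end

locale minimal_config = sparse_graph N V E k d
  for N :: "'e \<Rightarrow> 'v set" and V E k d +
  fixes L :: "('v, 'e) rtree list" and R :: "('v, 'e) rtree multiset" and B :: "('v \<times> 'e) multiset"
  assumes config: "config L R B"
    and minimal_badness: "state E T' B' \<Longrightarrow> total_badness (mset L + R) \<le> total_badness T'"
    and minimal_list: "\<lbrakk>config (take i L @ [P]) R' B';
      total_badness (mset (take i L @ [P]) + R') \<le> total_badness (mset L + R);
      i \<le> length L; i = length L \<or> esz P < esz (L ! i)\<rbrakk> \<Longrightarrow> False"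
begin

lemma state_LR: "state E (mset L + R) B"
  and legal_L: "legal B L"
  and bad_root: "\<not> good (set_mset (em (L ! 0)))"
  and L_nonempty: "0 < length L"
  using config unfolding config_def by auto

lemma list_vm_disjoint:
  assumes "state E (mset L' + X) B'" and "i < length L'" "j < length L'" "i \<noteq> j"
    and "x \<in># vm (L' ! i)" "x \<in># vm (L' ! j)"
  shows False
proof -
  have False if "i < j" "j < length L'" "x \<in># vm (L' ! i)" "x \<in># vm (L' ! j)" for i j
  proof -
    obtain M where "mset L' = add_mset (L' ! i) (add_mset (L' ! j) M)"
      using mset_two_nth[OF \<open>i < j\<close> \<open>j < length L'\<close>] by blast
    then have "state E (add_mset (L' ! i) (add_mset (L' ! j) (M + X))) B'"
      using assms(1) by simp
    then show False
      using state_vm_disjoint \<open>x \<in># vm (L' ! i)\<close> \<open>x \<in># vm (L' ! j)\<close> by blast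
  qed
  then show False
    using assms(2-) by (metis linorder_neqE_nat)
qed

lemma legal_take:
  assumes "legal B' L'"
  shows "legal B' (take j L')"
  unfolding legal_def
proof (intro allI impI)
  fix i assume i: "i < length (take j L')" "0 < i"
  then obtain h v p where "h < i" "v \<in># vm (L' ! h)" "(v, p) \<in># B'" "N p = {v, root (L' ! i)}"
    using assms unfolding legal_def by (metis length_take min_less_iff_conj)
  then show "\<exists>h<i. \<exists>v p. v \<in># vm (take j L' ! h) \<and> (v, p) \<in># B' \<and> N p = {v, root (take j L' ! i)}"
    using i(1) by (intro exI[of _ h] conjI exI[of _ v] exI[of _ p]) simp_all
qed

text \<open>No tree of the prefix is entered from its last tree, so only the root of that tree
  matters and the tree itself may be exchanged.\<close>

lemma legal_snoc:
  assumes "legal B' (take (Suc j) L')" and "j < length L'" and "root P = root (L' ! j)"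
    and "\<And>p. p \<in># B' \<Longrightarrow> p \<in># B''"
  shows "legal B'' (take j L' @ [P])"
  unfolding legal_def
proof (intro allI impI)
  fix i assume i: "i < length (take j L' @ [P])" "0 < i"
  then have ij: "i \<le> j"
    using assms(2) by simp
  then obtain j' v p where *: "j' < i" "v \<in># vm (take (Suc j) L' ! j')" "(v, p) \<in># B'"
    "N p = {v, root (take (Suc j) L' ! i)}"
    using assms(1,2) i(2) unfolding legal_def by (metis le_imp_less_Suc length_take min.absorb2 Suc_leI)
  have "(take j L' @ [P]) ! j' = take (Suc j) L' ! j'"
    using * ij assms(2) by (simp add: nth_append)
  moreover have "root ((take j L' @ [P]) ! i) = root (take (Suc j) L' ! i)"
    using ij assms(2,3) by (cases "i = j") (simp_all add: nth_append)
  ultimately show "\<exists>j'<i. \<exists>v p. v \<in># vm ((take j L' @ [P]) ! j') \<and> (v, p) \<in># B'' \<and>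
      N p = {v, root ((take j L' @ [P]) ! i)}"
    using * assms(4) by metis
qed

text \<open>The state is only required to agree with \<open>L\<close> on the first
  \<open>j + 1\<close> trees and not to be worse, because reversing the blue edge into a root leaves
  the minimal configuration. The reversal moves the spare out-edge to a strictly earlier tree, which
  drives the induction; at tree 0 a cut lowers the badness.\<close>

lemma no_spare:
  assumes "j < length L" and "state E (mset (take (Suc j) L) + X) B'" and "legal B' (take (Suc j) L)"
    and "total_badness (mset (take (Suc j) L) + X) \<le> total_badness (mset L + R)"
    and "u \<in># vm (L ! j)" and "count (image_mset fst B') u < k"
  shows False
  using assms
proof (induction j arbitrary: X B' u rule: less_induct)
  case (less j)
  have take: "take (Suc j) L = take j L @ [L ! j]"
    using less.prems(1) by (rule take_Suc_conv_app_nth)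
  have st: "state E (add_mset (L ! j) (mset (take j L) + X)) B'"
    using less.prems(2) unfolding take by simp
  show False
  proof (cases "j = 0")
    case True
    define K where "K = L ! 0"
    have stK: "state E (add_mset K X) B'"
      using st True by (simp add: K_def)
    have "\<not> good (set_mset (em K))"
      using bad_root by (simp add: K_def)
    then have badK: "badness K = esz K" "em K \<noteq> {#}"
      using good_empty by (auto simp: badness_def)
    have "u \<in># vm K"
      using less.prems(5) True by (simp add: K_def)
    \<comment> \<open>The first tree need not be entered by a blue edge, so its root may be chosen
      freely; with a root other than \<open>u\<close> there is an edge above \<open>u\<close> to
      cut. A second vertex exists because an edgeless tree is good.\<close>
    then obtain M where M: "vm K = add_mset u M"
      by (metis multi_member_split)
    then have "size M = esz K"
      using size_vm[of K] by simp
    then obtain r where rM: "r \<in># M"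
      using badK(2) by (metis multiset_nonemptyE size_empty size_eq_0_iff_empty)
    have "count (vm K) r \<le> 1"
      using state_count_vm[OF stK, of K r] by simp
    moreover have "1 \<le> count M r"
      using rM by (simp only: count_greater_eq_one_iff)
    ultimately have "r \<noteq> u"
      unfolding M by (intro notI) simp
    then have r: "r \<in># vm K" "r \<noteq> u"
      using M rM by simp_all
    obtain K' where K': "wft K'" "root K' = r" "vm K' = vm K" "em K' = em K"
      using reroot[OF stateD(1)[OF stK] r(1)] by auto
    have stK': "state E (add_mset K' X) B'"
      using state_reroot[OF stK K'(1,3,4)] .
    have uK: "u \<in># vm K'" "u \<noteq> root K'"
      using less.prems(5) True K' r by (auto simp: K_def)
    from state_cut[OF stK' uK less.prems(6)] obtain K0 s f where c:
      "em K' = add_mset f (em K0 + em s)" "state E (add_mset K0 (add_mset s X)) (add_mset (u, f) B')"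
      by blast
    have "badness K0 + badness s < badness K"
      using badness_le[of K0] badness_le[of s] c(1) K'(4) badK(1) by simp
    then have "total_badness (add_mset K0 (add_mset s X)) < total_badness (mset L + R)"
      using less.prems(4) True unfolding take by (simp add: K_def)
    then show False
      using minimal_badness[OF c(2)] by simp
  next
    case False
    show False
    proof (cases "u = root (L ! j)")
      case False
      from state_cut[OF st less.prems(5) False less.prems(6)] obtain K0 s f where c: "root K0 = root (L ! j)"
        "em (L ! j) = add_mset f (em K0 + em s)"
        "state E (add_mset K0 (add_mset s (mset (take j L) + X))) (add_mset (u, f) B')"
        by blast
      have "config (take j L @ [K0]) (add_mset s X) (add_mset (u, f) B')"
        unfolding config_def
      proof (intro conjI)
        show "state E (mset (take j L @ [K0]) + add_mset s X) (add_mset (u, f) B')"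
          using c(3) by (simp add: add_mset_commute)
        show "legal (add_mset (u, f) B') (take j L @ [K0])"
          by (rule legal_snoc[OF less.prems(3,1) c(1)]) simp
        show "\<not> good (set_mset (em ((take j L @ [K0]) ! 0)))"
          using bad_root \<open>j \<noteq> 0\<close> less.prems(1) by (simp add: nth_append)
      qed simp
      moreover have "badness K0 + badness s \<le> badness (L ! j)"
        using total_badness_pieces[of "{#K0, s#}" "L ! j"] c(2) by (simp add: subset_mset.le_add_same_cancel2)
      then have "total_badness (mset (take j L @ [K0]) + add_mset s X) \<le> total_badness (mset L + R)"
        using less.prems(4) unfolding take by simp
      moreover have "esz K0 < esz (L ! j)"
        using c(2) by simp
      ultimately show False
        using minimal_list[of j K0 "add_mset s X" "add_mset (u, f) B'"] less.prems(1) by linarith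
    next
      case True
      obtain j' v p where p: "j' < j" "v \<in># vm (L ! j')" "(v, p) \<in># B'" "N p = {v, u}"
      proof -
        have "\<exists>j'<j. \<exists>v p. v \<in># vm (take (Suc j) L ! j') \<and> (v, p) \<in># B' \<and> N p = {v, root (take (Suc j) L ! j)}"
          using less.prems(1,3) \<open>j \<noteq> 0\<close> unfolding legal_def by simp
        then show ?thesis
          using that True less.prems(1) by auto
      qed
      obtain B1 where B1: "B' = add_mset (v, p) B1"
        using p(3) by (metis multi_member_split)
      have vu: "v \<noteq> u"
        using list_vm_disjoint[OF less.prems(2), of j' j v] p less.prems(1,5) by (auto simp: nth_append)
      have cnt: "count (image_mset fst (add_mset (u, p) B1)) w \<le> k" for w
        using less.prems(6) stateD(5)[OF less.prems(2), of w] unfolding B1 by (auto split: if_splits)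
      have st1: "state E (mset (take (Suc j) L) + X) (add_mset (u, p) B1)"
        using state_replace[of E "{#}" "mset (take (Suc j) L) + X" "{#(v, p)#}" B1 "{#}" "{#(u, p)#}"]
          less.prems(2) cnt p(4) B1 by simp
      define X' where "X' = mset (drop (Suc j') (take (Suc j) L)) + X"
      have "take (Suc j) L = take (Suc j') L @ drop (Suc j') (take (Suc j) L)"
        using p(1) by (metis append_take_drop_id min.absorb1 take_take Suc_le_mono less_imp_le_nat)
      then have split: "mset (take (Suc j) L) + X = mset (take (Suc j') L) + X'"
        unfolding X'_def by (metis mset_append union_assoc)
      have "legal (add_mset (u, p) B1) (take (Suc j') L)"
        unfolding legal_def
      proof (intro allI impI)
        fix i assume i: "i < length (take (Suc j') L)" "0 < i"
        then have ij: "i \<le> j'" "i < length L"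
          by simp_all
        then have "\<exists>h<i. \<exists>w q. w \<in># vm (take (Suc j) L ! h) \<and> (w, q) \<in># B' \<and> N q = {w, root (take (Suc j) L ! i)}"
          using less.prems(3) i(2) p(1) unfolding legal_def by simp
        then obtain h w q where h: "h < i" "w \<in># vm (take (Suc j) L ! h)" "(w, q) \<in># B'"
          "N q = {w, root (take (Suc j) L ! i)}"
          by blast
        have nth: "take (Suc j) L ! h = L ! h" "take (Suc j) L ! i = L ! i" "take (Suc j') L ! h = L ! h"
          "take (Suc j') L ! i = L ! i"
          using h(1) ij p(1) by simp_all
        \<comment> \<open>The reversed edge \<open>p\<close> led into the root of tree
          \<open>j\<close>, so none of the trees up to \<open>j'\<close> was entered by it.\<close>
        have "(w, q) \<noteq> (v, p)"
        proof
          assume "(w, q) = (v, p)"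
          then have "root (L ! i) = root (L ! j)"
            using h(4) p(4) True unfolding nth by (metis Pair_inject doubleton_eq_iff)
          then show False
            using list_vm_disjoint[OF state_LR, of i j "root (L ! i)"] ij p(1) less.prems(1) root_in_vm[of "L ! i"]
              root_in_vm[of "L ! j"] by auto
        qed
        then have "(w, q) \<in># add_mset (u, p) B1"
          using h(3) unfolding B1 by auto
        then show "\<exists>h<i. \<exists>w q. w \<in># vm (take (Suc j') L ! h) \<and> (w, q) \<in># add_mset (u, p) B1 \<and>
            N q = {w, root (take (Suc j') L ! i)}"
          using h by (intro exI[of _ h] conjI exI[of _ w] exI[of _ q]) (simp_all only: nth)
      qed
      moreover have "count (image_mset fst (add_mset (u, p) B1)) v < k"
        using stateD(5)[OF less.prems(2), of v] vu unfolding B1 by simp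
      ultimately show False
        using less.IH[OF p(1) _ _ _ _ p(2), of X' "add_mset (u, p) B1"] st1 less.prems(1,4) p(1) unfolding split by simp
    qed
  qed
qed

lemma full:
  assumes "i < length L" and "u \<in># vm (L ! i)"
  shows "count (image_mset fst B) u = k"
proof (rule ccontr)
  assume "\<not> ?thesis"
  then have "count (image_mset fst B) u < k"
    using stateD(5)[OF state_LR, of u] by simp
  moreover have "legal B (take (Suc i) L)"
    using legal_L by (rule legal_take)
  moreover have LR: "mset L + R = mset (take (Suc i) L) + (mset (drop (Suc i) L) + R)"
    by (metis append_take_drop_id mset_append union_assoc)
  ultimately show False
    using no_spare[OF assms(1) _ _ _ assms(2), of "mset (drop (Suc i) L) + R" B] state_LR
    unfolding LR by blast
qed

end

context small_children
begin

lemma children_eq: "children s = (\<Sum>v\<in>#vm s. own v (Ch v))"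
proof (induction s)
  case (Node x bs)
  have "(\<Sum>(e, b)\<leftarrow>bs. children b) = (\<Sum>v\<in>#(\<Sum>(e, b)\<leftarrow>bs. vm b). own v (Ch v))"
    using Node
  proof (induction bs)
    case (Cons eb bs)
    obtain e b where eb: "eb = (e, b)"
      by fastforce
    have "children b = (\<Sum>v\<in>#vm b. own v (Ch v))"
      using Cons.prems[of eb b] eb by simp
    moreover have "(\<Sum>(e, b)\<leftarrow>bs. children b) = (\<Sum>v\<in>#(\<Sum>(e, b)\<leftarrow>bs. vm b). own v (Ch v))"
      by (rule Cons.IH[OF Cons.prems]) simp_all
    ultimately show ?case
      using eb by simp
  qed simp
  then show ?case
    by simp
qed

end

lemma sum_small_less:
  assumes "X \<noteq> {#}" and "\<And>x c b. (x, c, b) \<in># X \<Longrightarrow> m * esz b < d'"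
  shows "m * (\<Sum>(x, c, b)\<in>#X. esz b) < d' * size X"
  using assms
proof (induction X)
  case (add y X)
  obtain x c b where y: "y = (x, c, b)"
    by (cases y)
  have b: "m * esz b < d'"
    using add.prems(2) y by auto
  show ?case
  proof (cases "X = {#}")
    case False
    then have "m * (\<Sum>(x, c, b)\<in>#X. esz b) < d' * size X"
      using add by auto
    then show ?thesis
      using b y by (simp add: algebra_simps)
  qed (use b y in simp)
qed simp

lemma sum_filter_eq:
  assumes "\<And>v. count X v \<le> 1"
  shows "(\<Sum>v\<in>#X. filter_mset (\<lambda>c. t c = v) M) = filter_mset (\<lambda>c. t c \<in># X) M"
proof (rule multiset_eqI)
  fix c
  have "count (\<Sum>v\<in>#X. filter_mset (\<lambda>c. t c = v) M) c = count X (t c) * count M c"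
    by (induction X) auto
  also have "\<dots> = count (filter_mset (\<lambda>c. t c \<in># X) M) c"
  proof (cases "t c \<in># X")
    case True
    then have "count X (t c) = 1"
      using assms[of "t c"] count_greater_eq_one_iff[of X "t c"] by (simp only: le_antisym)
    then show ?thesis
      using True by simp
  next
    case False
    moreover have "count X (t c) = 0"
      using False by (simp only: not_in_iff)
    ultimately show ?thesis
      by simp
  qed
  finally show "count (\<Sum>v\<in>#X. filter_mset (\<lambda>c. t c = v) M) c = count (filter_mset (\<lambda>c. t c \<in># X) M) c" .
qed

lemma mset_drop_nth: "mset (drop j xs) = image_mset ((!) xs) (mset_set {j..<length xs})"
proof -
  have "drop j xs = map ((!) xs) [j..<length xs]"
    by (metis add_0 drop_map drop_upt map_nth)
  then show ?thesis
    by simp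
qed

context minimal_config
begin

section \<open>Small children in a minimal configuration\<close>

text \<open>A tree may be entered by several blue edges. Fixing one of them gives each tree but the
  first a single parent, so that its size is charged only once.\<close>

definition link :: "nat \<Rightarrow> nat \<times> 'v \<times> 'e" where
  "link i = (SOME (j, v, p). j < i \<and> v \<in># vm (L ! j) \<and> (v, p) \<in># B \<and> N p = {v, root (L ! i)})"

definition par :: "nat \<Rightarrow> nat" where "par i = fst (link i)"
definition tail :: "nat \<Rightarrow> 'v" where "tail i = fst (snd (link i))"
definition pedge :: "nat \<Rightarrow> 'e" where "pedge i = snd (snd (link i))"

lemma link:
  assumes "0 < i" "i < length L"
  shows "par i < i" "tail i \<in># vm (L ! par i)" "(tail i, pedge i) \<in># B" "N (pedge i) = {tail i, root (L ! i)}"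
proof -
  let ?P = "\<lambda>(j, v, p). j < i \<and> v \<in># vm (L ! j) \<and> (v, p) \<in># B \<and> N p = {v, root (L ! i)}"
  obtain j v p where "j < i" "v \<in># vm (L ! j)" "(v, p) \<in># B" "N p = {v, root (L ! i)}"
    using legal_L assms unfolding legal_def by blast
  then have "\<exists>x. ?P x"
    by (intro exI[of _ "(j, v, p)"]) simp
  then have "?P (link i)"
    unfolding link_def by (rule someI_ex)
  then show "par i < i" "tail i \<in># vm (L ! par i)" "(tail i, pedge i) \<in># B" "N (pedge i) = {tail i, root (L ! i)}"
    unfolding par_def tail_def pedge_def by (auto simp: split_def)
qed

lemma vm_disjoint: "i < length L \<Longrightarrow> j < length L \<Longrightarrow> x \<in># vm (L ! i) \<Longrightarrow> x \<in># vm (L ! j) \<Longrightarrow> i = j"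
  using list_vm_disjoint[OF state_LR] by blast

lemma par_eq: "0 < c \<Longrightarrow> c < length L \<Longrightarrow> i < length L \<Longrightarrow> tail c \<in># vm (L ! i) \<longleftrightarrow> par c = i"
  using link(1,2)[of c] vm_disjoint[of "par c" i "tail c"] by auto

text \<open>An edge and its tail determine the other end, which is the root of the entered tree, and
  different trees are disjoint.\<close>

lemma inj_pairs: "inj_on (\<lambda>c. (tail c, pedge c)) {1..<length L}"
proof (rule inj_onI)
  fix i j assume ij: "i \<in> {1..<length L}" "j \<in> {1..<length L}" "(tail i, pedge i) = (tail j, pedge j)"
  then have "{tail i, root (L ! i)} = {tail i, root (L ! j)}"
    using link(4)[of i] link(4)[of j] by auto
  then have "root (L ! i) = root (L ! j)"
    by (metis doubleton_eq_iff)
  then have "root (L ! i) \<in># vm (L ! j)"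
    using root_in_vm[of "L ! j"] by simp
  then show "i = j"
    using ij(1,2) by (intro vm_disjoint[of i j "root (L ! i)"]) simp_all
qed

abbreviation pairs :: "nat set \<Rightarrow> ('v \<times> 'e) multiset" where
  "pairs C \<equiv> image_mset (\<lambda>c. (tail c, pedge c)) (mset_set C)"

lemma pairs_subset: "C \<subseteq> {1..<length L} \<Longrightarrow> pairs C \<subseteq># B"
proof -
  assume C: "C \<subseteq> {1..<length L}"
  then have "inj_on (\<lambda>c. (tail c, pedge c)) C"
    using inj_pairs inj_on_subset by blast
  then have "pairs C = mset_set ((\<lambda>c. (tail c, pedge c)) ` C)"
    by (rule image_mset_mset_set)
  also have "\<dots> \<subseteq># mset_set (set_mset B)"
  proof (subst msubset_mset_set_iff)
    show "finite ((\<lambda>c. (tail c, pedge c)) ` C)"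
      using finite_subset[OF C] by simp
    show "(\<lambda>c. (tail c, pedge c)) ` C \<subseteq> set_mset B"
    proof (rule image_subsetI)
      fix c assume "c \<in> C"
      then have "0 < c" "c < length L"
        using C by auto
      then show "(tail c, pedge c) \<in># B"
        by (rule link(3))
    qed
  qed simp_all
  also have "\<dots> \<subseteq># B"
    by (rule mset_set_set_mset_msubset)
  finally show ?thesis .
qed

lemma pair_remains:
  assumes "C \<subseteq> {1..<length L}" "j \<in> {1..<length L}" "j \<notin> C"
  shows "(tail j, pedge j) \<in># B - pairs C"
proof -
  have "finite C"
    using assms(1) finite_subset by blast
  then have "add_mset (tail j, pedge j) (pairs C) \<subseteq># B"
    using pairs_subset[of "insert j C"] assms by simp
  then have "{#(tail j, pedge j)#} \<subseteq># B - pairs C"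
    by (metis add_mset_add_single subset_eq_diff_conv subset_mset.add_diff_inverse mset_subset_eq_add_left
        union_commute subset_mset.le_diff_conv2 pairs_subset assms(1))
  then show ?thesis
    by simp
qed

abbreviation small :: "nat \<Rightarrow> bool" where
  "small c \<equiv> (k + 1) * esz (L ! c) < d"

definition Chf :: "'v \<Rightarrow> ('e \<times> ('v, 'e) rtree) list" where
  "Chf x = map (\<lambda>c. (pedge c, L ! c)) (filter (\<lambda>c. tail c = x \<and> small c) [1..<length L])"

lemma wft_L: "i < length L \<Longrightarrow> wft (L ! i)"
  using stateD(1)[OF state_LR, of "L ! i"] by simp

sublocale sc: small_children N Chf k d
proof
  fix c b x
  assume "(c, b) \<in> set (Chf x)"
  then show "N c = {x, root b} \<and> wft b \<and> (k + 1) * esz b < d"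
    using link(4) wft_L unfolding Chf_def by auto
next
  fix x
  let ?C = "{c \<in> {1..<length L}. tail c = x \<and> small c}"
  have "length (Chf x) = card ?C"
  proof -
    have "?C = set (filter (\<lambda>c. tail c = x \<and> small c) [1..<length L])"
      by auto
    then show ?thesis
      unfolding Chf_def by (simp only: length_map distinct_card[OF distinct_filter[OF distinct_upt]])
  qed
  \<comment> \<open>Different children of \<open>x\<close> are entered by different blue edges out
    of \<open>x\<close>, so the bound on out-degrees limits their number.\<close>
  also have "\<dots> = count (image_mset fst (pairs ?C)) x"
  proof -
    have "image_mset fst (pairs ?C) = image_mset (\<lambda>_. x) (mset_set ?C)"
      unfolding image_mset.compositionality by (intro image_mset_cong) auto
    then show ?thesis
      by (simp add: image_mset_const_eq)
  qed
  also have "\<dots> \<le> count (image_mset fst B) x"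
    by (intro mset_subset_eq_count image_mset_subseteq_mono pairs_subset) auto
  also have "\<dots> \<le> k"
    using stateD(5)[OF state_LR] .
  finally show "length (Chf x) \<le> k" .
qed (rule k_pos)

abbreviation child :: "nat \<Rightarrow> 'v \<times> 'e \<times> ('v, 'e) rtree" where
  "child c \<equiv> (tail c, pedge c, L ! c)"

lemma children_index:
  assumes "\<And>v. count (vm s) v \<le> 1"
  shows "sc.children s = image_mset child (mset_set {c \<in> {1..<length L}. small c \<and> tail c \<in># vm s})"
proof -
  let ?M = "mset_set {c \<in> {1..<length L}. small c}"
  have own: "sc.own v (Chf v) = image_mset child (filter_mset (\<lambda>c. tail c = v) ?M)" for v
  proof -
    have "mset (filter (\<lambda>c. tail c = v \<and> small c) [1..<length L]) = filter_mset (\<lambda>c. tail c = v) ?M"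
    proof -
      have "filter_mset (\<lambda>c. tail c = v) ?M = mset_set {c \<in> {1..<length L}. tail c = v \<and> small c}"
        by (subst filter_mset_mset_set) (auto intro!: arg_cong[where f = mset_set])
      then show ?thesis
        by (simp add: filter_mset_mset_set)
    qed
    moreover have "sc.own v (Chf v) = image_mset child (mset (filter (\<lambda>c. tail c = v \<and> small c) [1..<length L]))"
      unfolding Chf_def by (simp add: image_mset.compositionality o_def flip: mset_filter) (intro image_mset_cong; auto)
    ultimately show ?thesis
      by simp
  qed
  have img: "(\<Sum>v\<in>#X. image_mset child (f v)) = image_mset child (\<Sum>v\<in>#X. f v)" for X :: "'v multiset" and f
    by (induction X) auto
  have "sc.children s = image_mset child (filter_mset (\<lambda>c. tail c \<in># vm s) ?M)"
    unfolding sc.children_eq own img sum_filter_eq[OF assms] ..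
  also have "filter_mset (\<lambda>c. tail c \<in># vm s) ?M = mset_set {c \<in> {1..<length L}. small c \<and> tail c \<in># vm s}"
    by (simp add: filter_mset_mset_set conj_assoc)
  finally show ?thesis .
qed

definition rest :: "nat \<Rightarrow> nat set \<Rightarrow> ('v, 'e) rtree multiset" where
  "rest i C = image_mset ((!) L) (mset_set ({Suc i..<length L} - C)) + R"

lemma LR_split:
  assumes "i < length L" "C \<subseteq> {Suc i..<length L}"
  shows "mset L + R = mset (take i L) + add_mset (L ! i) (image_mset ((!) L) (mset_set C)) + rest i C"
proof -
  have "mset_set {Suc i..<length L} = mset_set C + mset_set ({Suc i..<length L} - C)"
    using assms(2) by (subst mset_set_Union[symmetric]) (auto intro: finite_subset simp: Un_absorb1)
  then have "mset (drop (Suc i) L) = image_mset ((!) L) (mset_set C) + image_mset ((!) L) (mset_set ({Suc i..<length L} - C))"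
    unfolding mset_drop_nth by simp
  then show ?thesis
    unfolding mset_nth_split[OF assms(1)] rest_def by simp
qed

text \<open>\<open>C\<close> indexes the trees that are absorbed, \<open>C'\<close> the entering
  edges that lose their present blue orientation. The two sets differ when the blue edge into
  \<open>L ! i\<close> is itself reversed. The tails in \<open>D\<close> are covered by those that
  \<open>C'\<close> frees, so no out-degree grows.\<close>

lemma surgery:
  assumes i: "i < length L" and C: "C \<subseteq> {Suc i..<length L}" and C': "C \<subseteq> C'" "C' \<subseteq> {1..<length L}"
    and wf: "\<And>s. s \<in># Ps \<Longrightarrow> wft s"
    and vm: "(\<Sum>s\<in>#Ps. vm s) = vm (L ! i) + (\<Sum>c\<in>#mset_set C. vm (L ! c))"
    and em: "(\<Sum>s\<in>#Ps. em s) + image_mset snd D =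
      em (L ! i) + (\<Sum>c\<in>#mset_set C. em (L ! c)) + image_mset pedge (mset_set C')"
    and D: "\<And>v f. (v, f) \<in># D \<Longrightarrow> v \<in> N f" "image_mset fst D \<subseteq># image_mset tail (mset_set C')"
  shows "state E (Ps + (mset (take i L) + rest i C)) (D + (B - pairs C'))"
proof -
  have B: "pairs C' + (B - pairs C') = B"
    using pairs_subset[OF C'(2)] by simp
  show ?thesis
  proof (rule state_replace)
    show "state E (add_mset (L ! i) (image_mset ((!) L) (mset_set C)) + (mset (take i L) + rest i C)) (pairs C' + (B - pairs C'))"
      using state_LR unfolding B LR_split[OF i C] by (simp add: ac_simps)
    show "(\<Sum>s\<in>#Ps. vm s) = (\<Sum>s\<in>#add_mset (L ! i) (image_mset ((!) L) (mset_set C)). vm s)"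
      unfolding vm by (simp add: image_mset.compositionality o_def)
    show "(\<Sum>s\<in>#Ps. em s) + image_mset snd D =
        (\<Sum>s\<in>#add_mset (L ! i) (image_mset ((!) L) (mset_set C)). em s) + image_mset snd (pairs C')"
      unfolding em by (simp add: image_mset.compositionality o_def)
    show "count (image_mset fst (D + (B - pairs C'))) v \<le> k" for v
    proof -
      have "image_mset fst (pairs C') = image_mset tail (mset_set C')"
        by (simp add: image_mset.compositionality o_def)
      then have "count (image_mset fst D) v \<le> count (image_mset fst (pairs C')) v"
        using mset_subset_eq_count[OF D(2), of v] by simp
      then have "count (image_mset fst (D + (B - pairs C'))) v \<le> count (image_mset fst (pairs C' + (B - pairs C'))) v"
        by simp
      also have "\<dots> \<le> k"
        unfolding B using stateD(5)[OF state_LR] .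
      finally show ?thesis .
    qed
  qed (use wf D in auto)
qed

lemma surgery_badness:
  assumes "i < length L" "C \<subseteq> {Suc i..<length L}"
  shows "total_badness (Ps + (mset (take i L) + rest i C)) + badness (L ! i) \<le> total_badness (mset L + R) + total_badness Ps"
  unfolding LR_split[OF assms] by simp

lemma legal_prefix:
  assumes "j \<le> length L" and "\<And>c. 0 < c \<Longrightarrow> c < j \<Longrightarrow> (tail c, pedge c) \<in># B'"
  shows "legal B' (take j L)"
  unfolding legal_def
proof (intro allI impI)
  fix c assume c: "c < length (take j L)" "0 < c"
  then show "\<exists>h<c. \<exists>v p. v \<in># vm (take j L ! h) \<and> (v, p) \<in># B' \<and> N p = {v, root (take j L ! c)}"
    using link[of c] assms by (intro exI[of _ "par c"] conjI exI[of _ "tail c"] exI[of _ "pedge c"]) auto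
qed

text \<open>All entering edges that are removed belong to trees after position \<open>i\<close>, and
  \<open>P\<close> keeps the root of \<open>L ! i\<close>; hence the shortened list is still legal,
  and it is lexicographically smaller.\<close>

lemma surgery_config:
  assumes i: "i < length L" "0 < i" and C: "C \<subseteq> {Suc i..<length L}"
    and wf: "\<And>s. s \<in># add_mset P Ps \<Longrightarrow> wft s" and root: "root P = root (L ! i)"
    and vm: "(\<Sum>s\<in>#add_mset P Ps. vm s) = vm (L ! i) + (\<Sum>c\<in>#mset_set C. vm (L ! c))"
    and em: "(\<Sum>s\<in>#add_mset P Ps. em s) + image_mset snd D =
      em (L ! i) + (\<Sum>c\<in>#mset_set C. em (L ! c)) + image_mset pedge (mset_set C)"
    and D: "\<And>v f. (v, f) \<in># D \<Longrightarrow> v \<in> N f" "image_mset fst D \<subseteq># image_mset tail (mset_set C)"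
    and bad: "total_badness (add_mset P Ps) \<le> badness (L ! i)"
    and less: "esz P < esz (L ! i)"
  shows False
proof -
  have C1: "C \<subseteq> {1..<length L}"
    using C by auto
  have st: "state E (add_mset P Ps + (mset (take i L) + rest i C)) (D + (B - pairs C))"
    by (rule surgery[OF i(1) C order.refl C1 wf vm em D])
  have "config (take i L @ [P]) (Ps + rest i C) (D + (B - pairs C))"
    unfolding config_def
  proof (intro conjI)
    show "state E (mset (take i L @ [P]) + (Ps + rest i C)) (D + (B - pairs C))"
      using st by (simp add: ac_simps)
    have "legal (B - pairs C) (take (Suc i) L)"
    proof (rule legal_prefix)
      fix c assume "0 < c" "c < Suc i"
      then show "(tail c, pedge c) \<in># B - pairs C"
        using i(1) C by (intro pair_remains[OF C1]) auto
    qed (use i(1) in simp)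
    then show "legal (D + (B - pairs C)) (take i L @ [P])"
      by (rule legal_snoc[OF _ i(1) root]) simp
    show "\<not> good (set_mset (em ((take i L @ [P]) ! 0)))"
      using bad_root i by (simp add: nth_append)
  qed simp
  moreover have "total_badness (mset (take i L @ [P]) + (Ps + rest i C)) \<le> total_badness (mset L + R)"
    using surgery_badness[OF i(1) C, of "add_mset P Ps"] bad by simp
  ultimately show False
    using minimal_list[of i P "Ps + rest i C" "D + (B - pairs C)"] less i(1) by linarith
qed

lemma count_vm_subtree:
  assumes "i < length L" "s \<in> subtrees (L ! i)"
  shows "set_mset (vm s) \<subseteq> set_mset (vm (L ! i))" "count (vm s) v \<le> 1"
proof -
  have sub: "vm s \<subseteq># vm (L ! i)"
    using subtree_context[OF wft_L[OF assms(1)] assms(2)] by auto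
  then show "set_mset (vm s) \<subseteq> set_mset (vm (L ! i))"
    by (rule set_mset_mono)
  have "count (vm (L ! i)) v \<le> 1"
    using state_count_vm[OF state_LR, of "L ! i" v] assms(1) by simp
  then show "count (vm s) v \<le> 1"
    using mset_subset_eq_count[OF sub, of v] by (rule le_trans[rotated])
qed

text \<open>A parent precedes its children in the list, so an exchange inside \<open>L ! i\<close>
  can only absorb trees behind it and leaves the prefix intact.\<close>

lemma rearr_index:
  assumes "i < length L" "s \<in> subtrees (L ! i)" "U \<subseteq># sc.children s"
  shows "\<exists>C. C \<subseteq> {Suc i..<length L} \<and> U = image_mset child (mset_set C)"
proof -
  let ?C = "{c \<in> {1..<length L}. small c \<and> tail c \<in># vm s}"
  have "sc.children s = image_mset child (mset_set ?C)"
    by (rule children_index) (rule count_vm_subtree(2)[OF assms(1,2)])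
  then obtain C where C: "C \<subseteq> ?C" "U = image_mset child (mset_set C)"
    using subseteq_image_mset_set[of U child ?C] assms(3) by auto
  have "C \<subseteq> {Suc i..<length L}"
  proof
    fix c assume "c \<in> C"
    then have c: "0 < c" "c < length L" "tail c \<in># vm (L ! i)"
      using C(1) count_vm_subtree(1)[OF assms(1,2)] by auto
    then have "i < c"
      using par_eq[OF c(1,2) assms(1)] link(1)[OF c(1,2)] by simp
    then show "c \<in> {Suc i..<length L}"
      using c(2) by simp
  qed
  then show ?thesis
    using C(2) by blast
qed

lemma rearrD:
  assumes "sc.rearr n s M Q U D" and "U = image_mset child (mset_set C)"
  shows "root M = root s" "wft M" "q \<in># Q \<Longrightarrow> wft q"
    "vm M + (\<Sum>q\<in>#Q. vm q) = vm s + (\<Sum>c\<in>#mset_set C. vm (L ! c))"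
    "em M + (\<Sum>q\<in>#Q. em q) + image_mset snd D =
      em s + (\<Sum>c\<in>#mset_set C. em (L ! c)) + image_mset pedge (mset_set C)"
    "replicate_mset n (root s) + image_mset fst D = image_mset tail (mset_set C)"
    "(v, f) \<in># D \<Longrightarrow> v \<in> N f" "(\<Sum>q\<in>#Q. em q) + image_mset snd D \<subseteq># em s" "size Q = size D"
  using assms unfolding sc.rearr_def
  by (simp_all add: image_mset.compositionality o_def) blast+

lemma good_if_admissible:
  assumes "state E T B'" "s \<in># T" "sc.admissible s"
  shows "badness s = 0"
  using admissible_good[OF stateD(1)[OF assms(1,2)] state_count_vm[OF assms(1,2)]] assms(3)
  unfolding sc.admissible_def badness_def by simp

text \<open>The exchange leaves the root of \<open>s\<close> with a spare out-edge. For a proper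
  subtree it is spent on the edge above \<open>s\<close>: the piece with the old root is smaller,
  and at \<open>i = 0\<close> the badness drops. For a whole tree it is spent on reversing the blue
  edge into \<open>L ! i\<close>, and the spare passes to an earlier tree, against
  \<open>no_spare\<close>. Since \<open>M\<close> is good, the badness does not grow in either
  case.\<close>

lemma no_spare_rearr:
  assumes i: "i < length L" and s: "s \<in> subtrees (L ! i)" and r: "sc.rearr 1 s M Q U D"
    and proper: "s \<noteq> L ! i \<or> 0 < i"
  shows "\<not> sc.admissible M"
proof
  assume adm: "sc.admissible M"
  have "U \<subseteq># sc.children s"
    using r unfolding sc.rearr_def by blast
  then obtain C where C: "C \<subseteq> {Suc i..<length L}" "U = image_mset child (mset_set C)"
    using rearr_index[OF i s] by blast
  have C1: "C \<subseteq> {1..<length L}"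
    using C(1) by auto
  note R = rearrD[OF r C(2)]
  have Qs: "(\<Sum>q\<in>#Q. em q) \<subseteq># em s"
    by (rule subset_mset.order_trans[OF mset_subset_eq_add_left R(8)])
  have spare: "add_mset (root s) (image_mset fst D) = image_mset tail (mset_set C)"
    using R(6) by simp
  show False
  proof (cases "s = L ! i")
    case False
    obtain K0 f a where K0: "wft K0" "root K0 = root (L ! i)" "a \<in># vm K0" "N f = {a, root s}"
      "vm (L ! i) = vm K0 + vm s" "em (L ! i) = add_mset f (em K0 + em s)"
      using subtree_context[OF wft_L[OF i] s] False by blast
    define Ps where "Ps = add_mset M Q"
    define D' where "D' = add_mset (root s, f) D"
    have wf: "wft t" if "t \<in># add_mset K0 Ps" for t
      using that K0(1) R(2) R(3)[of t] unfolding Ps_def by auto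
    have vm: "(\<Sum>t\<in>#add_mset K0 Ps. vm t) = vm (L ! i) + (\<Sum>c\<in>#mset_set C. vm (L ! c))"
      using R(4) unfolding Ps_def K0(5) by (simp add: add.assoc)
    have "(\<Sum>t\<in>#add_mset K0 Ps. em t) + image_mset snd D' =
        add_mset f (em K0 + (em M + (\<Sum>q\<in>#Q. em q) + image_mset snd D))"
      unfolding Ps_def D'_def by (simp add: ac_simps)
    then have em: "(\<Sum>t\<in>#add_mset K0 Ps. em t) + image_mset snd D' =
        em (L ! i) + (\<Sum>c\<in>#mset_set C. em (L ! c)) + image_mset pedge (mset_set C)"
      unfolding R(5) K0(6) by (simp add: ac_simps)
    have D1: "v \<in> N g" if "(v, g) \<in># D'" for v g
      using that R(7)[of v g] K0(4) unfolding D'_def by auto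
    have D2: "image_mset fst D' \<subseteq># image_mset tail (mset_set C)"
      unfolding spare[symmetric] D'_def by simp
    have st: "state E (add_mset K0 Ps + (mset (take i L) + rest i C)) (D' + (B - pairs C))"
      by (rule surgery[OF i C(1) order.refl C1 wf vm em D1 D2])
    have "M \<in># add_mset K0 Ps + (mset (take i L) + rest i C)"
      unfolding Ps_def by simp
    then have M0: "badness M = 0"
      using good_if_admissible[OF st _ adm] by simp
    have bad: "total_badness (add_mset K0 Ps) = total_badness (add_mset K0 Q)"
      unfolding Ps_def using M0 by simp
    have sub: "(\<Sum>t\<in>#add_mset K0 Q. em t) \<subseteq># em K0 + em s"
      using Qs by simp
    show False
    proof (cases "i = 0")
      case True
      have "total_badness (add_mset K0 Q) < esz (L ! i)"
        using total_badness_le[of "add_mset K0 Q"] size_mset_mono[OF sub] K0(6) by simp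
      moreover have "badness (L ! i) = esz (L ! i)"
        using bad_root True by (simp add: badness_def)
      ultimately show False
        using surgery_badness[OF i C(1), of "add_mset K0 Ps"] minimal_badness[OF st] bad by linarith
    next
      case False
      then have i0: "0 < i"
        by simp
      have "em K0 + em s \<subseteq># em (L ! i)"
        unfolding K0(6) by (metis add_mset_add_single mset_subset_eq_add_left)
      with sub have "(\<Sum>t\<in>#add_mset K0 Q. em t) \<subseteq># em (L ! i)"
        by (rule subset_mset.order_trans)
      then have tb: "total_badness (add_mset K0 Ps) \<le> badness (L ! i)"
        unfolding bad by (rule total_badness_pieces)
      have less: "esz K0 < esz (L ! i)"
        using K0(6) by simp
      show False
        by (rule surgery_config[OF i i0 C(1) wf K0(2) vm em D1 D2 tb less])
    qed
  next
    case True
    then have i0: "0 < i"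
      using proper by simp
    define j where "j = par i"
    have j: "j < i" "tail i \<in># vm (L ! j)"
      using link(1,2)[OF i0 i] by (simp_all add: j_def)
    \<comment> \<open>The blue edge into tree \<open>i\<close> gives up its tail too, although tree
      \<open>i\<close> is not one of the absorbed children.\<close>
    define C' where "C' = insert i C"
    define D' where "D' = add_mset (root s, pedge i) D"
    have iC: "i \<notin> C" "finite C"
      using C(1) finite_subset by auto
    have C': "C \<subseteq> C'" "C' \<subseteq> {1..<length L}"
      using C1 i i0 unfolding C'_def by auto
    have wf: "wft t" if "t \<in># add_mset M Q" for t
      using that R(2) R(3)[of t] by auto
    have vm: "(\<Sum>t\<in>#add_mset M Q. vm t) = vm (L ! i) + (\<Sum>c\<in>#mset_set C. vm (L ! c))"
      using R(4) True by simp
    have em: "(\<Sum>t\<in>#add_mset M Q. em t) + image_mset snd D' =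
        em (L ! i) + (\<Sum>c\<in>#mset_set C. em (L ! c)) + image_mset pedge (mset_set C')"
      using R(5) True iC unfolding D'_def C'_def by simp
    have D1: "v \<in> N g" if "(v, g) \<in># D'" for v g
      using that R(7)[of v g] link(4)[OF i0 i] True unfolding D'_def by auto
    have fD': "image_mset fst D' = image_mset tail (mset_set C)"
      using spare unfolding D'_def by simp
    then have D2: "image_mset fst D' \<subseteq># image_mset tail (mset_set C')"
      using iC unfolding C'_def by simp
    have st: "state E (add_mset M Q + (mset (take i L) + rest i C)) (D' + (B - pairs C'))"
      by (rule surgery[OF i C(1) C' wf vm em D1 D2])
    have "M \<in># add_mset M Q + (mset (take i L) + rest i C)"
      by simp
    then have M0: "badness M = 0"
      using good_if_admissible[OF st _ adm] by simp
    have bad: "total_badness (add_mset M Q) \<le> badness (L ! i)"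
      using M0 total_badness_pieces[OF Qs] True by simp
    define X where "X = add_mset M Q + (mset (drop (Suc j) (take i L)) + rest i C)"
    have "take i L = take (Suc j) L @ drop (Suc j) (take i L)"
      using j(1) by (metis append_take_drop_id min.absorb1 take_take Suc_leI)
    then have mt: "mset (take i L) = mset (take (Suc j) L) + mset (drop (Suc j) (take i L))"
      by (metis mset_append)
    have split: "add_mset M Q + (mset (take i L) + rest i C) = mset (take (Suc j) L) + X"
      unfolding X_def mt by (simp add: ac_simps)
    have leg: "legal (D' + (B - pairs C')) (take (Suc j) L)"
    proof (rule legal_prefix)
      fix c assume c: "0 < c" "c < Suc j"
      then have "(tail c, pedge c) \<in># B - pairs C'"
        using j(1) i C(1) by (intro pair_remains[OF C'(2)]) (auto simp: C'_def)
      then show "(tail c, pedge c) \<in># D' + (B - pairs C')"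
        by simp
    qed (use i j(1) in simp)
    have tb: "total_badness (mset (take (Suc j) L) + X) \<le> total_badness (mset L + R)"
      using surgery_badness[OF i C(1), of "add_mset M Q"] bad unfolding split by linarith
    have cnt: "count (image_mset fst (D' + (B - pairs C'))) (tail i) < k"
    proof -
      have "add_mset (tail i) (image_mset fst D') = image_mset fst (pairs C')"
        unfolding fD' using iC unfolding C'_def by (simp add: image_mset.compositionality o_def)
      moreover have "pairs C' + (B - pairs C') = B"
        using pairs_subset[OF C'(2)] by (rule subset_mset.add_diff_inverse)
      then have "image_mset fst (pairs C') + image_mset fst (B - pairs C') = image_mset fst B"
        by (metis image_mset_union)
      ultimately have "add_mset (tail i) (image_mset fst D') + image_mset fst (B - pairs C') = image_mset fst B"
        by simp
      then have "count (add_mset (tail i) (image_mset fst D') + image_mset fst (B - pairs C')) (tail i) =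
          count (image_mset fst B) (tail i)"
        by (rule arg_cong)
      then have "Suc (count (image_mset fst (D' + (B - pairs C'))) (tail i)) = count (image_mset fst B) (tail i)"
        by simp
      then show ?thesis
        using stateD(5)[OF state_LR, of "tail i"] by linarith
    qed
    have "j < length L"
      using i j(1) by simp
    then show False
      by (rule no_spare[OF _ st[unfolded split] leg tb j(2) cnt])
  qed
qed

lemma root_strictly_strong:
  "d * (1 + sc.num_children (L ! 0)) < (k + 1) * sc.weight (L ! 0)"
proof -
  obtain x bs where K: "L ! 0 = Node x bs"
    by (cases "L ! 0")
  have "d * (1 + sc.num_children (Node x bs)) < (k + 1) * sc.weight (Node x bs)"
  proof (rule sc.strictly_strong)
    show "wft (Node x bs)"
      using wft_L[OF L_nonempty] K by simp
  next
    fix e b s M Q U D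
    assume b: "(e, b) \<in> set bs" "s \<in> subtrees b" and r: "sc.rearr 1 s M Q U D"
    have sub: "b \<in> subtrees (L ! 0)"
      unfolding K by (rule branch_subtree[OF self_subtree b(1)])
    have s: "s \<in> subtrees (L ! 0)"
      by (rule subtrees_trans[OF b(2) sub])
    have le: "esz s \<le> esz b"
      using subtree_context[OF wft_subtree[OF wft_L[OF L_nonempty] sub] b(2)] by auto
    have "add_mset e (em b) \<subseteq># em (Node x bs)"
      using sum_list_remove1[OF b(1), of "\<lambda>(e, b). add_mset e (em b)"] by simp
    then have "esz b < esz (L ! 0)"
      using size_mset_mono unfolding K by fastforce
    then have "s \<noteq> L ! 0"
      using le by auto
    then show "\<not> sc.admissible M"
      using no_spare_rearr[OF L_nonempty s r] by blast
  next
    fix M Q U D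
    assume r: "sc.rearr 0 (Node x bs) M Q U D"
    show "\<not> sc.admissible M"
    proof
      assume adm: "sc.admissible M"
      have r: "sc.rearr 0 (L ! 0) M Q U D"
        using r K by simp
      have "U \<subseteq># sc.children (L ! 0)"
        using r unfolding sc.rearr_def by blast
      then obtain C where C: "C \<subseteq> {Suc 0..<length L}" "U = image_mset child (mset_set C)"
        using rearr_index[OF L_nonempty self_subtree] by blast
      have C1: "C \<subseteq> {1..<length L}"
        using C(1) by simp
      note R = rearrD[OF r C(2)]
      have st: "state E (add_mset M Q + (mset (take 0 L) + rest 0 C)) (D + (B - pairs C))"
        by (rule surgery[OF L_nonempty C(1) order.refl C1]) (use R in auto)
      have M0: "badness M = 0"
        using good_if_admissible[OF st _ adm] by simp
      have badK: "badness (L ! 0) = esz (L ! 0)"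
        using bad_root by (simp add: badness_def)
      \<comment> \<open>Each piece cut off costs a red edge that is now blue and belongs to no tree,
        so with at least one piece the total size drops. Without pieces only the good tree
        \<open>M\<close> remains.\<close>
      have "total_badness Q < esz (L ! 0)"
      proof (cases "Q = {#}")
        case True
        have "em (L ! 0) \<noteq> {#}"
          using bad_root good_empty by auto
        then show ?thesis
          using True by (metis total_badness_simps(1) nonempty_has_size)
      next
        case False
        then have "size D > 0"
          using R(9) by (metis nonempty_has_size)
        then show ?thesis
          using size_mset_mono[OF R(8)] total_badness_le[of Q] by simp
      qed
      then show False
        using surgery_badness[OF L_nonempty C(1), of "add_mset M Q"] minimal_badness[OF st] M0 badK
        by simp
    qed
  qed
  then show ?thesis
    unfolding K .
qed

text \<open>A tree that is not strong has a core \<open>M\<close>. If it had children, each with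
  fewer than \<open>d / (k + 1)\<close> edges, the inequality of the core would make
  \<open>M\<close> smaller than the tree; as \<open>M\<close> is good and has the same root, it
  could take the place of the tree. Without children the weight is just the size, and failing to be
  strong means being small.\<close>

lemma strong_or_small:
  assumes i: "i < length L" "0 < i"
  shows "sc.strong (L ! i) \<or> (sc.num_children (L ! i) = 0 \<and> small i)"
proof (cases "sc.strong (L ! i)")
  case False
  have "sc.strong (L ! i) \<or> (\<exists>M. sc.weak_core (L ! i) M)"
    by (rule sc.strong_or_weak[OF wft_L[OF i(1)]]) (use no_spare_rearr[OF i(1)] i(2) in blast)
  then obtain M where M: "sc.weak_core (L ! i) M"
    using False by blast
  obtain Q U D where r: "sc.rearr 0 (L ! i) M Q U D"
    using M unfolding sc.weak_core_def by blast
  have smallM: "(k + 1) * esz M < d" and wM: "(k + 1) * esz M + d * sc.num_children (L ! i) \<le> (k + 1) * sc.weight (L ! i)"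
    using M unfolding sc.weak_core_def by auto
  have J0: "sc.num_children (L ! i) = 0"
  proof (rule ccontr)
    assume J: "sc.num_children (L ! i) \<noteq> 0"
    have "(k + 1) * esz b < d" if "(x, c, b) \<in># sc.children (L ! i)" for x c b
      using that sc.Ch unfolding sc.children_eq by auto
    then have "(k + 1) * (\<Sum>(x, c, b)\<in>#sc.children (L ! i). esz b) < d * sc.num_children (L ! i)"
      using J by (intro sum_small_less) auto
    then have "(k + 1) * esz M < (k + 1) * esz (L ! i)"
      using wM unfolding sc.weight_def by (simp add: distrib_left)
    then have less: "esz M < esz (L ! i)"
      by (simp only: mult_less_cancel1)
    have "U \<subseteq># sc.children (L ! i)"
      using r unfolding sc.rearr_def by blast
    then obtain C where C: "C \<subseteq> {Suc i..<length L}" "U = image_mset child (mset_set C)"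
      using rearr_index[OF i(1) self_subtree] by blast
    have C1: "C \<subseteq> {1..<length L}"
      using C(1) by auto
    note R = rearrD[OF r C(2)]
    have st: "state E (add_mset M Q + (mset (take i L) + rest i C)) (D + (B - pairs C))"
      by (rule surgery[OF i(1) C(1) order.refl C1]) (use R in auto)
    have M0: "badness M = 0"
      using good_if_admissible[OF st] small_admissible[OF smallM] unfolding sc.admissible_def by simp
    have "(\<Sum>q\<in>#Q. em q) \<subseteq># em (L ! i)"
      by (rule subset_mset.order_trans[OF mset_subset_eq_add_left R(8)])
    then have "total_badness (add_mset M Q) \<le> badness (L ! i)"
      using M0 total_badness_pieces by simp
    then show False
      using R less by (intro surgery_config[OF i C(1), of M Q D]) auto
  qed
  moreover have "small i"
  proof -
    have "sc.weight (L ! i) = esz (L ! i)"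
      using J0 unfolding sc.weight_def by simp
    then show ?thesis
      using False J0 unfolding sc.strong_def by simp
  qed
  ultimately show ?thesis
    by blast
qed blast

definition kids :: "nat \<Rightarrow> nat set" where
  "kids i = {c \<in> {1..<length L}. small c \<and> par c = i}"

lemma children_kids:
  assumes "i < length L"
  shows "sc.children (L ! i) = image_mset child (mset_set (kids i))"
proof -
  have "{c \<in> {1..<length L}. small c \<and> tail c \<in># vm (L ! i)} = kids i"
    using par_eq[OF _ _ assms] unfolding kids_def by auto
  then show ?thesis
    using children_index[of "L ! i"] count_vm_subtree(2)[OF assms self_subtree] by simp
qed

lemma num_children_kids: "i < length L \<Longrightarrow> sc.num_children (L ! i) = card (kids i)"
  by (simp add: children_kids)

lemma weight_kids: "i < length L \<Longrightarrow> sc.weight (L ! i) = esz (L ! i) + (\<Sum>c\<in>kids i. esz (L ! c))"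
  unfolding sc.weight_def children_kids by (simp add: image_mset.compositionality o_def sum_unfold_sum_mset)

text \<open>An unlisted tree entered by such an edge could be rerooted at the head of the edge and
  appended, and by the padding a longer list is smaller.\<close>

lemma blue_closed:
  assumes "i < length L" "(v, e) \<in># B" "v \<in># vm (L ! i)"
  shows "\<exists>S\<in>set L. \<exists>u\<in>#vm S. N e = {v, u}"
proof -
  obtain u where u: "N e = {v, u}" "u \<in> V"
    using blue_edge[OF state_LR order.refl assms(2)] .
  then obtain K where K: "K \<in># mset L + R" "u \<in># vm K"
    using state_vertex[OF state_LR] by blast
  show ?thesis
  proof (cases "K \<in> set L")
    case False
    then have "K \<in># R"
      using K(1) by auto
    then obtain R' where R': "R = add_mset K R'"
      by (metis multi_member_split)
    have "wft K"
      using stateD(1)[OF state_LR K(1)] .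
    from reroot[OF this K(2)] obtain K' where K': "wft K'" "root K' = u" "vm K' = vm K" "em K' = em K"
      by blast
    have "state E (add_mset K (mset L + R')) B"
      using state_LR unfolding R' by simp
    from state_reroot[OF this K'(1,3,4)] have "state E (mset (L @ [K']) + R') B"
      by simp
    moreover have "legal B (L @ [K'])"
      unfolding legal_def
    proof (intro allI impI)
      fix c assume c: "c < length (L @ [K'])" "0 < c"
      show "\<exists>j<c. \<exists>v p. v \<in># vm ((L @ [K']) ! j) \<and> (v, p) \<in># B \<and> N p = {v, root ((L @ [K']) ! c)}"
      proof (cases "c = length L")
        case True
        then show ?thesis
          using assms u(1) K'(2) by (intro exI[of _ i] conjI exI[of _ v] exI[of _ e]) (simp_all add: nth_append)
      next
        case False
        then have c': "c < length L"
          using c(1) by simp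
        show ?thesis
          using link[OF c(2) c'] c' by (intro exI[of _ "par c"] conjI exI[of _ "tail c"] exI[of _ "pedge c"]) (simp_all add: nth_append)
      qed
    qed
    ultimately have "config (take (length L) L @ [K']) R' B"
      using bad_root L_nonempty unfolding config_def by (simp add: nth_append)
    moreover have "total_badness (mset (take (length L) L @ [K']) + R') \<le> total_badness (mset L + R)"
      unfolding R' using badness_cong[OF K'(4)] by simp
    ultimately show ?thesis
      using minimal_list[of "length L" K' R' B] by blast
  qed (use K u in blast)
qed

text \<open>The listed trees have as many vertices as edges plus trees. Substituting this in the
  density bound, with no uncovered edges, cancels the terms of the blue edges and leaves
  \<open>k + 1\<close> as the factor.\<close>

lemma sparse_list: "(k + 1) * (\<Sum>i<length L. esz (L ! i)) \<le> d * length L"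
proof -
  define S where "S = set_mset (\<Sum>s\<in>#mset L. vm s)"
  have memS: "v \<in> S \<longleftrightarrow> (\<exists>i<length L. v \<in># vm (L ! i))" for v
    unfolding S_def by (auto simp: in_set_conv_nth) (metis nth_mem)
  have "((\<Sum>s\<in>#mset L. esz s) + k * card S + card ({} :: 'e set)) * (d + k + 1) \<le> (k * (d + k + 1) + d) * card S"
  proof (rule density_bound[OF state_LR order.refl S_def])
    show "S \<noteq> {}"
      using memS[of "root (L ! 0)"] L_nonempty root_in_vm[of "L ! 0"] by blast
    show "count (image_mset fst B) v = k" if "v \<in> S" for v
      using that full memS by blast
    show "N e \<subseteq> S" if vB: "(v, e) \<in># B" and vS: "v \<in> S" for v e
    proof -
      obtain i where "i < length L" "v \<in># vm (L ! i)"
        using vS memS by blast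
      then obtain T u where "T \<in> set L" "u \<in># vm T" "N e = {v, u}"
        using blue_closed[OF _ vB] by blast
      then show ?thesis
        using vS memS[of u] by (metis empty_subsetI in_set_conv_nth insert_subset)
    qed
  qed auto
  moreover have "(\<Sum>s\<in>#mset L. esz s) = (\<Sum>i<length L. esz (L ! i))"
    by (simp add: sum_mset_sum_list sum_list_sum_nth atLeast0LessThan flip: mset_map)
  moreover have "card S = (\<Sum>i<length L. esz (L ! i)) + length L"
  proof -
    have "card S = size (\<Sum>s\<in>#mset L. vm s)"
      unfolding S_def using card_set_mset_subset[OF state_vm_subset[OF state_LR]] .
    also have "\<dots> = (\<Sum>i<length L. Suc (esz (L ! i)))"
      by (simp add: size_sum_mset image_mset.compositionality o_def size_vm sum_mset_sum_list sum_list_sum_nth atLeast0LessThan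
          flip: mset_map)
    finally show ?thesis
      by (simp add: sum_Suc)
  qed
  ultimately show ?thesis
    by (simp add: algebra_simps)
qed

text \<open>Every tree of the list lies in exactly one group, consisting of a tree in
  \<open>Big\<close> and its kids. Each group has average size at least \<open>d / (k + 1)\<close>,
  and the group of tree 0 exceeds it.\<close>

lemma no_minimal_config: False
proof -
  define Sm where "Sm = {c \<in> {1..<length L}. small c}"
  define Big where "Big = {..<length L} - Sm"
  have fin: "finite Sm" "finite Big"
    unfolding Sm_def Big_def by auto
  \<comment> \<open>A small tree with kids would have to be strong, but it and all its kids are
    below the average that strength requires.\<close>
  have J0: "kids i = {}" if "i \<in> Sm" for i
  proof (rule ccontr)
    assume ne: "kids i \<noteq> {}"
    have i: "i < length L" "0 < i" "small i"
      using that unfolding Sm_def by auto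
    have finK: "finite (kids i)"
      unfolding kids_def by simp
    then have "sc.strong (L ! i)"
      using strong_or_small[OF i(1,2)] ne num_children_kids[OF i(1)] by simp
    then have "d * (1 + card (kids i)) \<le> (k + 1) * (esz (L ! i) + (\<Sum>c\<in>kids i. esz (L ! c)))"
      unfolding sc.strong_def num_children_kids[OF i(1)] weight_kids[OF i(1)] .
    moreover have "(\<Sum>c\<in>kids i. (k + 1) * esz (L ! c)) \<le> (\<Sum>c\<in>kids i. d)"
      by (rule sum_mono) (auto simp: kids_def)
    then have "(k + 1) * (\<Sum>c\<in>kids i. esz (L ! c)) \<le> d * card (kids i)"
      by (simp add: sum_distrib_left mult.commute)
    ultimately show False
      using i(3) by (simp add: distrib_left)
  qed
  have par_Big: "par c \<in> Big" if "c \<in> Sm" for c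
  proof -
    have c: "0 < c" "c < length L"
      using that unfolding Sm_def by auto
    have "c \<in> kids (par c)"
      using that unfolding Sm_def kids_def by simp
    then show ?thesis
      using J0[of "par c"] link(1)[OF c] c(2) unfolding Big_def by auto
  qed
  have kids_Sm: "kids i = {c \<in> Sm. par c = i}" for i
    unfolding kids_def Sm_def by auto
  have group: "(\<Sum>i\<in>Big. \<Sum>c\<in>kids i. f c) = (\<Sum>c\<in>Sm. f c)" for f :: "nat \<Rightarrow> nat"
    unfolding kids_Sm by (rule sum.group) (use fin par_Big in auto)
  have le: "d * (1 + card (kids i)) \<le> (k + 1) * sc.weight (L ! i)" if "i \<in> Big" for i
  proof (cases "i = 0")
    case True
    then show ?thesis
      using root_strictly_strong num_children_kids[OF L_nonempty] by simp
  next
    case False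
    then have i: "i < length L" "0 < i" "\<not> small i"
      using that unfolding Big_def Sm_def by auto
    then have "sc.strong (L ! i)"
      using strong_or_small[OF i(1,2)] by blast
    then show ?thesis
      unfolding sc.strong_def num_children_kids[OF i(1)] .
  qed
  \<comment> \<open>The first tree provides strictness. \<open>Sm\<close> excludes the index 0 by
    definition, so tree 0 heads a group whatever its size.\<close>
  have "0 \<in> Big"
    using L_nonempty unfolding Big_def Sm_def by simp
  then have "(\<Sum>i\<in>Big. d * (1 + card (kids i))) < (\<Sum>i\<in>Big. (k + 1) * sc.weight (L ! i))"
    using root_strictly_strong num_children_kids[OF L_nonempty] le fin
    by (intro sum_strict_mono_ex1) auto
  moreover have "(\<Sum>i\<in>Big. d * (1 + card (kids i))) = d * length L"
  proof -
    have "(\<Sum>i\<in>Big. card (kids i)) = card Sm"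
      using group[of "\<lambda>_. 1"] by simp
    moreover have "Sm \<subseteq> {..<length L}"
      unfolding Sm_def by auto
    then have "card Big + card Sm = length L"
      using card_Diff_subset[of Sm "{..<length L}"] card_mono[of "{..<length L}" Sm] fin(1)
      unfolding Big_def by simp
    ultimately have "(\<Sum>i\<in>Big. 1 + card (kids i)) = length L"
      by (simp add: sum.distrib sum_Suc)
    then show ?thesis
      by (metis sum_distrib_left)
  qed
  moreover have "(\<Sum>i\<in>Big. sc.weight (L ! i)) = (\<Sum>i<length L. esz (L ! i))"
  proof -
    have "(\<Sum>i\<in>Big. sc.weight (L ! i)) = (\<Sum>i\<in>Big. esz (L ! i) + (\<Sum>c\<in>kids i. esz (L ! c)))"
      by (rule sum.cong) (auto simp: Big_def weight_kids)
    also have "\<dots> = (\<Sum>i\<in>Big. esz (L ! i)) + (\<Sum>i\<in>Sm. esz (L ! i))"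
      by (simp only: sum.distrib group)
    also have "\<dots> = (\<Sum>i<length L. esz (L ! i))"
      unfolding Big_def by (rule sum.subset_diff[symmetric]) (auto simp: Sm_def)
    finally show ?thesis .
  qed
  ultimately show False
    using sparse_list by (simp only: sum_distrib_left[symmetric])
qed

end

context sparse_graph
begin

lemma exists_good_state: "\<exists>T B. state E T B \<and> (\<forall>s\<in>#T. good (set_mset (em s)))"
proof (rule ccontr)
  assume contra: "\<not> ?thesis"
  have nz: "total_badness T \<noteq> 0" if st: "state E T B" for T B
  proof
    assume zero: "total_badness T = 0"
    have "good (set_mset (em s))" if "s \<in># T" for s
    proof (rule ccontr)
      assume bad: "\<not> good (set_mset (em s))"
      have "badness s = 0"
        using zero that unfolding total_badness_def by simp
      then have "em s = {#}"
        using bad unfolding badness_def by simp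
      then show False
        using bad good_empty by simp
    qed
    then show False
      using contra st by blast
  qed
  obtain L R B where
    1: "config L R B" and 2: "\<forall>T' B'. state E T' B' \<longrightarrow> total_badness (mset L + R) \<le> total_badness T'"
    and 3: "\<forall>i P R' B'. config (take i L @ [P]) R' B' \<longrightarrow>
       total_badness (mset (take i L @ [P]) + R') \<le> total_badness (mset L + R) \<longrightarrow>
       i \<le> length L \<longrightarrow> \<not> (i = length L \<or> esz P < esz (L ! i))"
    using minimal_config_exists nz by metis
  interpret minimal_config N V E k d L R B
  proof
    show "config L R B"
      by (rule 1)
    show "total_badness (mset L + R) \<le> total_badness T'" if "state E T' B'" for T' B'
      using 2 that by blast
    show False if "config (take i L @ [P]) R' B'"
      "total_badness (mset (take i L @ [P]) + R') \<le> total_badness (mset L + R)"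
      "i \<le> length L" "i = length L \<or> esz P < esz (L ! i)" for i P R' B'
      using 3 that by blast
  qed
  show False
    by (rule no_minimal_config)
qed

end

section \<open>Walks, cycles and pseudoforests\<close>

lemma walk_nth:
  assumes "walk H vs es"
  shows "length vs = Suc (length es)" "i < length es \<Longrightarrow> ends H (es ! i) = {vs ! i, vs ! Suc i}"
    "i \<le> length es \<Longrightarrow> vs ! i \<in> set vs" "i < length es \<Longrightarrow> es ! i \<in> edges H"
  using assms unfolding walk_def by auto

lemma walk_ends_subset:
  assumes "walk H vs es" "e \<in> set es"
  shows "ends H e \<subseteq> set vs"
proof -
  obtain i where i: "i < length es" "es ! i = e"
    using assms(2) by (auto simp: in_set_conv_nth)
  then show ?thesis
    using walk_nth(2)[OF assms(1), of i] walk_nth(3)[OF assms(1), of i] walk_nth(3)[OF assms(1), of "Suc i"]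
    by simp
qed

context incidence
begin

lemma layering_low:
  assumes "layering lev low r A" "e \<in> A" "N e = {u, v}" "lev u \<le> lev v"
  shows "low e = v" "lev v = Suc (lev u)" "lev v \<le> r"
proof -
  obtain w where w: "N e = {w, low e}" "lev (low e) = Suc (lev w)" "lev (low e) \<le> r"
    using assms(1,2) unfolding layering_def by blast
  then have "w = u \<and> low e = v \<or> w = v \<and> low e = u"
    using assms(3) by (metis doubleton_eq_iff)
  then show "low e = v" "lev v = Suc (lev u)" "lev v \<le> r"
    using w assms(4) by auto
qed

text \<open>A path first climbs towards the root and then descends. After a descending step the
  vertex reached is the lower end of the edge just used, and as \<open>low\<close> is injective, no
  other edge leads up from it. The length is therefore at most the sum of the levels of both
  ends.\<close>

lemma path_length_le:
  assumes lay: "layering lev low r A" and p: "path H vs es" and H: "ends H = N" "set es \<subseteq> A"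
  shows "length es \<le> 2 * r"
proof (cases "es = []")
  case False
  have w: "walk H vs es" and dist: "distinct vs"
    using p unfolding path_def by auto
  note W = walk_nth[OF w]
  have A: "es ! i \<in> A" if "i < length es" for i
    using that H(2) by auto
  have ends: "N (es ! i) = {vs ! i, vs ! Suc i}" if "i < length es" for i
    using W(2)[OF that] H(1) by simp
  have low: "lev (vs ! Suc i) = Suc (lev (vs ! i)) \<and> low (es ! i) = vs ! Suc i \<and> lev (vs ! Suc i) \<le> r \<or>
      lev (vs ! i) = Suc (lev (vs ! Suc i)) \<and> low (es ! i) = vs ! i \<and> lev (vs ! i) \<le> r" if i: "i < length es" for i
    using layering_low[OF lay A[OF i] ends[OF i]]
      layering_low[OF lay A[OF i] ends[OF i, unfolded insert_commute[of "vs ! i"]]] by linarith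
  have turn: "low (es ! Suc i) \<noteq> vs ! Suc i" if "low (es ! i) = vs ! Suc i" "Suc i < length es" for i
  proof
    assume "low (es ! Suc i) = vs ! Suc i"
    then have "low (es ! Suc i) = low (es ! i)"
      using that(1) by simp
    then have "es ! Suc i = es ! i"
      using lay A[of i] A[of "Suc i"] that(2) unfolding layering_def by (auto dest: inj_onD)
    then have "{vs ! i, vs ! Suc i} = {vs ! Suc i, vs ! Suc (Suc i)}"
      using ends[of i] ends[of "Suc i"] that(2) by simp
    then have "vs ! i = vs ! Suc (Suc i)"
      by (metis doubleton_eq_iff)
    then show False
      using dist that(2) W(1) by (simp add: nth_eq_iff_index_eq)
  qed
  \<comment> \<open>If the last step did not descend, then no earlier one did, and the levels differ
    by exactly \<open>i\<close>; this is needed to continue climbing.\<close>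
  have "i \<le> lev (vs ! 0) + lev (vs ! i) \<and>
      (\<not> (0 < i \<and> low (es ! (i - 1)) = vs ! i) \<longrightarrow> lev (vs ! 0) = lev (vs ! i) + i)"
    if "i \<le> length es" for i
    using that
  proof (induction i)
    case (Suc i)
    then have IH: "i \<le> lev (vs ! 0) + lev (vs ! i)"
      "\<not> (0 < i \<and> low (es ! (i - 1)) = vs ! i) \<Longrightarrow> lev (vs ! 0) = lev (vs ! i) + i"
      by auto
    have i: "i < length es"
      using Suc.prems by simp
    have ne: "vs ! i \<noteq> vs ! Suc i"
      using dist i W(1) by (simp add: nth_eq_iff_index_eq)
    from low[OF i] show ?case
    proof
      assume "lev (vs ! Suc i) = Suc (lev (vs ! i)) \<and> low (es ! i) = vs ! Suc i \<and> lev (vs ! Suc i) \<le> r"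
      then show ?thesis
        using IH(1) by simp
    next
      assume up: "lev (vs ! i) = Suc (lev (vs ! Suc i)) \<and> low (es ! i) = vs ! i \<and> lev (vs ! i) \<le> r"
      have "\<not> (0 < i \<and> low (es ! (i - 1)) = vs ! i)"
        using turn[of "i - 1"] up i by auto
      then show ?thesis
        using IH(2) up by simp
    qed
  qed simp
  then have "length es \<le> lev (vs ! 0) + lev (vs ! length es)"
    by blast
  moreover have "lev (vs ! 0) \<le> r"
    using low[of 0] False by auto
  moreover have "lev (vs ! length es) \<le> r"
    using low[of "length es - 1"] False by auto
  ultimately show ?thesis
    by simp
qed simp

text \<open>At a vertex of maximal level both adjacent edges of the walk have it as their lower end
  and thus coincide. As the edges are distinct, only a loop remains, and the two ends of an edge
  have different levels.\<close>

lemma no_closed_walk: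
  assumes lay: "layering lev low r A" and w: "walk H vs es" and H: "ends H = N" "set es \<subseteq> A"
    and ne: "es \<noteq> []" and cl: "hd vs = last vs" and dist: "distinct es"
  shows False
proof -
  note W = walk_nth[OF w]
  define n where "n = length es"
  have n: "0 < n" "length vs = Suc n"
    using ne W(1) by (auto simp: n_def)
  have cl': "vs ! 0 = vs ! n"
    using cl n by (metis diff_Suc_1 hd_conv_nth last_conv_nth length_0_conv nat.distinct(1))
  have A: "es ! i \<in> A" if "i < n" for i
    using that H(2) by (auto simp: n_def)
  have ends: "N (es ! i) = {vs ! i, vs ! Suc i}" if "i < n" for i
    using W(2)[of i] that H(1) by (simp add: n_def)
  define m where "m = Max ((\<lambda>i. lev (vs ! i)) ` {..<n})"
  have "m \<in> (\<lambda>i. lev (vs ! i)) ` {..<n}"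
    unfolding m_def using n(1) by (intro Max_in) auto
  then obtain i where "i < n" "m = lev (vs ! i)"
    by blast
  moreover have "lev (vs ! j) \<le> m" if "j < n" for j
    unfolding m_def using that by (intro Max_ge) auto
  ultimately have i: "i < n" "\<And>j. j < n \<Longrightarrow> lev (vs ! j) \<le> lev (vs ! i)"
    by simp_all
  have max: "lev (vs ! j) \<le> lev (vs ! i)" if "j \<le> n" for j
    using i(2)[of j] i(2)[of 0] cl' n(1) that by (cases "j = n") auto
  \<comment> \<open>The edge that arrives at position \<open>i\<close>; for \<open>i = 0\<close>
    this is the last edge of the closed walk.\<close>
  define h where "h = (if i = 0 then n - 1 else i - 1)"
  have h: "h < n" "vs ! Suc h = vs ! i"
    using i(1) cl' n(1) by (auto simp: h_def)
  have e1: "low (es ! i) = vs ! i"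
    using layering_low(1)[OF lay A[OF i(1)], of "vs ! Suc i" "vs ! i"] ends[OF i(1)] max[of "Suc i"] i(1)
    by (simp add: insert_commute)
  have e2: "low (es ! h) = vs ! i"
    using layering_low(1)[OF lay A[OF h(1)], of "vs ! h" "vs ! i"] ends[OF h(1)] max[of h] h by simp
  have "es ! i = es ! h"
    using A[OF i(1)] A[OF h(1)] e1 e2 lay unfolding layering_def by (metis inj_onD)
  then have ih: "i = h"
    using dist i(1) h(1) by (simp add: nth_eq_iff_index_eq n_def)
  then have "vs ! Suc i = vs ! i"
    using h(2) by simp
  then show False
    using layering_low(2)[OF lay A[OF i(1)] ends[OF i(1)]] by simp
qed

text \<open>The vertex shared by two consecutive edges can be the tail of only one of them. Hence
  the orientation of the first edge propagates: forwards in one case, and in the other across the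
  closing point and backwards from the last edge.\<close>

lemma closed_walk_orientation:
  assumes w: "walk H vs es" and H: "ends H = N" and ne: "es \<noteq> []" and cl: "hd vs = last vs" and dist: "distinct es"
    and t: "inj_on t (set es)" "\<And>e. e \<in> set es \<Longrightarrow> t e \<in> N e"
  shows "(\<forall>i<length es. t (es ! i) = vs ! i) \<or> (\<forall>i<length es. t (es ! i) = vs ! Suc i)"
proof -
  note W = walk_nth[OF w]
  have cl': "vs ! 0 = vs ! length es"
    using cl W(1) by (metis diff_Suc_1 hd_conv_nth last_conv_nth length_0_conv nat.distinct(1))
  have te: "t (es ! i) = vs ! i \<or> t (es ! i) = vs ! Suc i" if "i < length es" for i
    using t(2)[of "es ! i"] W(2)[OF that] H that by auto
  have inj: "i = j" if "i < length es" "j < length es" "t (es ! i) = t (es ! j)" for i j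
    using that t(1) dist by (metis inj_on_def nth_eq_iff_index_eq nth_mem)
  show ?thesis
  proof (cases "t (es ! 0) = vs ! Suc 0")
    case True
    have "t (es ! i) = vs ! Suc i" if "i < length es" for i
      using that
    proof (induction i)
      case (Suc i)
      then show ?case
        using te[of "Suc i"] inj[of i "Suc i"] by auto
    qed (rule True)
    then show ?thesis
      by blast
  next
    case False
    have pos: "0 < length es"
      using ne by simp
    then have t0: "t (es ! 0) = vs ! 0"
      using te[of 0] False by blast
    have desc: "t (es ! (length es - Suc m)) = vs ! (length es - Suc m)" if "m < length es" for m
      using that
    proof (induction m)
      case 0
      show ?case
      proof (rule ccontr)
        assume neq: "t (es ! (length es - Suc 0)) \<noteq> vs ! (length es - Suc 0)"
        then have "t (es ! (length es - Suc 0)) = t (es ! 0)"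
          using te[of "length es - Suc 0"] pos t0 cl' by simp
        then have "length es - Suc 0 = 0"
          using inj[of "length es - Suc 0" 0] pos by simp
        then show False
          using neq t0 by simp
      qed
    next
      case (Suc m)
      define i where "i = length es - Suc (Suc m)"
      have i: "Suc i = length es - Suc m" "Suc i < length es"
        using Suc.prems by (auto simp: i_def)
      have "t (es ! Suc i) = vs ! Suc i"
        using Suc i by simp
      then have "t (es ! i) = vs ! i"
        using te[of i] inj[of i "Suc i"] i(2) by auto
      then show ?case
        by (simp add: i_def)
    qed
    have "t (es ! i) = vs ! i" if "i < length es" for i
    proof -
      have "length es - Suc (length es - Suc i) = i"
        using that by linarith
      then show ?thesis
        using desc[of "length es - Suc i"] that by simp
    qed
    then show ?thesis
      by blast
  qed
qed

text \<open>Two consequences that hold for both orientations, so that the direction of the walk need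
  not be distinguished later.\<close>

lemma closed_walk_properties:
  assumes w: "walk H vs es" and H: "ends H = N" and ne: "es \<noteq> []" and cl: "hd vs = last vs" and dist: "distinct es"
    and t: "inj_on t (set es)" "\<And>e. e \<in> set es \<Longrightarrow> t e \<in> N e"
  shows "v \<in> set vs \<Longrightarrow> \<exists>e\<in>set es. t e = v"
    and "\<lbrakk>\<And>e. e \<in> set es \<Longrightarrow> t e \<in> Z \<Longrightarrow> N e \<subseteq> Z; v \<in> Z; v \<in> set vs\<rbrakk> \<Longrightarrow> set vs \<subseteq> Z"
proof -
  note W = walk_nth[OF w]
  define n where "n = length es"
  have n: "0 < n" "length vs = Suc n"
    using ne W(1) by (auto simp: n_def)
  have cl': "vs ! 0 = vs ! n"
    using cl n by (metis diff_Suc_1 hd_conv_nth last_conv_nth length_0_conv nat.distinct(1))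
  have ends: "N (es ! i) = {vs ! i, vs ! Suc i}" "es ! i \<in> set es" if "i < n" for i
    using W(2)[of i] that H by (simp_all add: n_def)
  have or: "(\<forall>i<n. t (es ! i) = vs ! i) \<or> (\<forall>i<n. t (es ! i) = vs ! Suc i)"
    using closed_walk_orientation[OF assms(1-5) t] by (simp add: n_def)
  show "\<exists>e\<in>set es. t e = v" if v: "v \<in> set vs"
  proof -
    obtain i where i: "i \<le> n" "vs ! i = v"
      using v n(2) by (auto simp: in_set_conv_nth less_Suc_eq_le)
    from or show ?thesis
    proof
      assume f: "\<forall>i<n. t (es ! i) = vs ! i"
      show ?thesis
      proof (cases "i = n")
        case True
        then show ?thesis
          using f n(1) i cl' ends(2)[of 0] by (intro bexI[of _ "es ! 0"]) auto
      next
        case False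
        then show ?thesis
          using f i ends(2)[of i] by (intro bexI[of _ "es ! i"]) auto
      qed
    next
      assume b: "\<forall>i<n. t (es ! i) = vs ! Suc i"
      show ?thesis
      proof (cases i)
        case 0
        then show ?thesis
          using b n(1) i cl' ends(2)[of "n - 1"] by (intro bexI[of _ "es ! (n - 1)"]) auto
      next
        case (Suc j)
        then show ?thesis
          using b i ends(2)[of j] by (intro bexI[of _ "es ! j"]) auto
      qed
    qed
  qed
  show "set vs \<subseteq> Z" if Z: "\<And>e. e \<in> set es \<Longrightarrow> t e \<in> Z \<Longrightarrow> N e \<subseteq> Z" "v \<in> Z" "v \<in> set vs"
  proof -
    obtain a where a: "a \<le> n" "vs ! a \<in> Z"
      using Z(2,3) n(2) by (auto simp: in_set_conv_nth less_Suc_eq_le)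
    have "vs ! i \<in> Z" if "i \<le> n" for i
      using or
    proof
      assume f: "\<forall>i<n. t (es ! i) = vs ! i"
      have step: "vs ! Suc i \<in> Z" if "i < n" "vs ! i \<in> Z" for i
        using Z(1)[of "es ! i"] ends[of i] f that by auto
      have up: "vs ! j \<in> Z" if "i \<le> j" "j \<le> n" "vs ! i \<in> Z" for i j
        using that(1,2)
        by (induction j rule: dec_induct) (use that(3) step in auto)
      have "vs ! 0 \<in> Z"
        using up[of a n] a cl' by simp
      then show ?thesis
        using up[of 0 i] \<open>i \<le> n\<close> by simp
    next
      assume b: "\<forall>i<n. t (es ! i) = vs ! Suc i"
      have step: "vs ! i \<in> Z" if "i < n" "vs ! Suc i \<in> Z" for i
        using Z(1)[of "es ! i"] ends[of i] b that by auto
      have down: "vs ! i \<in> Z" if "i \<le> j" "j \<le> n" "vs ! j \<in> Z" for i j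
        using that(1)
        by (induction i rule: inc_induct) (use that(2,3) step in auto)
      have "vs ! n \<in> Z"
        using down[of 0 a] a cl' by simp
      then show ?thesis
        using down[of i n] \<open>i \<le> n\<close> by simp
    qed
    then show ?thesis
      using n(2) by (auto simp: in_set_conv_nth less_Suc_eq_le)
  qed
qed

lemma walk_invariant:
  assumes w: "walk H vs es" and H: "ends H = N" and S: "\<And>e u v. e \<in> edges H \<Longrightarrow> N e = {u, v} \<Longrightarrow> u \<in> S \<Longrightarrow> v \<in> S"
    and h: "hd vs \<in> S"
  shows "set vs \<subseteq> S"
proof -
  note W = walk_nth[OF w]
  have "vs ! i \<in> S" if "i \<le> length es" for i
    using that
  proof (induction i)
    case 0
    then show ?case
      using h W(1) by (metis hd_conv_nth length_0_conv nat.distinct(1))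
  next
    case (Suc i)
    then show ?case
      using S[OF W(4)[of i], of "vs ! i" "vs ! Suc i"] W(2)[of i] H by simp
  qed
  then show ?thesis
    using W(1) by (auto simp: in_set_conv_nth less_Suc_eq_le)
qed

text \<open>Each vertex is the tail \<open>t e\<close> of at most one edge \<open>e\<close>, so
  \<open>H\<close> is the graph of a partial function and a cycle is never left along an out-edge.
  The vertices from which \<open>C\<close> can be reached are closed under adjacency and so include
  those of \<open>C'\<close>. From \<open>C'\<close> one reaches \<open>C\<close> without leaving
  \<open>C'\<close>, so the cycles meet and must coincide.\<close>

lemma functional_pseudoforest:
  assumes H: "ends H = N" and t: "inj_on t (edges H)" "\<And>e. e \<in> edges H \<Longrightarrow> t e \<in> N e"
    and two: "\<And>e. e \<in> edges H \<Longrightarrow> \<exists>u v. N e = {u, v}"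
  shows "pseudoforest H"
  unfolding pseudoforest_def
proof (intro allI impI ballI)
  fix K C C'
  assume K: "component K H" and C: "C \<in> cycles K" and C': "C' \<in> cycles K"
  have KH: "edges K \<subseteq> edges H" "ends K = N" "connected_graph K"
    using K H unfolding component_def subgraph_def by auto
  obtain vs es where c: "walk K vs es" "es \<noteq> []" "hd vs = last vs" "distinct es"
    and Ceq: "C = \<lparr>verts = set vs, edges = set es, ends = ends K\<rparr>"
    using C unfolding cycles_def by blast
  obtain vs' es' where c': "walk K vs' es'" "es' \<noteq> []" "hd vs' = last vs'" "distinct es'"
    and C'eq: "C' = \<lparr>verts = set vs', edges = set es', ends = ends K\<rparr>"
    using C' unfolding cycles_def by blast
  have sub: "set es \<subseteq> edges H" "set es' \<subseteq> edges H" "set vs \<subseteq> verts K" "set vs' \<subseteq> verts K"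
    using c(1) c'(1) KH(1) unfolding walk_def by auto
  have inj: "inj_on t (set es)" "inj_on t (set es')"
    using t(1) sub inj_on_subset by blast+
  have te: "t e \<in> N e" if "e \<in> set es \<or> e \<in> set es'" for e
    using t(2) sub that by blast
  note P = closed_walk_properties[OF c(1) KH(2) c(2-4) inj(1) te]
  note P' = closed_walk_properties[OF c'(1) KH(2) c'(2-4) inj(2) te]
  have ends_sub: "N e \<subseteq> set vs" if "e \<in> set es" for e
    using walk_ends_subset[OF c(1) that] KH(2) by simp
  have ends_sub': "N e \<subseteq> set vs'" if "e \<in> set es'" for e
    using walk_ends_subset[OF c'(1) that] KH(2) by simp
  have out: "e \<in> set es" if "e \<in> edges H" "t e \<in> set vs" for e
    using P(1)[OF _ that(2)] that(1) sub(1) t(1) by (metis inj_onD subsetD)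
  have out': "e \<in> set es'" if "e \<in> edges H" "t e \<in> set vs'" for e
    using P'(1)[OF _ that(2)] that(1) sub(2) t(1) by (metis inj_onD subsetD)
  define nxt where "nxt = {(u, v). \<exists>e\<in>edges H. t e = u \<and> N e = {u, v}}"
  define S where "S = {u. \<exists>w\<in>set vs. (u, w) \<in> nxt\<^sup>*}"
  \<comment> \<open>If \<open>u\<close> reaches the cycle, either it lies on it, and then so does
    its out-edge, or its only out-edge is the first step of the way; in both cases \<open>v\<close>
    reaches the cycle.\<close>
  have nxt_S: "u \<in> S \<longleftrightarrow> v \<in> S" if uv: "e \<in> edges H" "t e = u" "N e = {u, v}" for e u v
  proof
    assume "v \<in> S"
    moreover have "(u, v) \<in> nxt"
      using uv unfolding nxt_def by blast
    ultimately show "u \<in> S"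
      unfolding S_def by (blast intro: converse_rtrancl_into_rtrancl)
  next
    assume "u \<in> S"
    then obtain w where w: "w \<in> set vs" "(u, w) \<in> nxt\<^sup>*"
      unfolding S_def by blast
    from w(2) show "v \<in> S"
    proof (cases rule: converse_rtranclE)
      case base
      then have "e \<in> set es"
        using out uv w(1) by blast
      then have "v \<in> set vs"
        using ends_sub uv(3) by blast
      then show ?thesis
        unfolding S_def by blast
    next
      case (step y)
      then obtain f where f: "f \<in> edges H" "t f = u" "N f = {u, y}"
        unfolding nxt_def by blast
      then have "f = e"
        using uv t(1) by (metis inj_onD)
      then have "y = v"
        using f(3) uv(3) by (metis doubleton_eq_iff)
      then show ?thesis
        using step(2) w(1) unfolding S_def by blast
    qed
  qed
  have adj_S: "v \<in> S" if "e \<in> edges K" "N e = {u, v}" "u \<in> S" for e u v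
  proof -
    have e: "e \<in> edges H"
      using that(1) KH(1) by blast
    then have "t e = u \<or> t e = v"
      using t(2) that(2) by blast
    then show ?thesis
      using nxt_S[OF e, of u v] nxt_S[OF e, of v u] that(2,3) by (auto simp: insert_commute)
  qed
  have hd_vs: "hd vs \<in> set vs" "hd vs' \<in> set vs'"
    using walk_nth(1)[OF c(1)] walk_nth(1)[OF c'(1)] by (metis hd_in_set list.size(3) nat.distinct(1))+
  obtain ps qs where "path_between K (hd vs) (hd vs') ps qs"
    using KH(3) hd_vs sub(3,4) unfolding connected_graph_def by blast
  then have ps: "walk K ps qs" "hd ps = hd vs" "last ps = hd vs'"
    unfolding path_between_def path_def by auto
  have "hd ps \<in> S"
    using ps(2) hd_vs(1) unfolding S_def by auto
  then have "set ps \<subseteq> S"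
    by (intro walk_invariant[OF ps(1) KH(2) adj_S])
  moreover have "last ps \<in> set ps"
    using walk_nth(1)[OF ps(1)] by (intro last_in_set) auto
  ultimately have "hd vs' \<in> S"
    using ps(3) by auto
  then obtain w where w: "w \<in> set vs" "(hd vs', w) \<in> nxt\<^sup>*"
    unfolding S_def by blast
  have "w \<in> set vs'"
    using w(2)
  proof (induction rule: rtrancl_induct)
    case (step y z)
    then obtain e where e: "e \<in> edges H" "t e = y" "N e = {y, z}"
      unfolding nxt_def by blast
    then have "e \<in> set es'"
      using out' step(3) by blast
    then show ?case
      using ends_sub' e(3) by blast
  qed (rule hd_vs(2))
  have "set vs \<subseteq> set vs'"
  proof (rule P(2)[OF _ _ \<open>w \<in> set vs'\<close> w(1)])
    show "N e \<subseteq> set vs'" if "e \<in> set es" "t e \<in> set vs'" for e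
      using out'[of e] that sub(1) ends_sub' by blast
  qed simp
  moreover have "set vs' \<subseteq> set vs"
  proof (rule P'(2)[OF _ _ w(1) \<open>w \<in> set vs'\<close>])
    show "N e \<subseteq> set vs" if "e \<in> set es'" "t e \<in> set vs" for e
      using out[of e] that sub(2) ends_sub by blast
  qed simp
  ultimately have V: "set vs = set vs'"
    by blast
  have "set es = {e \<in> edges H. t e \<in> set vs}"
    using out sub(1) ends_sub te by blast
  moreover have "set es' = {e \<in> edges H. t e \<in> set vs'}"
    using out' sub(2) ends_sub' te by blast
  ultimately have "set es = set es'"
    using V by simp
  then show "C = C'"
    using Ceq C'eq V by simp
qed

end

section \<open>Diameters, colour classes and the arithmetic of the bounds\<close>

lemma path_length_le_card:
  assumes "path H vs es" "finite (edges H)"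
  shows "length es \<le> card (edges H)"
proof -
  have w: "walk H vs es" and dist: "distinct vs"
    using assms(1) unfolding path_def by auto
  note W = walk_nth[OF w]
  have "distinct es"
  proof (rule ccontr)
    assume "\<not> ?thesis"
    then obtain i j where ij: "i < j" "j < length es" "es ! i = es ! j"
      by (metis distinct_conv_nth linorder_neqE_nat)
    then have "vs ! i \<in> {vs ! j, vs ! Suc j}"
      using W(2)[of i] W(2)[of j] by auto
    then have "i = j \<or> i = Suc j"
      using dist W(1) ij by (auto simp: nth_eq_iff_index_eq)
    then show False
      using ij(1) by auto
  qed
  then have "length es = card (set es)"
    by (simp add: distinct_card)
  also have "\<dots> \<le> card (edges H)"
    using w assms(2) unfolding walk_def by (intro card_mono) auto
  finally show ?thesis .
qed

lemma diam_le:
  assumes "connected_graph K" "finite (verts K)" and "\<And>vs es. path K vs es \<Longrightarrow> length es \<le> m"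
  shows "diam K \<le> m"
proof -
  let ?D = "{graph_dist K u v | u v. u \<in> verts K \<and> v \<in> verts K}"
  have "?D = (\<lambda>(u, v). graph_dist K u v) ` (verts K \<times> verts K)"
    by auto
  then have "finite ?D"
    using assms(2) by simp
  moreover obtain u where "u \<in> verts K"
    using assms(1) unfolding connected_graph_def by blast
  then have "?D \<noteq> {}"
    by blast
  moreover have "x \<le> m" if "x \<in> ?D" for x
  proof -
    obtain u v where uv: "x = graph_dist K u v" "u \<in> verts K" "v \<in> verts K"
      using \<open>x \<in> ?D\<close> by blast
    then obtain vs es where p: "path_between K u v vs es"
      using assms(1) unfolding connected_graph_def by blast
    then have "graph_dist K u v \<le> length es"
      unfolding graph_dist_def by (intro Least_le) blast
    moreover have "length es \<le> m"
      using p assms(3) unfolding path_between_def by blast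
    ultimately show ?thesis
      using uv(1) by simp
  qed
  ultimately show ?thesis
    unfolding diam_def by simp
qed

text \<open>The edges with a common tail are numbered from 0, and the number is the colour; no
  colour is repeated at a tail.\<close>

lemma color_classes:
  assumes "finite A" and "\<And>v. card {e \<in> A. t e = v} \<le> k"
  shows "\<exists>col. (\<forall>e\<in>A. col e < k) \<and> (\<forall>j. inj_on t {e \<in> A. col e = (j :: nat)})"
proof -
  have "\<exists>h. bij_betw h {e \<in> A. t e = v} {0..<card {e \<in> A. t e = v}}" for v
    using assms(1) by (intro ex_bij_betw_finite_nat) simp
  then obtain h where h: "\<And>v. bij_betw (h v) {e \<in> A. t e = v} {0..<card {e \<in> A. t e = v}}"
    by metis
  define col where "col e = h (t e) e" for e
  have "col e < k" if "e \<in> A" for e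
  proof -
    have "h (t e) e \<in> {0..<card {e' \<in> A. t e' = t e}}"
      using bij_betwE[OF h[of "t e"]] that by blast
    then show ?thesis
      using assms(2)[of "t e"] unfolding col_def by simp
  qed
  moreover have "inj_on t {e \<in> A. col e = j}" for j
  proof (rule inj_onI)
    fix e e' assume e: "e \<in> {e \<in> A. col e = j}" "e' \<in> {e \<in> A. col e = j}" "t e = t e'"
    then have "h (t e) e = h (t e) e'"
      unfolding col_def by auto
    then show "e = e'"
      using bij_betw_imp_inj_on[OF h[of "t e"]] e by (auto dest: inj_onD)
  qed
  ultimately show ?thesis
    by blast
qed

lemma mad_sparse:
  fixes G :: "('v, 'e) multigraph" and k d :: nat
  assumes fin: "finite_multigraph G" and mad: "mad G \<le> 2 * (real k + real d / (real d + real k + 1))"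
    and S: "S \<subseteq> verts G" "S \<noteq> {}" and X: "X \<subseteq> edges G" "\<And>e. e \<in> X \<Longrightarrow> ends G e \<subseteq> S"
  shows "card X * (d + k + 1) \<le> (k * (d + k + 1) + d) * card S"
proof -
  have wf: "wf_multigraph G" and finV: "finite (verts G)" and finE: "finite (edges G)"
    using fin unfolding finite_multigraph_def by auto
  define H where "H = \<lparr>verts = S, edges = X, ends = ends G\<rparr>"
  have H: "subgraph H G" "verts H \<noteq> {}"
    using wf S X unfolding subgraph_def wf_multigraph_def H_def by auto
  let ?D = "{2 * real (card (edges H)) / real (card (verts H)) | H. subgraph H G \<and> verts H \<noteq> {}}"
  have "?D \<subseteq> (\<lambda>(S, X). 2 * real (card X) / real (card S)) ` (Pow (verts G) \<times> Pow (edges G))"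
    unfolding subgraph_def by force
  then have "finite ?D"
    by (rule finite_subset) (use finV finE in simp)
  moreover have "2 * real (card X) / real (card S) \<in> ?D"
    using H unfolding H_def by force
  ultimately have "2 * real (card X) / real (card S) \<le> mad G"
    unfolding mad_def by (rule Max_ge)
  then have "real (card X) / real (card S) \<le> real k + real d / (real d + real k + 1)"
    using mad by simp
  moreover have S0: "real (card S) > 0"
    using S finV finite_subset by (fastforce simp: card_gt_0_iff)
  ultimately have "real (card X) \<le> (real k + real d / (real d + real k + 1)) * real (card S)"
    by (simp add: pos_divide_le_eq)
  then have "real (card X) * (real d + real k + 1) \<le>
      ((real k + real d / (real d + real k + 1)) * real (card S)) * (real d + real k + 1)"
    by (intro mult_right_mono) auto
  also have "\<dots> = (real k * (real d + real k + 1) + real d) * real (card S)"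
    by (simp add: field_simps)
  finally have "real (card X * (d + k + 1)) \<le> real ((k * (d + k + 1) + d) * card S)"
    by (simp only: of_nat_mult of_nat_add of_nat_1)
  then show ?thesis
    by (simp only: of_nat_le_iff)
qed

text \<open>Either \<open>r\<close> is small and \<open>D \<le> 2 * r\<close> decides, or
  \<open>r\<close> is large, the inequality forces \<open>e\<close> down, and
  \<open>D \<le> e\<close> decides. For \<open>d = 0\<close> the value of \<open>l\<close> is
  \<open>-1\<close>, which is why it is an integer.\<close>

lemma diam_bounds:
  fixes k d e r D :: nat and l :: int
  assumes k: "k \<ge> 1" and l: "l = \<lfloor>(real d - 1) / (real k + 1)\<rfloor>"
    and e: "e + (r - 1) * (k - 1) \<le> d" and D: "D \<le> 2 * r" "D \<le> e"
  shows "int D \<le> 2 * l + 2" and "[d = 1] (mod (k + 1)) \<Longrightarrow> int D \<le> 2 * l + 1"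
    and "int e \<ge> int d - int z * (int k - 1) + 1 \<Longrightarrow> D \<le> 2 * z"
proof -
  \<comment> \<open>The inequality stays true if \<open>r - 1\<close> is replaced by a smaller
    \<open>t\<close>; passing to integers here avoids truncated subtraction below.\<close>
  have large: "int e + t * (int k - 1) \<le> int d" if "0 \<le> t" "t \<le> int r - 1" for t
  proof -
    have "t * (int k - 1) \<le> (int r - 1) * (int k - 1)"
      using that k by (intro mult_right_mono) auto
    also have "\<dots> = int ((r - 1) * (k - 1))"
      using that k by (simp add: of_nat_diff)
    finally show ?thesis
      using e by linarith
  qed
  have "(real d - 1) / (real k + 1) < real_of_int l + 1"
    using l by linarith
  then have "real d - 1 < (real_of_int l + 1) * (real k + 1)"
    by (simp add: pos_divide_less_eq)
  then have "real_of_int (int d - 1) < real_of_int ((l + 1) * (int k + 1))"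
    by simp
  then have dl: "int d \<le> (l + 1) * (int k + 1)"
    by linarith
  have l1: "-1 \<le> l"
  proof -
    have "- (1 :: real) \<le> (real d - 1) / (real k + 1)"
      by (simp add: pos_le_divide_eq)
    then show ?thesis
      unfolding l by (simp add: le_floor_iff)
  qed
  show "int D \<le> 2 * l + 2"
  proof (cases "int r \<le> l + 1")
    case False
    then have "int e + (l + 1) * (int k - 1) \<le> int d"
      using l1 by (intro large) auto
    then have "int e \<le> 2 * (l + 1)"
      using dl by (simp add: algebra_simps)
    then show ?thesis
      using D(2) by simp
  qed (use D(1) in linarith)
  show "int D \<le> 2 * l + 1" if cong: "[d = 1] (mod (k + 1))"
  proof -
    have "d mod (k + 1) = 1"
      using cong k unfolding cong_def by simp
    then obtain m where m: "d = m * (k + 1) + 1"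
      using div_mult_mod_eq[of d "k + 1"] by metis
    have "(real d - 1) / (real k + 1) = real m"
      unfolding m by (simp add: field_simps)
    then have lm: "l = int m"
      unfolding l by simp
    show ?thesis
    proof (cases "int r \<le> l")
      case False
      then have "int e + l * (int k - 1) \<le> int d"
        unfolding lm by (intro large) auto
      then have "int e \<le> 2 * l + 1"
        unfolding lm m by (simp add: algebra_simps)
      then show ?thesis
        using D(2) by simp
    qed (use D(1) in linarith)
  qed
  show "D \<le> 2 * z" if z: "int e \<ge> int d - int z * (int k - 1) + 1"
  proof (cases "r \<le> z")
    case False
    then have "int e + int z * (int k - 1) \<le> int d"
      by (intro large) auto
    then show ?thesis
      using z by linarith
  qed (use D(1) in linarith)
qed

section \<open>From a state back to a decomposition of the graph\<close>

context sparse_graph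
begin

lemma state_edges:
  assumes "state E T B"
  shows "set_mset (\<Sum>s\<in>#T. em s) \<union> snd ` set_mset B = E"
    and "set_mset (\<Sum>s\<in>#T. em s) \<inter> snd ` set_mset B = {}"
    and "(v, e) \<in># B \<Longrightarrow> (w, e) \<in># B \<Longrightarrow> v = w"
proof -
  have eq: "(\<Sum>s\<in>#T. em s) + image_mset snd B = mset_set E"
    using stateD(3)[OF assms] .
  have "set_mset ((\<Sum>s\<in>#T. em s) + image_mset snd B) = E"
    unfolding eq using finite_E by simp
  then show "set_mset (\<Sum>s\<in>#T. em s) \<union> snd ` set_mset B = E"
    by simp
  have cnt: "count ((\<Sum>s\<in>#T. em s) + image_mset snd B) e \<le> 1" for e
    unfolding eq by (rule count_le_one_subset[OF subset_mset.order_refl])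
  show "set_mset (\<Sum>s\<in>#T. em s) \<inter> snd ` set_mset B = {}"
  proof (rule equals0I)
    fix e assume "e \<in> set_mset (\<Sum>s\<in>#T. em s) \<inter> snd ` set_mset B"
    then have "e \<in># (\<Sum>s\<in>#T. em s)" "e \<in># image_mset snd B"
      by auto
    then have "1 \<le> count (\<Sum>s\<in>#T. em s) e" "1 \<le> count (image_mset snd B) e"
      by (simp_all only: count_greater_eq_one_iff)
    then show False
      using cnt[of e] by (simp only: count_union)
  qed
  show "v = w" if "(v, e) \<in># B" "(w, e) \<in># B"
  proof (rule ccontr)
    assume "v \<noteq> w"
    obtain B1 where B1: "B = add_mset (v, e) B1"
      using multi_member_split[OF \<open>(v, e) \<in># B\<close>] by blast
    then have "(w, e) \<in># B1"
      using \<open>(w, e) \<in># B\<close> \<open>v \<noteq> w\<close> by simp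
    then obtain B' where "B = add_mset (v, e) (add_mset (w, e) B')"
      using B1 multi_member_split[of "(w, e)" B1] by blast
    then have "2 \<le> count (image_mset snd B) e"
      by simp
    then show False
      using cnt[of e] by (simp only: count_union)
  qed
qed

lemma red_tree:
  assumes st: "state E T B" and H: "edges H \<subseteq> set_mset (\<Sum>s\<in>#T. em s)" "ends H = N"
    and w: "walk H vs es" and s: "s \<in># T" "hd vs \<in># vm s"
  shows "set vs \<subseteq> set_mset (vm s)"
proof (rule walk_invariant[OF w H(2) _ s(2)])
  fix e u v assume e: "e \<in> edges H" "N e = {u, v}" "u \<in># vm s"
  then obtain s' where s': "s' \<in># T" "e \<in># em s'"
    using H(1) by auto
  have sub: "N e \<subseteq> set_mset (vm s')"
    using ends_in_vm[OF stateD(1)[OF st s'(1)] s'(2)] .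
  have "s = s'"
  proof (rule ccontr)
    assume "s \<noteq> s'"
    then obtain T' where "T = add_mset s (add_mset s' T')"
      using s(1) s'(1) by (metis insert_noteq_member multi_member_split)
    then show False
      using state_vm_disjoint[of E s s' T' B u] st e sub by auto
  qed
  then show "v \<in># vm s"
    using sub e(2) by auto
qed

lemma red_edges_in_tree:
  assumes st: "state E T B" and e: "e \<in># (\<Sum>s\<in>#T. em s)" "u \<in> N e" and s: "s \<in># T" "u \<in># vm s"
  shows "e \<in># em s"
proof -
  obtain s' where s': "s' \<in># T" "e \<in># em s'"
    using e(1) by auto
  have sub: "N e \<subseteq> set_mset (vm s')"
    using ends_in_vm[OF stateD(1)[OF st s'(1)] s'(2)] .
  have "s = s'"
  proof (rule ccontr)
    assume "s \<noteq> s'"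
    then obtain T' where "T = add_mset s (add_mset s' T')"
      using s(1) s'(1) by (metis insert_noteq_member multi_member_split)
    then show False
      using state_vm_disjoint[of E s s' T' B u] st e sub s by auto
  qed
  then show ?thesis
    using s'(2) by simp
qed

lemma red_acyclic:
  assumes st: "state E T B" and H: "edges H \<subseteq> set_mset (\<Sum>s\<in>#T. em s)" "ends H = N" "verts H \<subseteq> V"
  shows "cycles H = {}"
proof (rule ccontr)
  assume "cycles H \<noteq> {}"
  then obtain vs es where c: "walk H vs es" "es \<noteq> []" "hd vs = last vs" "distinct es"
    unfolding cycles_def by blast
  have "vs \<noteq> []"
    using walk_nth(1)[OF c(1)] by auto
  then have "hd vs \<in> V"
    using c(1) H(3) hd_in_set[of vs] unfolding walk_def by blast
  then obtain s where s: "s \<in># T" "hd vs \<in># vm s"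
    using state_vertex[OF st] by blast
  have vs: "set vs \<subseteq> set_mset (vm s)"
    using red_tree[OF st H(1,2) c(1) s] .
  have "set es \<subseteq> set_mset (em s)"
  proof
    fix e assume e: "e \<in> set es"
    then obtain i where i: "i < length es" "es ! i = e"
      by (auto simp: in_set_conv_nth)
    have "e \<in># (\<Sum>s\<in>#T. em s)"
      using walk_nth(4)[OF c(1) i(1)] i(2) H(1) by auto
    moreover have "vs ! i \<in> N e"
      using walk_nth(2)[OF c(1) i(1)] i(2) H(2) by simp
    moreover have "vs ! i \<in># vm s"
      using walk_nth(3)[OF c(1), of i] i(1) vs by auto
    ultimately show "e \<in># em s"
      using red_edges_in_tree[OF st _ _ s(1)] by blast
  qed
  moreover obtain lev low where "layering lev low (depth s) (set_mset (em s))"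
    using tree_layering[OF stateD(1)[OF st s(1)] state_count_vm[OF st s(1)]] by blast
  ultimately show False
    using no_closed_walk[OF _ c(1) H(2) _ c(2-4)] by blast
qed

text \<open>A component lies inside a single tree \<open>s\<close>, and \<open>good\<close> passes
  from the edges of \<open>s\<close> to those of the component. The radius \<open>r\<close> is that
  of a layering, not one measured in \<open>K\<close>.\<close>

lemma red_component:
  assumes st: "state E T B" and good: "\<forall>s\<in>#T. good (set_mset (em s))"
    and H: "edges H = set_mset (\<Sum>s\<in>#T. em s)" "ends H = N" "verts H = V"
    and K: "component K H"
  shows "\<exists>r. card (edges K) + (r - 1) * (k - 1) \<le> d \<and> diam K \<le> 2 * r \<and> diam K \<le> card (edges K)"
proof -
  have KH: "wf_multigraph K" "verts K \<subseteq> V" "edges K \<subseteq> set_mset (\<Sum>s\<in>#T. em s)" "ends K = N" "connected_graph K"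
    using K H unfolding component_def subgraph_def by auto
  have finK: "finite (verts K)" "finite (edges K)"
    using KH(2,3) finite_V finite_subset by (blast intro: finite_set_mset)+
  obtain u where u: "u \<in> verts K"
    using KH(5) unfolding connected_graph_def by blast
  then obtain s where s: "s \<in># T" "u \<in># vm s"
    using state_vertex[OF st] KH(2) by blast
  have vK: "verts K \<subseteq> set_mset (vm s)"
  proof
    fix v assume "v \<in> verts K"
    then obtain vs es where p: "walk K vs es" "hd vs = u" "last vs = v"
      using KH(5) u unfolding connected_graph_def path_between_def path_def by blast
    then have "set vs \<subseteq> set_mset (vm s)"
      using red_tree[OF st KH(3,4) p(1) s(1)] s(2) by blast
    moreover have "vs \<noteq> []"
      using walk_nth(1)[OF p(1)] by auto
    ultimately show "v \<in># vm s"
      using p(3) by auto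
  qed
  have eK: "edges K \<subseteq> set_mset (em s)"
  proof
    fix e assume e: "e \<in> edges K"
    then have "N e \<subseteq> verts K" "N e \<noteq> {}"
      using KH(1,4) unfolding wf_multigraph_def by fastforce+
    then obtain w where w: "w \<in> N e" "w \<in># vm s"
      using vK by blast
    then show "e \<in># em s"
      using red_edges_in_tree[OF st _ w(1) s(1) w(2)] e KH(3) by blast
  qed
  have "good (edges K)"
    using good_mono[OF _ eK] good s(1) by auto
  then obtain r lev low where r: "layering lev low r (edges K)" "card (edges K) + (r - 1) * (k - 1) \<le> d"
    unfolding good_def by blast
  have "diam K \<le> 2 * r"
  proof (rule diam_le[OF KH(5) finK(1)])
    fix vs es assume p: "path K vs es"
    then have "set es \<subseteq> edges K"
      unfolding path_def walk_def by blast
    then show "length es \<le> 2 * r"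
      using path_length_le[OF r(1) p KH(4)] by blast
  qed
  moreover have "diam K \<le> card (edges K)"
    using diam_le[OF KH(5) finK(1)] path_length_le_card finK(2) by blast
  ultimately show ?thesis
    using r(2) by blast
qed

lemma blue_classes:
  assumes st: "state E T B"
  shows "\<exists>t col. (\<forall>e\<in>snd ` set_mset B. t e \<in> N e \<and> col e < k) \<and>
    (\<forall>j :: nat. inj_on t {e \<in> snd ` set_mset B. col e = j})"
proof -
  define A where "A = snd ` set_mset B"
  define t where "t e = (SOME v. (v, e) \<in># B)" for e
  have t: "(t e, e) \<in># B" if "e \<in> A" for e
    using that unfolding A_def t_def by (auto intro: someI)
  have "card {e \<in> A. t e = v} \<le> k" for v
  proof -
    let ?C = "filter_mset (\<lambda>p. fst p = v) B"
    have "{e \<in> A. t e = v} \<subseteq> snd ` set_mset ?C"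
      using t by force
    then have "card {e \<in> A. t e = v} \<le> card (set_mset ?C)"
      by (meson card_image_le card_mono finite_imageI finite_set_mset le_trans)
    also have "\<dots> \<le> size ?C"
      by (rule card_set_mset_le_size)
    also have "\<dots> = count (image_mset fst B) v"
      by (induction B) auto
    also have "\<dots> \<le> k"
      using stateD(5)[OF st] .
    finally show ?thesis .
  qed
  moreover have "finite A"
    unfolding A_def by simp
  ultimately obtain col where "\<forall>e\<in>A. col e < k" "\<forall>j :: nat. inj_on t {e \<in> A. col e = j}"
    using color_classes[of A t k] by blast
  moreover have "t e \<in> N e" if "e \<in> A" for e
    using stateD(4)[OF st t[OF that]] .
  ultimately show ?thesis
    unfolding A_def by blast
qed

end

theorem theorem1p6:
  fixes G :: "('v, 'e) multigraph" and k d :: nat and l :: int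
  assumes "k \<ge> 1"
    and "l = \<lfloor>(real d - 1) / (real k + 1)\<rfloor>"
    and "finite_multigraph G"
    and "mad G \<le> 2 * (real k + real d / (real d + real k + 1))"
  shows "\<exists>Fs F. length Fs = k + 1 \<and> decomposition G Fs \<and> (\<forall>H\<in>set Fs. pseudoforest H) \<and>
    F \<in> set Fs \<and>
    acyclic_graph F \<and>
    (\<forall>K. component K F \<longrightarrow> card (edges K) \<le> d) \<and>
    (\<forall>K. component K F \<longrightarrow>
       int (diam K) \<le> 2 * l + 2 \<and> ([d = 1] (mod (k + 1)) \<longrightarrow> int (diam K) \<le> 2 * l + 1)) \<and>
    (\<forall>z::nat. \<forall>K. component K F \<and> int (card (edges K)) \<ge> int d - int z * (int k - 1) + 1
       \<longrightarrow> diam K \<le> 2 * z)"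
proof -
  have wf: "wf_multigraph G" and fin: "finite (verts G)" "finite (edges G)"
    using assms(3) unfolding finite_multigraph_def by auto
  interpret sparse_graph "ends G" "verts G" "edges G" k d
  proof (rule sparse_graph.intro)
    show "finite (verts G)" "finite (edges G)" "k \<ge> 1"
      by (fact fin assms(1))+
    show "ends G e \<subseteq> verts G \<and> (card (ends G e) = 1 \<or> card (ends G e) = 2)" if "e \<in> edges G" for e
      using wf[unfolded wf_multigraph_def] that by (rule bspec)
    show "card X * (d + k + 1) \<le> (k * (d + k + 1) + d) * card S"
      if "S \<subseteq> verts G" "S \<noteq> {}" "X \<subseteq> edges G" "\<And>e. e \<in> X \<Longrightarrow> ends G e \<subseteq> S" for S X
      by (rule mad_sparse[OF assms(3,4) that])
  qed
  obtain T B where st: "state (edges G) T B" and good: "\<forall>s\<in>#T. good (set_mset (em s))"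
    using exists_good_state by blast
  note E = state_edges[OF st]
  obtain t col where tc: "\<forall>e\<in>snd ` set_mset B. t e \<in> ends G e \<and> col e < k"
    and inj: "\<forall>j :: nat. inj_on t {e \<in> snd ` set_mset B. col e = j}"
    using blue_classes[OF st] by (elim exE conjE)
  have t: "t e \<in> ends G e" and col: "col e < k" if "e \<in> snd ` set_mset B" for e
    using bspec[OF tc that] by simp_all
  define part where "part X = \<lparr>verts = verts G, edges = X, ends = ends G\<rparr>" for X
  define F where "F = part (set_mset (\<Sum>s\<in>#T. em s))"
  define P where "P j = part {e \<in> snd ` set_mset B. col e = j}" for j
  \<comment> \<open>The red forest and \<open>k\<close> colour classes of blue edges, all spanning
    and some possibly without edges.\<close>
  define Fs where "Fs = F # map P [0..<k]"
  have FsE: "H \<in> set Fs \<longleftrightarrow> H = F \<or> (\<exists>j<k. H = P j)" for H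
    unfolding Fs_def by auto
  have F: "edges F = set_mset (\<Sum>s\<in>#T. em s)" "ends F = ends G" "verts F = verts G"
    unfolding F_def part_def by simp_all
  have P: "edges (P j) = {e \<in> snd ` set_mset B. col e = j}" "ends (P j) = ends G" "verts (P j) = verts G" for j
    unfolding P_def part_def by simp_all
  have sub: "edges H \<subseteq> edges G \<and> ends H = ends G \<and> verts H = verts G" if "H \<in> set Fs" for H
    using that E(1) F P unfolding FsE by auto
  have dec: "decomposition G Fs"
    unfolding decomposition_def
  proof (intro conjI ballI allI impI)
    fix H assume "H \<in> set Fs"
    then show "subgraph H G" "verts H = verts G"
      using sub[of H] wf unfolding subgraph_def wf_multigraph_def by auto
  next
    have "\<Union> (edges ` set Fs) = edges F \<union> (\<Union>j<k. edges (P j))"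
      unfolding Fs_def by auto
    also have "(\<Union>j<k. edges (P j)) = snd ` set_mset B"
      using col unfolding P by auto
    finally show "(\<Union>H\<in>set Fs. edges H) = edges G"
      using E(1) unfolding F by simp
  next
    fix i j assume ij: "i < length Fs" "j < length Fs" "i \<noteq> j"
    have nth: "edges (Fs ! Suc m) = {e \<in> snd ` set_mset B. col e = m}" if "Suc m < length Fs" for m
      using that P(1)[of m] unfolding Fs_def by simp
    have nth0: "edges (Fs ! 0) = set_mset (\<Sum>s\<in>#T. em s)"
      using F(1) unfolding Fs_def by simp
    show "edges (Fs ! i) \<inter> edges (Fs ! j) = {}"
      using ij E(2) nth nth0 by (cases i; cases j) auto
  qed
  have acyc: "cycles F = {}"
    using red_acyclic[OF st, of F] F by simp
  have pf: "pseudoforest H" if "H \<in> set Fs" for H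
  proof (cases "H = F")
    case True
    show ?thesis
      unfolding pseudoforest_def
    proof (intro allI impI)
      fix K assume "component K H"
      then have "subgraph K F"
        unfolding True component_def by (rule conjunct1)
      then have "verts K \<subseteq> verts F \<and> edges K \<subseteq> edges F \<and> ends K = ends F"
        unfolding subgraph_def by (rule conjunct2)
      then have K: "edges K \<subseteq> set_mset (\<Sum>s\<in>#T. em s)" "ends K = ends G" "verts K \<subseteq> verts G"
        unfolding F by blast+
      have "cycles K = {}"
        by (rule red_acyclic[OF st K])
      then show "\<forall>C\<in>cycles K. \<forall>C'\<in>cycles K. C = C'"
        by simp
    qed
  next
    case False
    with that[unfolded FsE] obtain j where j: "H = P j"
      by (elim disjE exE conjE) simp_all
    show ?thesis
    proof (rule functional_pseudoforest)
      have eH: "edges H = {e \<in> snd ` set_mset B. col e = j}"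
        unfolding j by (rule P(1))
      show "ends H = ends G"
        unfolding j by (rule P(2))
      show "inj_on t (edges H)"
        unfolding eH using inj by (rule spec)
      show "t e \<in> ends G e" if "e \<in> edges H" for e
        using t that unfolding eH by (elim CollectE conjE)
      show "\<exists>u v. ends G e = {u, v}" if e: "e \<in> edges H" for e
      proof -
        have "e \<in> edges G"
          using sub[OF \<open>H \<in> set Fs\<close>, THEN conjunct1] e by (rule subsetD)
        then obtain a b where "ends G e = {a, b}"
          by (rule ends_obtain)
        then show ?thesis
          by (intro exI)
      qed
    qed
  qed
  \<comment> \<open>One radius per component serves all the remaining conditions.\<close>
  have comp: "\<exists>r. card (edges K) + (r - 1) * (k - 1) \<le> d \<and> diam K \<le> 2 * r \<and> diam K \<le> card (edges K)"
    if "component K F" for K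
    using red_component[OF st good F that] .
  have c1: "\<forall>K. component K F \<longrightarrow> card (edges K) \<le> d"
  proof (intro allI impI)
    fix K assume "component K F"
    from comp[OF this] obtain r where "card (edges K) + (r - 1) * (k - 1) \<le> d"
      by (elim exE conjE)
    then show "card (edges K) \<le> d"
      by (rule add_leD1)
  qed
  have c2: "\<forall>K. component K F \<longrightarrow>
      int (diam K) \<le> 2 * l + 2 \<and> ([d = 1] (mod (k + 1)) \<longrightarrow> int (diam K) \<le> 2 * l + 1)"
  proof (intro allI impI)
    fix K assume "component K F"
    from comp[OF this] obtain r where r: "card (edges K) + (r - 1) * (k - 1) \<le> d" "diam K \<le> 2 * r" "diam K \<le> card (edges K)"
      by (elim exE conjE)
    show "int (diam K) \<le> 2 * l + 2 \<and> ([d = 1] (mod (k + 1)) \<longrightarrow> int (diam K) \<le> 2 * l + 1)"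
      by (intro conjI impI diam_bounds(1)[OF assms(1,2) r] diam_bounds(2)[OF assms(1,2) r])
  qed
  have c3: "\<forall>z::nat. \<forall>K. component K F \<and> int (card (edges K)) \<ge> int d - int z * (int k - 1) + 1
      \<longrightarrow> diam K \<le> 2 * z"
  proof (intro allI impI, elim conjE)
    fix z :: nat and K
    assume K: "component K F" and z: "int (card (edges K)) \<ge> int d - int z * (int k - 1) + 1"
    obtain r where r: "card (edges K) + (r - 1) * (k - 1) \<le> d" "diam K \<le> 2 * r" "diam K \<le> card (edges K)"
      using comp[OF K] by (elim exE conjE)
    show "diam K \<le> 2 * z"
      using diam_bounds(3)[OF assms(1,2) r z] .
  qed
  have len: "length Fs = k + 1" and memF: "F \<in> set Fs"
    unfolding Fs_def by simp_all
  have ac: "acyclic_graph F"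
    unfolding acyclic_graph_def by (rule acyc)
  show ?thesis
    by (rule exI[of _ Fs], rule exI[of _ F]) (intro conjI len dec memF ac c1 c2 c3 ballI pf)
qed

end
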